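(* Let $U \subset \mathbb H_{\mathbb R}$ be an open bounded subset with piecewise $\mathcal C^1$ boundary $\partial U$, and let $f$ be a $\mathcal C^1$-function, with values in $\mathbb H_{\mathbb R}$ or $\mathbb H_{\mathbb C}$, defined on a neighborhood (in $\mathbb H_{\mathbb R}$) of the closure $\overline U$ and such that $\nabla^+_{\mathbb R} f = 0$. Suppose that $f$ extends to a holomorphic left-regular function $f^{\mathbb C} : V^{\mathbb C} \to \mathbb H_{\mathbb C}$, where $V^{\mathbb C} \subset \mathbb H_{\mathbb C}$ is an open subset containing $\overline U$. Then for every $X_0 \in \mathbb H_{\mathbb R}$ with $X_0\notin\partial U$, $$ - \frac 1 {2\pi^2} \int_{(h_{\epsilon, X_0})_*(\partial U)} \frac {(Z-X_0)^{-1}} {N(Z-X_0)} \cdot Dz \cdot f^{\mathbb C}(Z) = \begin{cases} f(X_0) & \text{if } X_0 \in U;\\ 0 & \text{if } X_0 \notin \overline{U}, \end{cases} $$ for all real $\epsilon \ne 0$ sufficiently close to $0$.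
   Context: $\mathbb H_{\mathbb C}$ is the algebra of complex $2\times 2$ matrices (complexified quaternions), with complex basis $e_0 = \begin{pmatrix} 1&0\\ 0&1\end{pmatrix}$, $e_1 = \begin{pmatrix} 0&-i\\ -i&0\end{pmatrix}$, $e_2=\begin{pmatrix}0&-1\\ 1&0\end{pmatrix}$, $e_3=\begin{pmatrix}-i&0\\ 0&i\end{pmatrix}$; write $Z = z^0e_0+z^1e_1+z^2e_2+z^3e_3$, $z^j\in\mathbb C$. Put $N(Z)=\det Z = (z^0)^2+(z^1)^2+(z^2)^2+(z^3)^2$. When $N(Z)\neq 0$, $Z^{-1}$ is the matrix inverse. The split quaternions $\mathbb H_{\mathbb R}\subset\mathbb H_{\mathbb C}$ are the real span of $e_0$, $\tilde e_1 = ie_1$, $\tilde e_2=-ie_2$, $e_3$; write $X=x^0e_0+x^1\tilde e_1+x^2\tilde e_2+x^3e_3$, $x^j\in\mathbb R$. $\mathbb H_{\mathbb R}$ is oriented so that $\{e_0,\tilde e_1,\tilde e_2,e_3\}$ is positive, and $\partial U$ carries the boundary orientation (outward normal first). For $f$ on an open subset of $\mathbb H_{\mathbb R}$ with values in $\mathbb H_{\mathbb R}$ or $\mathbb H_{\mathbb C}$, $\nabla^+_{\mathbb R} f = e_0\frac{\partial f}{\partial x^0} - \tilde e_1\frac{\partial f}{\partial x^1}-\tilde e_2\frac{\partial f}{\partial x^2}+e_3\frac{\partial f}{\partial x^3}$. A function $f^{\mathbb C}:V^{\mathbb C}\to\mathbb H_{\mathbb C}$ on an open set $V^{\mathbb C}\subset\mathbb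 H_{\mathbb C}$ is holomorphic left-regular if it is holomorphic in $z^0,\dots,z^3$ and $e_0\frac{\partial f^{\mathbb C}}{\partial z^0}+e_1\frac{\partial f^{\mathbb C}}{\partial z^1}+e_2\frac{\partial f^{\mathbb C}}{\partial z^2}+e_3\frac{\partial f^{\mathbb C}}{\partial z^3}=0$. $Dz$ is the holomorphic $\mathbb H_{\mathbb C}$-valued 3-form on $\mathbb H_{\mathbb C}$ $$Dz = e_0\, dz^1\wedge dz^2\wedge dz^3 - e_1\, dz^0\wedge dz^2\wedge dz^3 + e_2\, dz^0\wedge dz^1\wedge dz^3 - e_3\, dz^0\wedge dz^1\wedge dz^2 ;$$ products in the integrand are matrix products, in the order written. The involution $Z\mapsto Z^-$ is $\begin{pmatrix} z_{11}&z_{12}\\ z_{21}&z_{22}\end{pmatrix}\mapsto\begin{pmatrix} z_{11}&-z_{12}\\ -z_{21}&z_{22}\end{pmatrix}$, and for $\epsilon\in\mathbb R$, $h_{\epsilon,X_0}:\mathbb H_{\mathbb C}\to\mathbb H_{\mathbb C}$ is $h_{\epsilon,X_0}(Z)=Z+i\epsilon (Z-X_0)^-$. The contour $(h_{\epsilon,X_0})_*(\partial U)$ is the image (push-forward) of the oriented cycle $\partial U$. How close $\epsilon$ must be to $0$ may depend on $X_0$; for such $\epsilon\neq0$ the contour lies in $V^{\mathbb C}$ and the integrand is non-singular on it. *)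

theory Defs
  imports "HOL-Analysis.Analysis"
begin

section \<open>Complexified quaternions\<close>

type_synonym HC = "complex^2^2"

text \<open>The library has no multiplication of a complex matrix by a complex scalar
  (\<open>*s\<close> would act on the rows by a vector).\<close>

definition cscale :: "complex \<Rightarrow> HC \<Rightarrow> HC"  (infixr \<open>*\<^sub>c\<close> 75)
  where "c *\<^sub>c A = (\<chi> i j. c * A $ i $ j)"

definition e0 :: HC where "e0 = vector [vector [1, 0], vector [0, 1]]"
definition e1 :: HC where "e1 = vector [vector [0, -\<i>], vector [-\<i>, 0]]"
definition e2 :: HC where "e2 = vector [vector [0, -1], vector [1, 0]]"
definition e3 :: HC where "e3 = vector [vector [-\<i>, 0], vector [0, \<i>]]"

definition te1 :: HC where "te1 = \<i> *\<^sub>c e1"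
definition te2 :: HC where "te2 = (-\<i>) *\<^sub>c e2"

definition qnorm :: "HC \<Rightarrow> complex" where "qnorm Z = det Z"

definition qminus :: "HC \<Rightarrow> HC"
  where "qminus Z = vector [vector [Z$1$1, - Z$1$2], vector [- Z$2$1, Z$2$2]]"

text \<open>The complex coordinates $z^0, \dots, z^3$ with respect to the basis \<open>e0, e1, e2, e3\<close>.
  They are indexed by the numeral type \<open>4\<close>, whose elements are \<open>0, 1, 2, 3\<close>.\<close>

definition zcoord :: "4 \<Rightarrow> HC \<Rightarrow> complex"
  where "zcoord k Z =
    (if k = 0 then (Z$1$1 + Z$2$2) / 2
     else if k = 1 then \<i> * (Z$1$2 + Z$2$1) / 2
     else if k = 2 then (Z$2$1 - Z$1$2) / 2
     else \<i> * (Z$1$1 - Z$2$2) / 2)"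

lemma zcoord_expansion:
  "Z = zcoord 0 Z *\<^sub>c e0 + zcoord 1 Z *\<^sub>c e1 + zcoord 2 Z *\<^sub>c e2 + zcoord 3 Z *\<^sub>c e3"
  by (simp add: vec_eq_iff forall_2 cscale_def zcoord_def e0_def e1_def e2_def e3_def field_simps)

lemma zcoord_basis:
  "zcoord k (a *\<^sub>c e0 + b *\<^sub>c e1 + c *\<^sub>c e2 + d *\<^sub>c e3) =
    (if k = 0 then a else if k = 1 then b else if k = 2 then c else d)"
  by (simp add: cscale_def zcoord_def e0_def e1_def e2_def e3_def field_simps)

lemma qnorm_zcoord:
  "qnorm Z = (zcoord 0 Z)\<^sup>2 + (zcoord 1 Z)\<^sup>2 + (zcoord 2 Z)\<^sup>2 + (zcoord 3 Z)\<^sup>2"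
  by (simp add: qnorm_def det_2 zcoord_def power2_eq_square field_simps)


section \<open>Split quaternions\<close>

text \<open>The real form is handled through its linear coordinates $x^0, \dots, x^3$: a point of
  it is a vector \<open>x :: real^4\<close>, and \<open>hr x\<close> is the corresponding matrix. Topology,
  differentiability and orientation of the real form are those of \<open>real^4\<close>.\<close>

definition hr :: "real^4 \<Rightarrow> HC"
  where "hr x = x$0 *\<^sub>R e0 + x$1 *\<^sub>R te1 + x$2 *\<^sub>R te2 + x$3 *\<^sub>R e3"

lemma zcoord_hr:
  "zcoord 0 (hr x) = x$0" "zcoord 1 (hr x) = \<i> * x$1"
  "zcoord 2 (hr x) = - \<i> * x$2" "zcoord 3 (hr x) = x$3"
  by (simp_all add: zcoord_def hr_def te1_def te2_def cscale_def e0_def e1_def e2_def e3_def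
      scaleR_conv_of_real[where 'a = complex] field_simps)

definition rpartial :: "('a::finite) \<Rightarrow> (real^'a \<Rightarrow> 'b::real_normed_vector) \<Rightarrow> real^'a \<Rightarrow> 'b"
  where "rpartial k f x = vector_derivative (\<lambda>t. f (x + t *\<^sub>R axis k 1)) (at 0)"

definition C1_on :: "('a::real_normed_vector \<Rightarrow> 'b::real_normed_vector) \<Rightarrow> 'a set \<Rightarrow> bool"
  where "C1_on f S \<longleftrightarrow>
    (\<exists>f'. (\<forall>x\<in>S. (f has_derivative blinfun_apply (f' x)) (at x)) \<and> continuous_on S f')"

definition nablaR_plus :: "(real^4 \<Rightarrow> HC) \<Rightarrow> real^4 \<Rightarrow> HC"
  where "nablaR_plus f x =
    e0 ** rpartial 0 f x - te1 ** rpartial 1 f x - te2 ** rpartial 2 f x + e3 ** rpartial 3 f x"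


section \<open>Holomorphic left-regular functions\<close>

definition holomorphic_HC :: "(HC \<Rightarrow> HC) \<Rightarrow> HC set \<Rightarrow> bool"
  where "holomorphic_HC f V \<longleftrightarrow>
    (\<forall>Z\<in>V. \<exists>f'. (f has_derivative f') (at Z) \<and> (\<forall>c A. f' (c *\<^sub>c A) = c *\<^sub>c f' A))"

text \<open>For \<open>E = ek\<close> this is the entrywise partial derivative with respect to $z^k$.\<close>

definition cpartial :: "HC \<Rightarrow> (HC \<Rightarrow> HC) \<Rightarrow> HC \<Rightarrow> HC"
  where "cpartial E f Z = (\<chi> i j. deriv (\<lambda>t. f (Z + t *\<^sub>c E) $ i $ j) 0)"

definition hol_left_regular :: "(HC \<Rightarrow> HC) \<Rightarrow> HC set \<Rightarrow> bool"
  where "hol_left_regular f V \<longleftrightarrow> holomorphic_HC f V \<and>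
    (\<forall>Z\<in>V. e0 ** cpartial e0 f Z + e1 ** cpartial e1 f Z
          + e2 ** cpartial e2 f Z + e3 ** cpartial e3 f Z = 0)"


section \<open>Differential 3-forms and their integrals\<close>

text \<open>\<open>dz3 i j k\<close> is $dz^i \wedge dz^j \wedge dz^k$; a 3-form at a point is represented by
  its values on triples of tangent vectors.\<close>

definition dz3 :: "4 \<Rightarrow> 4 \<Rightarrow> 4 \<Rightarrow> HC \<Rightarrow> HC \<Rightarrow> HC \<Rightarrow> complex"
  where "dz3 i j k A B C = det (vector
    [vector [zcoord i A, zcoord i B, zcoord i C],
     vector [zcoord j A, zcoord j B, zcoord j C],
     vector [zcoord k A, zcoord k B, zcoord k C]] :: complex^3^3)"

definition Dz :: "HC \<Rightarrow> HC \<Rightarrow> HC \<Rightarrow> HC"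
  where "Dz A B C = dz3 1 2 3 A B C *\<^sub>c e0 - dz3 0 2 3 A B C *\<^sub>c e1
                  + dz3 0 1 3 A B C *\<^sub>c e2 - dz3 0 1 2 A B C *\<^sub>c e3"

text \<open>The integral of a 3-form \<open>\<omega>\<close> over the chain of the patches
  \<open>\<psi> i : D i \<rightarrow> HC\<close> (\<open>i < m\<close>), each oriented by the standard orientation of its parameter
  domain. Replacing \<open>\<psi> i\<close> by \<open>h \<circ> \<psi> i\<close> gives the push-forward of the chain under \<open>h\<close>.\<close>

definition chain_integral ::
  "nat \<Rightarrow> (nat \<Rightarrow> (real^3) set) \<Rightarrow> (nat \<Rightarrow> real^3 \<Rightarrow> HC) \<Rightarrow>
   (HC \<Rightarrow> HC \<Rightarrow> HC \<Rightarrow> HC \<Rightarrow> HC) \<Rightarrow> HC"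
  where "chain_integral m D \<psi> \<omega> =
    (\<Sum>i<m. integral (D i)
      (\<lambda>u. \<omega> (\<psi> i u) (rpartial 1 (\<psi> i) u) (rpartial 2 (\<psi> i) u) (rpartial 3 (\<psi> i) u)))"


section \<open>Piecewise continuously differentiable oriented boundary\<close>

text \<open>The list form \<open>vector [v, a, b, c] :: real^4^4\<close> numbers the rows \<open>1, 2, 3, 4 = 0\<close>,
  an odd permutation of the coordinate order \<open>0, 1, 2, 3\<close>; hence the explicit rows.
  The value is positive iff \<open>v, a, b, c\<close> is oriented like \<open>e0, te1, te2, e3\<close>.\<close>

definition det4 :: "real^4 \<Rightarrow> real^4 \<Rightarrow> real^4 \<Rightarrow> real^4 \<Rightarrow> real"
  where "det4 v a b c =
    det ((\<chi> i. if i = 0 then v else if i = 1 then a else if i = 2 then b else c) :: real^4^4)"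

lemma det4_standard: "det4 (axis 0 1) (axis 1 1) (axis 2 1) (axis 3 1) = 1"
proof -
  have "k = 3" if "k \<noteq> 0" "k \<noteq> 1" "k \<noteq> 2" for k :: 4
    using that exhaust_4[of k] by auto
  then have "(\<chi> i. if i = 0 then axis 0 1 else if i = 1 then axis 1 1
      else if i = 2 then axis 2 1 else axis 3 1) = (mat 1 :: real^4^4)"
    by (auto simp: vec_eq_iff mat_def axis_def)
  then show ?thesis
    by (simp add: det4_def)
qed

text \<open>The patches \<open>\<phi> i : D i \<rightarrow> real^4\<close> (\<open>i < m\<close>) decompose the boundary of \<open>U\<close> into finitely
  many pieces, each continuously differentiable up to its edges: off the edges every piece is
  an embedded hypersurface disjoint from all the other pieces, with \<open>U\<close> on exactly one side,
  and oriented by the rule ``outward vector first''. The parameter domains are compact with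
  negligible frontier (cubes, simplices, balls, ...). An open set has piecewise continuously
  differentiable boundary if it admits such a decomposition.\<close>

definition oriented_C1_boundary ::
  "(real^4) set \<Rightarrow> nat \<Rightarrow> (nat \<Rightarrow> (real^3) set) \<Rightarrow> (nat \<Rightarrow> real^3 \<Rightarrow> real^4) \<Rightarrow> bool"
  where "oriented_C1_boundary U m D \<phi> \<longleftrightarrow>
    (\<forall>i<m. compact (D i) \<and> negligible (frontier (D i)) \<and>
       (\<exists>N. open N \<and> D i \<subseteq> N \<and> C1_on (\<phi> i) N)) \<and>
    frontier U = (\<Union>i<m. \<phi> i ` D i) \<and>
    (\<forall>i<m. \<forall>u\<in>interior (D i). \<forall>j<m. \<forall>w\<in>D j. \<phi> i u = \<phi> j w \<longrightarrow> i = j \<and> u = w) \<and>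
    (\<forall>i<m. \<forall>u\<in>interior (D i).
       inj (frechet_derivative (\<phi> i) (at u)) \<and>
       (\<forall>v. det4 v (rpartial 1 (\<phi> i) u) (rpartial 2 (\<phi> i) u) (rpartial 3 (\<phi> i) u) > 0 \<longrightarrow>
          (\<forall>\<^sub>F t in at_right 0. \<phi> i u + t *\<^sub>R v \<notin> closure U \<and> \<phi> i u - t *\<^sub>R v \<in> U)))"


section \<open>The deformation of the contour and the integrand\<close>

definition hdef :: "real \<Rightarrow> HC \<Rightarrow> HC \<Rightarrow> HC"
  where "hdef \<epsilon> X0 Z = Z + (\<i> * of_real \<epsilon>) *\<^sub>c qminus (Z - X0)"

definition cauchy_fueter_form :: "HC \<Rightarrow> (HC \<Rightarrow> HC) \<Rightarrow> HC \<Rightarrow> HC \<Rightarrow> HC \<Rightarrow> HC \<Rightarrow> HC"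
  where "cauchy_fueter_form X0 F Z A B C =
    ((1 / qnorm (Z - X0)) *\<^sub>c matrix_inv (Z - X0)) ** Dz A B C ** F Z"

end

theory Submission
  imports Defs "HOL-Complex_Analysis.Cauchy_Integral_Formula"
begin

text \<open>The idea. In the real coordinates \<open>y = x - X0\<close> the deformation is linear: it sends \<open>x\<close> to
  \<open>hr X0 + twist a b y\<close> with \<open>a = 1 + i \<epsilon>\<close> and \<open>b = 1 - i \<epsilon>\<close>, and
  $N = a^2 (y_0^2 + y_3^2) - b^2 (y_1^2 + y_2^2)$ has imaginary part $2 \epsilon |y|^2$. So for
  \<open>\<epsilon> \<noteq> 0\<close> the deformed real form meets the null cone at \<open>X0\<close> only. The integrand is a closed form,
  because $Z^{-1}/N(Z)$ is right-regular (\<open>kern_regular\<close>) and $f^C$ is left-regular; hence its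
  pull-back to the real form is the flux form of a divergence-free matrix-valued vector field
  with a single singularity at \<open>X0\<close> (\<open>field_divergence_free\<close>). The contour enters only
  through this pull-back.

  The theorem therefore follows from the divergence theorem for \<open>U\<close> once the singularity is
  removed. Instead of excising a ball, the field is multiplied by \<open>1 - \<chi>\<close>, where \<open>\<chi>\<close> is a bump at
  \<open>X0\<close> of radius \<open>r\<close>; the boundary integral does not change, and the divergence of the cut field is
  \<open>- T(x - X0) ** f\<^sup>C\<close> for an explicit kernel \<open>T\<close>, the \<open>cutoff_kernel\<close>. Its size is
  $O(r^{-4})$ on a ball of radius $2r$ and its integral is $2 \pi^2$ times the identity, for every
  \<open>r\<close> and every admissible \<open>a\<close>, \<open>b\<close> (\<open>cutoff_kernel_integral\<close>), so letting \<open>r\<close> tend to \<open>0\<close> leaves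
  $-2 \pi^2 f(X_0)$. If \<open>X0\<close> is outside, the kernel of small radius vanishes on \<open>U\<close>.

  The divergence theorem for piecewise continuously differentiable boundaries
  (\<open>divergence_theorem\<close>) is proved locally. Near a regular boundary point and for a
  transversal direction \<open>v\<close>, the map \<open>(u, t) \<mapsto> \<phi> u + t v\<close> is a local coordinate system whose Jacobian
  does not depend on \<open>t\<close>, so that Fubini and the fundamental theorem of calculus along \<open>v\<close> give the
  claim (\<open>stokes_near_patch_transversal\<close>); all directions follow by linearity. Bump functions
  patch these local results together away from the edges. The edges are images of null sets of
  a three-dimensional parameter space, hence covered by balls of radius \<open>s\<close> whose number times
  $s^3$ is arbitrarily small (\<open>cover_image_of_null_set\<close>); a cutoff near them has a gradient of size
  $1/s$ on a set of volume $s^4$ times that number, and so costs nothing in the limit.\<close>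

text \<open>Power series coefficients share the symbol of vector components.\<close>

unbundle no fps_syntax

section \<open>Continuously differentiable functions\<close>

abbreviation dderiv :: "'a::real_normed_vector \<Rightarrow> ('a \<Rightarrow> 'b::real_normed_vector) \<Rightarrow> 'a \<Rightarrow> 'b"
  where "dderiv v h x \<equiv> frechet_derivative h (at x) v"

text \<open>In finite dimension the derivative is continuous as an operator as soon as each of
  its values on a fixed vector is. All later arguments use the directional form.\<close>

lemma C1_onI:
  fixes f :: "'a::euclidean_space \<Rightarrow> 'b::real_normed_vector"
  assumes der: "\<And>x. x \<in> S \<Longrightarrow> (f has_derivative f' x) (at x)"
    and cont: "\<And>v. continuous_on S (\<lambda>x. f' x v)"
  shows "C1_on f S"
proof -
  have eq: "blinfun_apply (Blinfun (f' x)) = f' x" if "x \<in> S" for x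
    using der[OF that] by (simp add: bounded_linear_Blinfun_apply has_derivative_bounded_linear)
  have "continuous_on S (\<lambda>x. Blinfun (f' x))"
  proof (rule continuous_on_blinfun_componentwise)
    fix i :: 'a
    show "continuous_on S (\<lambda>x. blinfun_apply (Blinfun (f' x)) i)"
      using cont[of i] by (rule continuous_on_eq) (simp add: eq)
  qed
  then show ?thesis
    unfolding C1_on_def using der eq by (intro exI[of _ "\<lambda>x. Blinfun (f' x)"]) auto
qed

lemma C1_on_has_derivative:
  "C1_on f S \<Longrightarrow> x \<in> S \<Longrightarrow> (f has_derivative frechet_derivative f (at x)) (at x)"
  unfolding C1_on_def by (metis differentiableI frechet_derivative_works)

lemma C1_on_continuous_dderiv:
  assumes "C1_on f S"
  shows "continuous_on S (\<lambda>x. dderiv v f x)"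
proof -
  obtain f' where f': "\<And>x. x \<in> S \<Longrightarrow> (f has_derivative blinfun_apply (f' x)) (at x)"
    and c: "continuous_on S f'"
    using assms unfolding C1_on_def by blast
  have "continuous_on S (\<lambda>x. blinfun_apply (f' x) v)"
    by (intro continuous_intros c)
  then show ?thesis
    by (rule continuous_on_eq) (use frechet_derivative_at[OF f'] in auto)
qed

lemma C1_on_continuous: "C1_on f S \<Longrightarrow> continuous_on S f"
  by (meson C1_on_has_derivative continuous_at_imp_continuous_on has_derivative_continuous)

lemma C1_on_subset: "C1_on f S \<Longrightarrow> T \<subseteq> S \<Longrightarrow> C1_on f T"
  unfolding C1_on_def by (meson continuous_on_subset subsetD)

text \<open>Used to glue a field that is cut off near its singularity to zero.\<close>

lemma C1_on_union:
  fixes f :: "'a::euclidean_space \<Rightarrow> 'b::real_normed_vector"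
  assumes "C1_on f S" "C1_on f T" "open S" "open T"
  shows "C1_on f (S \<union> T)"
  by (rule C1_onI[where f' = "\<lambda>x. frechet_derivative f (at x)"])
    (use assms in \<open>auto intro: C1_on_has_derivative continuous_on_open_Un C1_on_continuous_dderiv\<close>)

lemma has_derivative_congI:
  assumes "open S" "x \<in> S" "\<And>y. y \<in> S \<Longrightarrow> f y = g y" "(f has_derivative f') (at x)"
  shows "(g has_derivative f') (at x)"
  using assms by (meson has_derivative_transform_within_open)

lemma dderiv_cong:
  assumes "open S" "x \<in> S" "\<And>y. y \<in> S \<Longrightarrow> f y = g y"
  shows "dderiv v f x = dderiv v g x"
proof -
  have "(f has_derivative f') (at x) \<longleftrightarrow> (g has_derivative f') (at x)" for f'
    using has_derivative_congI[OF assms, where f' = f']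
      has_derivative_congI[OF assms(1,2) assms(3)[symmetric], where f' = f']
    by auto
  then show ?thesis
    unfolding frechet_derivative_def by simp
qed

lemma C1_on_cong:
  fixes f :: "'a::euclidean_space \<Rightarrow> 'b::real_normed_vector"
  assumes "C1_on f S" "open S" "\<And>y. y \<in> S \<Longrightarrow> f y = g y"
  shows "C1_on g S"
  using assms unfolding C1_on_def by (meson has_derivative_congI)

lemma dderiv_bilinear:
  assumes "bounded_bilinear p" "f differentiable (at x)" "g differentiable (at x)"
  shows "((\<lambda>x. p (f x) (g x)) has_derivative (\<lambda>v. p (f x) (dderiv v g x) + p (dderiv v f x) (g x))) (at x)"
    and "dderiv v (\<lambda>x. p (f x) (g x)) x = p (f x) (dderiv v g x) + p (dderiv v f x) (g x)"
proof -
  show "((\<lambda>x. p (f x) (g x)) has_derivative (\<lambda>v. p (f x) (dderiv v g x) + p (dderiv v f x) (g x))) (at x)"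
    by (rule bounded_bilinear.FDERIV[OF assms(1)]) (use assms(2,3) frechet_derivative_works in blast)+
  from frechet_derivative_at[OF this]
  show "dderiv v (\<lambda>x. p (f x) (g x)) x = p (f x) (dderiv v g x) + p (dderiv v f x) (g x)"
    by metis
qed

lemma C1_on_differentiable: "C1_on f S \<Longrightarrow> x \<in> S \<Longrightarrow> f differentiable (at x)"
  by (meson C1_on_has_derivative differentiableI)

lemma C1_on_bilinear:
  fixes f :: "'a::euclidean_space \<Rightarrow> 'b::real_normed_vector"
  assumes p: "bounded_bilinear p" and f: "C1_on f S" and g: "C1_on g S"
  shows "C1_on (\<lambda>x. p (f x) (g x)) S"
proof (rule C1_onI)
  show "((\<lambda>x. p (f x) (g x)) has_derivative (\<lambda>v. p (f x) (dderiv v g x) + p (dderiv v f x) (g x))) (at x)"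
    if "x \<in> S" for x
    by (rule dderiv_bilinear(1)) (use assms that in \<open>auto intro: C1_on_differentiable\<close>)
  show "continuous_on S (\<lambda>x. p (f x) (dderiv v g x) + p (dderiv v f x) (g x))" for v
    by (intro continuous_intros bounded_bilinear.continuous_on[OF p] C1_on_continuous
        C1_on_continuous_dderiv f g)
qed

lemmas C1_on_mult = C1_on_bilinear[OF bounded_bilinear_mult]
lemmas C1_on_scaleR = C1_on_bilinear[OF bounded_bilinear_scaleR]

lemma C1_on_const: "C1_on (\<lambda>x. c) S"
  unfolding C1_on_def by (intro exI[of _ "\<lambda>x. 0"]) (auto simp: zero_blinfun.rep_eq)

lemma C1_on_add:
  fixes f :: "'a::euclidean_space \<Rightarrow> 'b::real_normed_vector"
  assumes f: "C1_on f S" and g: "C1_on g S"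
  shows "C1_on (\<lambda>x. f x + g x) S"
proof (rule C1_onI)
  show "((\<lambda>x. f x + g x) has_derivative (\<lambda>v. dderiv v f x + dderiv v g x)) (at x)" if "x \<in> S" for x
    using that f g by (intro derivative_intros C1_on_has_derivative)
qed (intro continuous_intros C1_on_continuous_dderiv f g)

lemma C1_on_linear:
  fixes L :: "'b::real_normed_vector \<Rightarrow> 'c::real_normed_vector" and f :: "'a::euclidean_space \<Rightarrow> 'b"
  assumes L: "bounded_linear L" and f: "C1_on f S"
  shows "C1_on (\<lambda>x. L (f x)) S"
proof (rule C1_onI)
  show "((\<lambda>x. L (f x)) has_derivative (\<lambda>v. L (dderiv v f x))) (at x)" if "x \<in> S" for x
    using that f by (intro bounded_linear.has_derivative[OF L] C1_on_has_derivative)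
qed (intro bounded_linear.continuous_on[OF L] C1_on_continuous_dderiv f)

lemma dderiv_linear:
  assumes "bounded_linear L" "f differentiable (at x)"
  shows "dderiv v (\<lambda>x. L (f x)) x = L (dderiv v f x)"
proof -
  have "((\<lambda>x. L (f x)) has_derivative (\<lambda>v. L (dderiv v f x))) (at x)"
    using assms frechet_derivative_works by (blast intro: bounded_linear.has_derivative)
  from frechet_derivative_at[OF this] show ?thesis by metis
qed

lemma dderiv_add:
  assumes "f differentiable (at x)" "g differentiable (at x)"
  shows "dderiv v (\<lambda>x. f x + g x) x = dderiv v f x + dderiv v g x"
proof -
  have "((\<lambda>x. f x + g x) has_derivative (\<lambda>v. dderiv v f x + dderiv v g x)) (at x)"
    using assms frechet_derivative_works by (blast intro: derivative_intros)
  from frechet_derivative_at[OF this] show ?thesis by metis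
qed

lemma dderiv_line:
  assumes "h differentiable (at (x + t *\<^sub>R v))"
  shows "((\<lambda>t. h (x + t *\<^sub>R v)) has_vector_derivative dderiv v h (x + t *\<^sub>R v)) (at t)"
proof -
  let ?D = "frechet_derivative h (at (x + t *\<^sub>R v))"
  have 1: "(h has_derivative ?D) (at (x + t *\<^sub>R v))"
    using assms frechet_derivative_works by blast
  have 2: "((\<lambda>t. x + t *\<^sub>R v) has_derivative (\<lambda>t. t *\<^sub>R v)) (at t)"
    by (auto intro!: derivative_eq_intros)
  have "((\<lambda>t. h (x + t *\<^sub>R v)) has_derivative (\<lambda>t. ?D (t *\<^sub>R v))) (at t)"
    using has_derivative_compose[OF 2 1] by simp
  moreover have "?D (t *\<^sub>R v) = t *\<^sub>R ?D v" for t
    using linear_cmul[OF has_derivative_linear[OF 1]] by simp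
  ultimately show ?thesis
    by (simp add: has_vector_derivative_def)
qed

lemma rpartial_eq_dderiv:
  assumes "h differentiable (at x)"
  shows "rpartial k h x = dderiv (axis k 1) h x"
proof -
  have "((\<lambda>t. h (x + t *\<^sub>R axis k 1)) has_vector_derivative dderiv (axis k 1) h (x + 0 *\<^sub>R axis k 1)) (at 0)"
    by (rule dderiv_line) (use assms in simp)
  then show ?thesis
    unfolding rpartial_def by (simp add: vector_derivative_at)
qed

section \<open>Bump functions\<close>

text \<open>The squared positive part is the building block of the bump profile, being continuously
  differentiable across its kink.\<close>

lemma square_pos_part_derivative:
  "((\<lambda>x::real. (max 0 x)\<^sup>2) has_real_derivative 2 * max 0 x) (at x)"
proof -
  consider "x > 0" | "x < 0" | "x = 0" by linarith
  then show ?thesis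
  proof cases
    case 1
    have "((\<lambda>x::real. x\<^sup>2) has_real_derivative 2 * x) (at x)"
      by (auto intro!: derivative_eq_intros)
    then have "((\<lambda>x::real. (max 0 x)\<^sup>2) has_real_derivative 2 * x) (at x)"
      by (rule has_field_derivative_transform_within_open[of _ _ _ "{0<..}"]) (use 1 in auto)
    then show ?thesis using 1 by simp
  next
    case 2
    have "((\<lambda>x::real. 0) has_real_derivative 0) (at x)"
      by simp
    then have "((\<lambda>x::real. (max 0 x)\<^sup>2) has_real_derivative 0) (at x)"
      by (rule has_field_derivative_transform_within_open[of _ _ _ "{..<0}"]) (use 2 in auto)
    then show ?thesis using 2 by simp
  next
    case 3
    have "((\<lambda>h::real. max 0 h) \<longlongrightarrow> max 0 0) (at 0)"
      by (intro tendsto_intros)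
    then have "((\<lambda>h::real. ((max 0 (0 + h))\<^sup>2 - (max 0 0)\<^sup>2) / h) \<longlongrightarrow> 0) (at 0)"
      by (simp add: Lim_transform_eventually[where f = "\<lambda>h. max 0 h"] eventually_at_filter max_def power2_eq_square)
    then show ?thesis using 3 by (simp add: DERIV_def)
  qed
qed

text \<open>A decreasing profile in the squared distance: \<open>1\<close> up to \<open>1\<close> and \<open>0\<close> from
  \<open>4 = 2\<^sup>2\<close> on; the division by \<open>9 = (4 - 1)\<^sup>2\<close> places the second kink at \<open>4\<close>.\<close>

definition bump_profile :: "real \<Rightarrow> real"
  where "bump_profile \<rho> = (max 0 (1 - (max 0 (\<rho> - 1))\<^sup>2 / 9))\<^sup>2"

definition bump_profile' :: "real \<Rightarrow> real"
  where "bump_profile' \<rho> = 2 * max 0 (1 - (max 0 (\<rho> - 1))\<^sup>2 / 9) * (- (2 * max 0 (\<rho> - 1) / 9))"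

lemma bump_profile_derivative: "(bump_profile has_real_derivative bump_profile' \<rho>) (at \<rho>)"
proof -
  have 1: "((\<lambda>\<rho>. (max 0 (\<rho> - 1))\<^sup>2) has_real_derivative 2 * max 0 (\<rho> - 1) * 1) (at \<rho>)" for \<rho> :: real
    by (rule DERIV_chain'[OF _ square_pos_part_derivative]) (auto intro!: derivative_eq_intros)
  have 2: "((\<lambda>\<rho>. 1 - (max 0 (\<rho> - 1))\<^sup>2 / 9) has_real_derivative - (2 * max 0 (\<rho> - 1) / 9)) (at \<rho>)"
    by (rule derivative_eq_intros 1 refl | simp)+
  show ?thesis
    unfolding bump_profile_def bump_profile'_def
    by (rule DERIV_chain'[OF 2 square_pos_part_derivative])
qed

lemma bump_profile_one: "\<rho> \<le> 1 \<Longrightarrow> bump_profile \<rho> = 1"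
  by (simp add: bump_profile_def)

lemma bump_profile_aux: "\<rho> \<ge> 4 \<Longrightarrow> max 0 (1 - (max 0 (\<rho> - 1))\<^sup>2 / 9) = (0::real)"
proof -
  assume "\<rho> \<ge> 4"
  then have "3\<^sup>2 \<le> (\<rho> - 1)\<^sup>2" by (intro power_mono) auto
  then show ?thesis using \<open>\<rho> \<ge> 4\<close> by (simp add: max_def)
qed

lemma bump_profile_zero: "\<rho> \<ge> 4 \<Longrightarrow> bump_profile \<rho> = 0"
  by (simp only: bump_profile_def bump_profile_aux) simp

lemma bump_profile'_zero: "\<rho> \<le> 1 \<or> \<rho> \<ge> 4 \<Longrightarrow> bump_profile' \<rho> = 0"
  using bump_profile_aux[of \<rho>] by (auto simp: bump_profile'_def)

lemma bump_profile_bounds: "0 \<le> bump_profile \<rho>" "bump_profile \<rho> \<le> 1"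
  by (auto simp: bump_profile_def intro!: power_le_one)

lemma bump_profile'_bound: "\<bar>bump_profile' \<rho>\<bar> \<le> 4 / 3"
proof (cases "\<rho> \<ge> 4")
  case False
  have "max 0 (1 - (max 0 (\<rho> - 1))\<^sup>2 / 9) * (2 * max 0 (\<rho> - 1) / 9) \<le> 1 * (2 / 3)"
    using False by (intro mult_mono) auto
  moreover have "0 \<le> max 0 (1 - (max 0 (\<rho> - 1))\<^sup>2 / 9) * (2 * max 0 (\<rho> - 1) / 9)"
    by (intro mult_nonneg_nonneg) auto
  ultimately show ?thesis
    unfolding bump_profile'_def by linarith
qed (simp add: bump_profile'_zero)

lemma continuous_bump_profile': "continuous_on S bump_profile'"
  unfolding bump_profile'_def by (intro continuous_intros) auto

definition bump :: "'a::euclidean_space \<Rightarrow> real \<Rightarrow> 'a \<Rightarrow> real"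
  where "bump c R x = bump_profile ((norm (x - c))\<^sup>2 / R\<^sup>2)"

lemma bump_has_derivative:
  "(bump c R has_derivative (\<lambda>v. bump_profile' ((norm (x - c))\<^sup>2 / R\<^sup>2) * (2 * ((x - c) \<bullet> v) / R\<^sup>2))) (at x)"
proof -
  have 1: "((\<lambda>x. (norm (x - c))\<^sup>2 / R\<^sup>2) has_derivative (\<lambda>v. 2 * ((x - c) \<bullet> v) / R\<^sup>2)) (at x)"
    unfolding power2_norm_eq_inner
    by (auto intro!: derivative_eq_intros simp: inner_commute divide_inverse)
  have 2: "(bump_profile has_derivative (\<lambda>t. bump_profile' ((norm (x - c))\<^sup>2 / R\<^sup>2) * t)) (at ((norm (x - c))\<^sup>2 / R\<^sup>2))"
    using bump_profile_derivative by (simp add: has_field_derivative_def)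
  show ?thesis
    unfolding bump_def[abs_def] using has_derivative_compose[OF 1 2] by simp
qed

lemma dderiv_bump:
  "dderiv v (bump c R) x = bump_profile' ((norm (x - c))\<^sup>2 / R\<^sup>2) * (2 * ((x - c) \<bullet> v) / R\<^sup>2)"
  by (simp add: frechet_derivative_at[OF bump_has_derivative, symmetric])

lemma C1_on_bump: "C1_on (bump c R) S"
proof (rule C1_onI[OF bump_has_derivative])
  show "continuous_on S (\<lambda>x. bump_profile' ((norm (x - c))\<^sup>2 / R\<^sup>2) * (2 * ((x - c) \<bullet> v) / R\<^sup>2))" for v
    unfolding divide_inverse
    by (intro continuous_intros continuous_on_compose2[OF continuous_bump_profile'[of UNIV]]) auto
qed

lemma bump_one: "R > 0 \<Longrightarrow> x \<in> cball c R \<Longrightarrow> bump c R x = 1"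
  by (auto simp: bump_def dist_norm norm_minus_commute intro!: bump_profile_one)

lemma bump_zero: "R > 0 \<Longrightarrow> x \<notin> ball c (2 * R) \<Longrightarrow> bump c R x = 0"
proof -
  assume "R > 0" "x \<notin> ball c (2 * R)"
  then have "(2 * R)\<^sup>2 \<le> (norm (x - c))\<^sup>2"
    by (intro power_mono) (auto simp: dist_norm norm_minus_commute)
  then show ?thesis
    using \<open>R > 0\<close> by (auto simp: bump_def field_simps power2_eq_square intro!: bump_profile_zero)
qed

lemma bump_bounds: "0 \<le> bump c R x" "bump c R x \<le> 1"
  by (auto simp: bump_def bump_profile_bounds)

lemma dderiv_bump_zero: "R > 0 \<Longrightarrow> x \<in> ball c R \<or> x \<notin> ball c (2 * R) \<Longrightarrow> dderiv v (bump c R) x = 0"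
proof -
  assume R: "R > 0" and "x \<in> ball c R \<or> x \<notin> ball c (2 * R)"
  then have "norm (x - c) \<le> R \<or> 2 * R \<le> norm (x - c)"
    by (auto simp: dist_norm norm_minus_commute)
  then have "(norm (x - c))\<^sup>2 \<le> R\<^sup>2 \<or> (2 * R)\<^sup>2 \<le> (norm (x - c))\<^sup>2"
    using R power_mono[of "norm (x - c)" R 2] power_mono[of "2 * R" "norm (x - c)" 2] by auto
  then have "(norm (x - c))\<^sup>2 / R\<^sup>2 \<le> 1 \<or> 4 \<le> (norm (x - c))\<^sup>2 / R\<^sup>2"
    using R by (auto simp: field_simps)
  then show ?thesis
    by (simp add: dderiv_bump bump_profile'_zero)
qed

text \<open>The gradient is of order \<open>1 / R\<close>. This rate is what makes cutting off near the edges
  harmless and what bounds the kernel near \<open>X0\<close>.\<close>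

lemma dderiv_bump_bound: "R > 0 \<Longrightarrow> \<bar>dderiv v (bump c R) x\<bar> \<le> 6 * norm v / R"
proof (cases "x \<in> ball c (2 * R)")
  case True
  assume R: "R > 0"
  have "\<bar>(x - c) \<bullet> v\<bar> \<le> norm (x - c) * norm v"
    by (rule Cauchy_Schwarz_ineq2)
  also have "\<dots> \<le> (2 * R) * norm v"
    using True by (intro mult_right_mono) (auto simp: dist_norm norm_minus_commute)
  finally have 1: "\<bar>2 * ((x - c) \<bullet> v) / R\<^sup>2\<bar> \<le> 4 * norm v / R"
    using R by (simp add: field_simps power2_eq_square abs_mult)
  have "\<bar>dderiv v (bump c R) x\<bar> \<le> (4 / 3) * (4 * norm v / R)"
    unfolding dderiv_bump abs_mult by (intro mult_mono 1 bump_profile'_bound) auto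
  also have "\<dots> \<le> 6 * norm v / R"
    using R by (simp add: field_simps)
  finally show ?thesis .
qed (auto simp: dderiv_bump_zero)

section \<open>Lebesgue measure in coordinates\<close>

text \<open>A bijection between the standard bases carries boxes to boxes of the same volume, and
  boxes determine Lebesgue measure.\<close>

lemma lborel_distr_basis_bijection:
  fixes T :: "'a::euclidean_space \<Rightarrow> 'b::euclidean_space"
  assumes T: "linear T" and b: "bij_betw T Basis Basis"
  shows "distr lborel lborel T = lborel"
proof -
  have inner: "T x \<bullet> T k = x \<bullet> k" if "k \<in> Basis" for x k
  proof -
    have Tk: "T j \<bullet> T k = j \<bullet> k" if "j \<in> Basis" for j
    proof -
      have "T j \<in> Basis" "T k \<in> Basis" "T j = T k \<longleftrightarrow> j = k"
        using that \<open>k \<in> Basis\<close> b unfolding bij_betw_def inj_on_def by blast+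
      then show ?thesis
        using that \<open>k \<in> Basis\<close> by (simp add: inner_Basis)
    qed
    have "T x \<bullet> T k = T (\<Sum>j\<in>Basis. (x \<bullet> j) *\<^sub>R j) \<bullet> T k"
      by (simp add: euclidean_representation)
    also have "\<dots> = (\<Sum>j\<in>Basis. (x \<bullet> j) * (T j \<bullet> T k))"
      by (simp add: linear_sum[OF T] linear_cmul[OF T] inner_sum_left)
    also have "\<dots> = (\<Sum>j\<in>Basis. (x \<bullet> j) * (j \<bullet> k))"
      by (intro sum.cong) (auto simp: Tk)
    also have "\<dots> = x \<bullet> k"
      by (metis (no_types, lifting) euclidean_representation inner_scaleR_left inner_sum_left sum.cong)
    finally show ?thesis .
  qed
  have [measurable]: "T \<in> borel_measurable borel"
    by (intro borel_measurable_continuous_onI linear_continuous_on linear_linear[THEN iffD1] T)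
      (auto intro: linear_conv_bounded_linear[THEN iffD1] T)
  have "lborel = distr lborel lborel T"
  proof (rule lborel_eqI)
    fix l u :: 'b assume lu: "\<And>k. k \<in> Basis \<Longrightarrow> l \<bullet> k \<le> u \<bullet> k"
    define l' u' where "l' = (\<Sum>k\<in>Basis. (l \<bullet> T k) *\<^sub>R k)" and "u' = (\<Sum>k\<in>Basis. (u \<bullet> T k) *\<^sub>R k)"
    have l': "l' \<bullet> k = l \<bullet> T k" and u': "u' \<bullet> k = u \<bullet> T k" if "k \<in> Basis" for k
      using that by (auto simp: l'_def u'_def inner_sum_left inner_Basis if_distrib cong: if_cong)
    have TB: "T ` Basis = Basis" using b by (simp add: bij_betw_def)
    have "T -` box l u = box l' u'"
    proof -
      have "x \<in> box l' u' \<longleftrightarrow> T x \<in> box l u" for x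
      proof -
        have "T x \<in> box l u \<longleftrightarrow> (\<forall>k\<in>T ` Basis. l \<bullet> k < T x \<bullet> k \<and> T x \<bullet> k < u \<bullet> k)"
          by (simp only: TB box_def mem_Collect_eq)
        also have "\<dots> \<longleftrightarrow> (\<forall>k\<in>Basis. l' \<bullet> k < x \<bullet> k \<and> x \<bullet> k < u' \<bullet> k)"
          by (simp only: ball_simps l' u' inner cong: ball_cong)
        finally show ?thesis by (simp only: box_def mem_Collect_eq)
      qed
      then show ?thesis by auto
    qed
    then have "emeasure (distr lborel lborel T) (box l u) = emeasure lborel (box l' u')"
      by (simp add: emeasure_distr)
    also have "\<dots> = ennreal (\<Prod>k\<in>Basis. (u' - l') \<bullet> k)"
      using lu TB by (subst emeasure_lborel_box) (auto simp: l' u')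
    also have "(\<Prod>k\<in>Basis. (u' - l') \<bullet> k) = (\<Prod>k\<in>Basis. (u - l) \<bullet> T k)"
      by (intro prod.cong) (auto simp: l' u' inner_diff_left)
    also have "\<dots> = (\<Prod>k\<in>Basis. (u - l) \<bullet> k)"
      using prod.reindex_bij_betw[OF b] .
    finally show "emeasure (distr lborel lborel T) (box l u) = ennreal (\<Prod>k\<in>Basis. (u - l) \<bullet> k)" .
  qed simp
  then show ?thesis by simp
qed

lemma integral_product_coordinates:
  fixes f :: "'c::euclidean_space \<Rightarrow> 'd::{banach, second_countable_topology}"
    and T :: "'a::euclidean_space \<times> 'b::euclidean_space \<Rightarrow> 'c"
  assumes T: "linear T" and b: "bij_betw T Basis Basis" and f: "integrable lborel f"
  shows "integral\<^sup>L lborel f = (\<integral>x. (\<integral>y. f (T (x, y)) \<partial>lborel) \<partial>lborel)"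
proof -
  have [measurable]: "T \<in> borel_measurable (lborel \<Otimes>\<^sub>M lborel)"
    using linear_continuous_on[OF T[unfolded linear_conv_bounded_linear], of UNIV]
    by (simp add: borel_measurable_continuous_onI lborel_prod)
  have d: "distr (lborel \<Otimes>\<^sub>M lborel) lborel T = lborel"
    using lborel_distr_basis_bijection[OF T b] by (simp add: lborel_prod)
  have "integrable (distr (lborel \<Otimes>\<^sub>M lborel) lborel T) f"
    by (simp add: d f)
  then have i: "integrable (lborel \<Otimes>\<^sub>M lborel) (\<lambda>(x, y). f (T (x, y)))"
    using f by (subst (asm) integrable_distr_eq) (auto simp: case_prod_unfold)
  have "integral\<^sup>L lborel f = integral\<^sup>L (distr (lborel \<Otimes>\<^sub>M lborel) lborel T) f"
    by (simp add: d)
  also have "\<dots> = integral\<^sup>L (lborel \<Otimes>\<^sub>M lborel) (\<lambda>(x, y). f (T (x, y)))"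
    using f by (subst integral_distr) (auto simp: case_prod_unfold)
  also have "\<dots> = (\<integral>x. (\<integral>y. f (T (x, y)) \<partial>lborel) \<partial>lborel)"
    using lborel_pair.integral_fst[OF i] by simp
  finally show ?thesis .
qed

lemma four_eq_zero: "(4::4) = 0"
  by simp

lemma forall_4_zero: "(\<forall>k::4. P k) \<longleftrightarrow> P 0 \<and> P 1 \<and> P 2 \<and> P 3"
  using four_eq_zero by (metis exhaust_4)

lemma UNIV_4_zero: "UNIV = {0, 1, 2, 3 :: 4}"
  using four_eq_zero UNIV_4 by auto

lemma sum_4_zero: "sum f (UNIV :: 4 set) = f 0 + f 1 + f 2 + f 3"
  unfolding UNIV_4_zero by (simp add: add.assoc)

text \<open>\<open>real^4\<close> is split into the coordinate \<open>0\<close>, which plays the role of the transversal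
  parameter \<open>t\<close>, and the coordinates \<open>1, 2, 3\<close>, which play the role of the parameters of a patch.\<close>

definition join :: "real^3 \<Rightarrow> real \<Rightarrow> real^4"
  where "join u t = (\<chi> k. if k = 0 then t else if k = 1 then u$1 else if k = 2 then u$2 else u$3)"

definition tail :: "real^4 \<Rightarrow> real^3"
  where "tail y = vector [y$1, y$2, y$3]"

lemma tail_join [simp]: "tail (join u t) = u"
  by (simp add: tail_def join_def vec_eq_iff forall_3)

lemma join_zero [simp]: "join u t $ 0 = t"
  by (simp add: join_def)

lemma join_tail [simp]: "join (tail y) (y$0) = y"
  by (simp add: tail_def join_def vec_eq_iff forall_4_zero)

lemma linear_join: "linear (\<lambda>(u, t). join u t)"
  by (rule linearI) (auto simp: join_def vec_eq_iff forall_4_zero)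

lemma bounded_linear_join: "bounded_linear (\<lambda>(u, t). join u t)"
  using linear_join linear_conv_bounded_linear by blast

lemma bounded_linear_tail: "bounded_linear tail"
proof -
  have "linear tail"
    by (rule linearI) (auto simp: tail_def vec_eq_iff forall_3)
  then show ?thesis using linear_conv_bounded_linear by blast
qed

lemma tail_axis:
  "tail (axis 0 1) = 0" "tail (axis 1 1) = axis 1 1" "tail (axis 2 1) = axis 2 1" "tail (axis 3 1) = axis 3 1"
  by (simp_all add: tail_def vec_eq_iff forall_3 axis_def)

lemma Basis_vec_axis: "(Basis :: (real^'n) set) = range (\<lambda>k. axis k 1)"
  by (auto simp: Basis_vec_def)

lemma bij_join: "bij_betw (\<lambda>(u, t). join u t) Basis Basis"
proof -
  have "join (axis 1 1) 0 = axis 1 1" "join (axis 2 1) 0 = axis 2 1" "join (axis 3 1) 0 = axis 3 1"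
    "join 0 1 = axis 0 1"
    by (simp_all add: join_def vec_eq_iff forall_4_zero axis_def)
  then have "(\<lambda>(u, t). join u t) ` Basis = Basis"
    by (simp add: Basis_prod_def Basis_vec_axis UNIV_3 UNIV_4_zero image_Un insert_commute)
  moreover have "inj (\<lambda>(u, t). join u t)"
    by (rule injI) (metis case_prod_beta join_zero prod.collapse tail_join)
  ultimately show ?thesis
    unfolding bij_betw_def by (meson inj_on_subset subset_UNIV)
qed

lemma set_integrable_lborel_iff:
  fixes f :: "'a::euclidean_space \<Rightarrow> 'b::euclidean_space"
  assumes "(\<lambda>x. indicator S x *\<^sub>R f x) \<in> borel_measurable borel"
  shows "set_integrable lborel S f \<longleftrightarrow> f absolutely_integrable_on S"
  unfolding set_integrable_def by (rule integrable_completion[symmetric]) (use assms in simp)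

lemma set_integrable_compact:
  fixes f :: "'a::euclidean_space \<Rightarrow> 'b::euclidean_space"
  assumes "compact K" "continuous_on K f" "S \<subseteq> K" "S \<in> sets borel"
  shows "set_integrable lborel S f"
proof (rule set_integrable_subset)
  show "set_integrable lborel K f"
    unfolding set_integrable_def using assms(1,2) by (rule borel_integrable_compact)
qed (use assms in auto)

lemma set_integrable_imp_absolutely_integrable:
  fixes f :: "'a::euclidean_space \<Rightarrow> 'b::euclidean_space"
  assumes "set_integrable lborel S f"
  shows "f absolutely_integrable_on S"
proof -
  have "(\<lambda>x. indicator S x *\<^sub>R f x) \<in> borel_measurable borel"
    using borel_measurable_integrable[OF assms[unfolded set_integrable_def]] by simp
  from set_integrable_lborel_iff[OF this] assms show ?thesis by blast
qed

text \<open>A real function is treated as a vector with one component.\<close>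

lemma change_of_variables_real:
  fixes f :: "real^'m::{finite,wellorder} \<Rightarrow> real" and g :: "real^'m::_ \<Rightarrow> real^'m::_"
  assumes S: "S \<in> sets lebesgue"
    and g: "\<And>x. x \<in> S \<Longrightarrow> (g has_derivative g' x) (at x within S)" and inj: "inj_on g S"
    and f: "f absolutely_integrable_on g ` S"
  shows "(\<lambda>x. \<bar>det (matrix (g' x))\<bar> * f (g x)) absolutely_integrable_on S"
    and "integral S (\<lambda>x. \<bar>det (matrix (g' x))\<bar> * f (g x)) = integral (g ` S) f"
proof -
  let ?F = "\<lambda>x. vec (f x) :: real^1"
  have "linear (vec :: real \<Rightarrow> real^1)"
    by (rule linearI) (auto simp: vec_eq_iff)
  then have v: "bounded_linear (vec :: real \<Rightarrow> real^1)"
    by (simp add: linear_conv_bounded_linear)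
  have "?F absolutely_integrable_on g ` S"
    using absolutely_integrable_linear[OF f v] by (simp add: o_def)
  then have *: "(\<lambda>x. \<bar>det (matrix (g' x))\<bar> *\<^sub>R ?F (g x)) absolutely_integrable_on S"
    "integral S (\<lambda>x. \<bar>det (matrix (g' x))\<bar> *\<^sub>R ?F (g x)) = integral (g ` S) ?F"
    using has_absolute_integral_change_of_variables[OF S g inj, of ?F "integral (g ` S) ?F"] by auto
  have b: "bounded_linear (\<lambda>x :: real^1. x $ 1)"
    by (rule bounded_linear_vec_nth)
  show "(\<lambda>x. \<bar>det (matrix (g' x))\<bar> * f (g x)) absolutely_integrable_on S"
    using absolutely_integrable_linear[OF *(1) b] by (simp add: o_def)
  have "integral S (\<lambda>x. \<bar>det (matrix (g' x))\<bar> * f (g x))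
      = integral S (\<lambda>x. \<bar>det (matrix (g' x))\<bar> *\<^sub>R ?F (g x)) $ 1"
    using integral_linear[OF _ b, of "\<lambda>x. \<bar>det (matrix (g' x))\<bar> *\<^sub>R ?F (g x)" S] *(1)
    by (simp add: o_def set_lebesgue_integral_eq_integral)
  also have "\<dots> = integral (g ` S) f"
    unfolding *(2)
    using integral_linear[OF _ v, of f "g ` S"] f by (simp add: o_def set_lebesgue_integral_eq_integral)
  finally show "integral S (\<lambda>x. \<bar>det (matrix (g' x))\<bar> * f (g x)) = integral (g ` S) f" .
qed

lemma integral_eq_on_superset:
  fixes f :: "'a::euclidean_space \<Rightarrow> 'b::euclidean_space"
  assumes "S \<subseteq> T" "\<And>x. x \<in> T \<Longrightarrow> x \<notin> S \<Longrightarrow> f x = 0"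
  shows "integral S f = integral T f"
  unfolding integral_restrict_UNIV[of S f, symmetric] integral_restrict_UNIV[of T f, symmetric]
  by (rule integral_cong) (use assms in auto)

lemma integrable_compact_support:
  fixes f :: "'a::euclidean_space \<Rightarrow> 'b::euclidean_space"
  assumes "compact K" "continuous_on K f" "\<And>x. x \<notin> K \<Longrightarrow> f x = 0"
  shows "integrable lborel f"
proof -
  have "integrable lborel (\<lambda>x. indicator K x *\<^sub>R f x)"
    using assms(1,2) by (rule borel_integrable_compact)
  also have "(\<lambda>x. indicator K x *\<^sub>R f x) = f"
    using assms(3) by (auto simp: indicator_def)
  finally show ?thesis .
qed

text \<open>By translation invariance the integral of \<open>h (x + s v)\<close> does not depend on \<open>s\<close>;
  differentiate under the integral sign at \<open>s = 0\<close>.\<close>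

lemma integral_dderiv_compact_support:
  fixes h :: "'a::euclidean_space \<Rightarrow> real"
  assumes h: "C1_on h UNIV" and B: "\<And>x. norm x > B \<Longrightarrow> h x = 0"
  shows "integral UNIV (dderiv v h) = 0"
proof -
  obtain a where a: "cball 0 (\<bar>B\<bar> + norm v + 1) \<subseteq> cbox (- a) (a :: 'a)"
    using bounded_subset_cbox_symmetric[of "cball 0 (\<bar>B\<bar> + norm v + 1)"] by auto
  have hd: "h differentiable (at x)" for x
    using h by (auto intro: C1_on_differentiable)
  have hc: "continuous_on S h" for S
    using C1_on_continuous[OF h] continuous_on_subset by blast
  have dc: "continuous_on S (dderiv v h)" for S
    using C1_on_continuous_dderiv[OF h] continuous_on_subset by blast
  have shift0: "h (x + s *\<^sub>R v) = 0" if "x \<notin> cbox (- a) a" "s \<in> {-1..1}" for x s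
  proof -
    have "norm x > \<bar>B\<bar> + norm v + 1" using that a by (force simp: subset_eq)
    moreover have "norm (s *\<^sub>R v) \<le> 1 * norm v"
      unfolding norm_scaleR using that by (intro mult_right_mono) auto
    moreover have "norm x \<le> norm (x + s *\<^sub>R v) + norm (s *\<^sub>R v)"
      using norm_triangle_ineq4[of "x + s *\<^sub>R v" "s *\<^sub>R v"] by simp
    ultimately show ?thesis by (intro B) linarith
  qed
  have d0: "dderiv v h x = 0" if "x \<notin> cbox (- a) a" for x
  proof -
    have "dderiv v h x = dderiv v (\<lambda>x. 0) x"
    proof (rule dderiv_cong)
      show "open (- cbox (- a) a)" by auto
      show "h y = 0" if "y \<in> - cbox (- a) a" for y
        using shift0[of y 0] that by simp
    qed (use that in auto)
    then show ?thesis by simp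
  qed
  have const: "integral (cbox (- a) a) (\<lambda>x. h (x + s *\<^sub>R v)) = integral UNIV h" if s: "s \<in> {-1..1}" for s
  proof -
    have ih: "integrable lborel h"
      using shift0[of _ 0] by (intro integrable_compact_support[OF compact_cbox hc, of "- a" a]) auto
    have "integral (cbox (- a) a) (\<lambda>x. h (x + s *\<^sub>R v)) = integral UNIV (\<lambda>x. h (x + s *\<^sub>R v))"
      by (rule integral_eq_on_superset) (use shift0 s in auto)
    also have "\<dots> = integral\<^sup>L lborel (\<lambda>x. h (x + s *\<^sub>R v))"
      by (intro integral_lborel integrable_compact_support[OF compact_cbox, of "- a" a])
        (use shift0 s in \<open>auto intro!: continuous_on_compose2[OF hc[of UNIV]] continuous_intros\<close>)
    also have "\<dots> = integral\<^sup>L (distr lborel borel ((+) (s *\<^sub>R v))) h"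
      using ih by (subst integral_distr) (auto simp: add.commute)
    also have "\<dots> = integral UNIV h"
      unfolding lborel_distr_plus using ih by (simp add: integral_lborel)
    finally show ?thesis .
  qed
  have "((\<lambda>s. integral (cbox (- a) a) (\<lambda>x. h (x + s *\<^sub>R v))) has_vector_derivative
      integral (cbox (- a) a) (\<lambda>x. dderiv v h (x + 0 *\<^sub>R v))) (at 0 within {-1..1})"
  proof (rule leibniz_rule_vector_derivative)
    show "((\<lambda>s. h (x + s *\<^sub>R v)) has_vector_derivative dderiv v h (x + s *\<^sub>R v)) (at s within {-1..1})" for x s
      by (rule has_vector_derivative_at_within[OF dderiv_line[OF hd]])
    show "(\<lambda>x. h (x + s *\<^sub>R v)) integrable_on cbox (- a) a" for s
      by (intro integrable_continuous continuous_on_compose2[OF hc[of UNIV]] continuous_intros) auto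
    show "continuous_on ({-1..1} \<times> cbox (- a) a) (\<lambda>(s, x). dderiv v h (x + s *\<^sub>R v))"
      unfolding case_prod_unfold
      by (intro continuous_on_compose2[OF dc[of UNIV]] continuous_intros) auto
  qed auto
  moreover have "((\<lambda>s. integral (cbox (- a) a) (\<lambda>x. h (x + s *\<^sub>R v))) has_vector_derivative 0) (at 0 within {-1..1})"
    by (rule has_vector_derivative_transform[where f = "\<lambda>s. integral UNIV h"]) (use const in auto)
  ultimately have "integral (cbox (- a) a) (dderiv v h) = 0"
    using vector_derivative_unique_within_closed_interval[of "-1" 1 0] by fastforce
  moreover have "integral (cbox (- a) a) (dderiv v h) = integral UNIV (dderiv v h)"
    by (rule integral_eq_on_superset) (use d0 in auto)
  ultimately show ?thesis by simp
qed

section \<open>The determinant\<close>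

lemma det4_add: "det4 (v + w) a b c = det4 v a b c + det4 w a b c"
  unfolding det4_def
  using det_row_add[of 0 "\<lambda>_. v" "\<lambda>_. w" "\<lambda>i. if i = 1 then a else if i = 2 then b else c"] by simp

lemma det4_scale: "det4 (r *\<^sub>R v) a b c = r * det4 v a b c"
  unfolding det4_def
  using det_row_mul[of 0 r "\<lambda>_. v" "\<lambda>i. if i = 1 then a else if i = 2 then b else c"]
  unfolding scalar_mult_eq_scaleR .

lemma continuous_on_det4:
  assumes "continuous_on S v" "continuous_on S a" "continuous_on S b" "continuous_on S c"
  shows "continuous_on S (\<lambda>x. det4 (v x) (a x) (b x) (c x))"
  unfolding det4_def det_def
proof (intro continuous_on_sum continuous_on_mult continuous_on_const continuous_on_prod)
  fix \<sigma> and i :: 4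
  consider "i = 0" | "i = 1" | "i = 2" | "i = 3"
    using UNIV_4_zero by auto
  then show "continuous_on S (\<lambda>x. (\<chi> i. if i = 0 then v x else if i = 1 then a x
      else if i = 2 then b x else c x) $ i $ \<sigma> i)"
    using assms by cases (auto intro!: continuous_intros)
qed

text \<open>This linear map is the derivative of \<open>(u, t) \<mapsto> \<phi> u + t v\<close>. Its determinant is the
  density of the flux form in the direction \<open>v\<close>, and it does not involve \<open>t\<close>.\<close>

lemma det_matrix_graph:
  assumes "bounded_linear L"
  shows "det (matrix (\<lambda>w. L (tail w) + w$0 *\<^sub>R v)) = det4 v (L (axis 1 1)) (L (axis 2 1)) (L (axis 3 1))"
proof -
  interpret bounded_linear L by fact
  have "matrix (\<lambda>w. L (tail w) + w$0 *\<^sub>R v) =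
      transpose (\<chi> i. if i = 0 then v else if i = 1 then L (axis 1 1) else if i = 2 then L (axis 2 1) else L (axis 3 1))"
    unfolding matrix_def transpose_def vec_eq_iff forall_4_zero
    by (simp add: tail_axis zero) (simp add: axis_def)
  then show ?thesis
    by (simp add: det4_def det_transpose)
qed

section \<open>The divergence theorem near a regular boundary point\<close>

text \<open>\<open>W\<close> is the open set on which the integrated fields are differentiable.\<close>

locale C1_boundary =
  fixes U W :: "(real^4) set" and m :: nat and D :: "nat \<Rightarrow> (real^3) set"
    and \<phi> :: "nat \<Rightarrow> real^3 \<Rightarrow> real^4"
  assumes U_open: "open U" and U_bounded: "bounded U"
    and boundary: "oriented_C1_boundary U m D \<phi>"
    and W_open: "open W" and U_W: "closure U \<subseteq> W"
begin

definition jac :: "nat \<Rightarrow> real^4 \<Rightarrow> real^3 \<Rightarrow> real"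
  where "jac i v u = det4 v (rpartial 1 (\<phi> i) u) (rpartial 2 (\<phi> i) u) (rpartial 3 (\<phi> i) u)"

definition flux :: "real^4 \<Rightarrow> (real^4 \<Rightarrow> 'b::euclidean_space) \<Rightarrow> 'b"
  where "flux v h = (\<Sum>i<m. integral (D i) (\<lambda>u. jac i v u *\<^sub>R h (\<phi> i u)))"

definition stokes :: "real^4 \<Rightarrow> (real^4 \<Rightarrow> 'b::euclidean_space) \<Rightarrow> bool"
  where "stokes v h \<longleftrightarrow> integral U (dderiv v h) = flux v h"

lemma D_compact: "i < m \<Longrightarrow> compact (D i)"
  and D_negligible: "i < m \<Longrightarrow> negligible (frontier (D i))"
  and frontier_U: "frontier U = (\<Union>i<m. \<phi> i ` D i)"
  and patch_inj: "i < m \<Longrightarrow> u \<in> interior (D i) \<Longrightarrow> j < m \<Longrightarrow> w \<in> D j \<Longrightarrow> \<phi> i u = \<phi> j w \<Longrightarrow> i = j \<and> u = w"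
  and patch_immersion: "i < m \<Longrightarrow> u \<in> interior (D i) \<Longrightarrow> inj (frechet_derivative (\<phi> i) (at u))"
  and patch_oriented: "i < m \<Longrightarrow> u \<in> interior (D i) \<Longrightarrow> jac i v u > 0 \<Longrightarrow>
    (\<forall>\<^sub>F t in at_right 0. \<phi> i u + t *\<^sub>R v \<notin> closure U \<and> \<phi> i u - t *\<^sub>R v \<in> U)"
proof -
  note b = boundary[unfolded oriented_C1_boundary_def]
  note patches = b[THEN conjunct1] and fr = b[THEN conjunct2, THEN conjunct1]
    and inj = b[THEN conjunct2, THEN conjunct2, THEN conjunct1]
    and reg = b[THEN conjunct2, THEN conjunct2, THEN conjunct2]
  show "i < m \<Longrightarrow> compact (D i)" "i < m \<Longrightarrow> negligible (frontier (D i))"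
    using patches by simp_all
  show "frontier U = (\<Union>i<m. \<phi> i ` D i)" by (fact fr)
  show "i < m \<Longrightarrow> u \<in> interior (D i) \<Longrightarrow> j < m \<Longrightarrow> w \<in> D j \<Longrightarrow> \<phi> i u = \<phi> j w \<Longrightarrow> i = j \<and> u = w"
    using inj by simp
  show "i < m \<Longrightarrow> u \<in> interior (D i) \<Longrightarrow> inj (frechet_derivative (\<phi> i) (at u))"
    using reg by simp
  show "i < m \<Longrightarrow> u \<in> interior (D i) \<Longrightarrow> jac i v u > 0 \<Longrightarrow>
      (\<forall>\<^sub>F t in at_right 0. \<phi> i u + t *\<^sub>R v \<notin> closure U \<and> \<phi> i u - t *\<^sub>R v \<in> U)"
    using reg unfolding jac_def by simp
qed

lemma patch_C1:
  assumes "i < m"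
  obtains N where "open N" "D i \<subseteq> N" "C1_on (\<phi> i) N"
  using boundary[unfolded oriented_C1_boundary_def, THEN conjunct1] assms by blast

lemma jac_add: "jac i (v + w) u = jac i v u + jac i w u"
  by (simp add: jac_def det4_add)

lemma jac_scale: "jac i (r *\<^sub>R v) u = r * jac i v u"
  by (simp add: jac_def det4_scale)

lemma jac_continuous:
  assumes "C1_on (\<phi> i) N"
  shows "continuous_on N (jac i v)"
proof -
  have "continuous_on N (rpartial k (\<phi> i))" for k
    by (rule continuous_on_eq[OF C1_on_continuous_dderiv[OF assms, of "axis k 1"]])
      (simp add: rpartial_eq_dderiv[OF C1_on_differentiable[OF assms]])
  then show ?thesis
    unfolding jac_def by (intro continuous_on_det4 continuous_intros)
qed

lemma closure_compact: "compact (closure U)"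
  using U_bounded by (simp add: compact_closure)

lemma patch_frontier: "i < m \<Longrightarrow> u \<in> D i \<Longrightarrow> \<phi> i u \<in> frontier U"
  using frontier_U by blast

lemma frontier_W: "frontier U \<subseteq> W"
  using U_W by (auto simp: frontier_def)

lemma frontier_not_U: "x \<in> frontier U \<Longrightarrow> x \<notin> U"
  using U_open by (auto simp: frontier_def interior_open)

text \<open>This turns the pointwise one-sidedness of \<open>U\<close> at a boundary point into a statement
  about each of the two halves of a coordinate box.\<close>

lemma connected_avoiding_frontier:
  assumes "connected S" "S \<inter> frontier U = {}"
  shows "S \<inter> U \<noteq> {} \<Longrightarrow> S \<subseteq> U" and "S - closure U \<noteq> {} \<Longrightarrow> S \<inter> closure U = {}"
proof -
  show "S \<inter> U \<noteq> {} \<Longrightarrow> S \<subseteq> U"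
    using connected_Int_frontier[OF assms(1), of U] assms(2) by blast
  assume "S - closure U \<noteq> {}"
  moreover have "closure U = U \<union> frontier U"
    using closure_Un_frontier[of U] by simp
  ultimately show "S \<inter> closure U = {}"
    using connected_Int_frontier[OF assms(1), of U] assms(2) by blast
qed

lemma dderiv_zero_off_ball:
  assumes "\<And>x. x \<in> W \<Longrightarrow> x \<notin> ball c \<rho> \<Longrightarrow> h x = 0" "x \<in> W" "x \<notin> cball c \<rho>"
  shows "dderiv v h x = 0"
proof -
  have "dderiv v h x = dderiv v (\<lambda>x. 0) x"
    by (rule dderiv_cong[of "W - cball c \<rho>"]) (use assms W_open in \<open>auto intro: open_Diff\<close>)
  then show ?thesis by simp
qed

text \<open>Put \<open>\<Psi> (u, t) = \<phi> u + t v\<close>. By the inverse function theorem this is a chart near the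
  boundary point. In a small box the boundary is the slice \<open>t = 0\<close>, the set \<open>U\<close> is the part
  \<open>t < 0\<close>, and \<open>\<partial>\<^sub>v h\<close> becomes \<open>d/dt\<close>, so the integral over \<open>t\<close> leaves the boundary value of \<open>h\<close>
  multiplied by the Jacobian, which is constant along the lines. The condition \<open>jac i v u0 > 0\<close>
  says that \<open>v\<close> points outward and fixes the sign of the Jacobian.\<close>

lemma stokes_near_patch_transversal:
  assumes i: "i < m" and u0: "u0 \<in> interior (D i)" and v: "jac i v u0 > 0"
  obtains \<rho> where "\<rho> > 0"
    "\<And>h :: real^4 \<Rightarrow> real. C1_on h W \<Longrightarrow> (\<And>x. x \<in> W \<Longrightarrow> x \<notin> ball (\<phi> i u0) \<rho> \<Longrightarrow> h x = 0) \<Longrightarrow> stokes v h"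
proof -
  define x0 where "x0 = \<phi> i u0"
  obtain N where N: "open N" "D i \<subseteq> N" "C1_on (\<phi> i) N"
    using patch_C1[OF i] .
  obtain \<phi>' where \<phi>': "\<And>u. u \<in> N \<Longrightarrow> (\<phi> i has_derivative blinfun_apply (\<phi>' u)) (at u)"
    and \<phi>'_cont: "continuous_on N \<phi>'"
    using N(3) unfolding C1_on_def by blast
  have int_D: "interior (D i) \<subseteq> D i" "u0 \<in> D i" "u0 \<in> N" using u0 N interior_subset by blast+
  define \<Psi> where "\<Psi> y = \<phi> i (tail y) + y$0 *\<^sub>R v" for y
  have \<Psi>_join: "\<Psi> (join u t) = \<phi> i u + t *\<^sub>R v" for u t
    by (simp add: \<Psi>_def)
  define \<Psi>' where "\<Psi>' y = (\<phi>' (tail y) o\<^sub>L Blinfun tail) + (blinfun_scaleR_left v o\<^sub>L Blinfun (\<lambda>w::real^4. w$0))" for y :: "real^4"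
  have \<Psi>'_apply: "blinfun_apply (\<Psi>' y) = (\<lambda>w. \<phi>' (tail y) (tail w) + w$0 *\<^sub>R v)" for y
    by (auto simp: \<Psi>'_def blinfun.add_left bounded_linear_Blinfun_apply bounded_linear_tail bounded_linear_vec_nth)
  define NN where "NN = tail -` N"
  have tail_cont: "continuous_on S tail" for S
    by (rule linear_continuous_on[OF bounded_linear_tail])
  have NN: "open NN"
    unfolding NN_def using N(1) by (intro open_vimage tail_cont)
  have \<Psi>_der: "(\<Psi> has_derivative blinfun_apply (\<Psi>' y)) (at y)" if "y \<in> NN" for y
  proof -
    have "(\<phi> i has_derivative \<phi>' (tail y)) (at (tail y))"
      using that \<phi>' by (simp add: NN_def)
    from has_derivative_compose[OF bounded_linear_imp_has_derivative[OF bounded_linear_tail] this]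
    have 1: "((\<lambda>y. \<phi> i (tail y)) has_derivative (\<lambda>w. \<phi>' (tail y) (tail w))) (at y)" .
    have 2: "((\<lambda>y::real^4. y$0 *\<^sub>R v) has_derivative (\<lambda>w. w$0 *\<^sub>R v)) (at y)"
      by (intro bounded_linear_imp_has_derivative bounded_linear_compose[OF bounded_linear_scaleR_left] bounded_linear_vec_nth)
    show ?thesis
      unfolding \<Psi>_def[abs_def] \<Psi>'_apply by (rule has_derivative_add[OF 1 2])
  qed
  have \<Psi>'_cont: "continuous_on NN \<Psi>'"
    unfolding \<Psi>'_def NN_def
    by (intro continuous_intros continuous_on_compose2[OF \<phi>'_cont tail_cont]) auto
  have rp: "rpartial k (\<phi> i) u = \<phi>' u (axis k 1)" if "u \<in> N" for k u
    using rpartial_eq_dderiv[of "\<phi> i" u k] frechet_derivative_at[OF \<phi>'[OF that]] \<phi>'[OF that]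
    by (auto simp: differentiable_def)
  have jac_det: "det (matrix (blinfun_apply (\<Psi>' y))) = jac i v (tail y)" if "y \<in> NN" for y
    unfolding \<Psi>'_apply using that
    by (subst det_matrix_graph) (auto simp: blinfun.bounded_linear_right jac_def rp NN_def)
  define y0 where "y0 = join u0 0"
  have y0: "y0 \<in> NN" using int_D by (simp add: y0_def NN_def)
  obtain invf where invf: "invf o\<^sub>L \<Psi>' y0 = id_blinfun"
  proof -
    let ?A = "matrix (blinfun_apply (\<Psi>' y0))"
    have "det ?A \<noteq> 0" using jac_det[OF y0] v by (simp add: y0_def)
    then obtain B where B: "B ** ?A = mat 1"
      using invertible_det_nz unfolding invertible_def by blast
    have "Blinfun ((*v) B) o\<^sub>L \<Psi>' y0 = id_blinfun"
    proof (rule blinfun_eqI)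
      fix w
      have "\<Psi>' y0 w = ?A *v w"
        by (simp add: matrix_works blinfun.bounded_linear_right bounded_linear.linear)
      then show "(Blinfun ((*v) B) o\<^sub>L \<Psi>' y0) w = id_blinfun w"
        by (simp add: bounded_linear_Blinfun_apply matrix_vector_mul_bounded_linear matrix_vector_mul_assoc B)
    qed
    then show ?thesis using that by blast
  qed
  obtain U' V g g' where U': "open U'" "U' \<subseteq> NN" "y0 \<in> U'" and V: "open V" and hom: "homeomorphism U' V \<Psi> g"
    by (rule inverse_function_theorem[OF NN \<Psi>_der \<Psi>'_cont y0 invf])
  have inj: "inj_on \<Psi> U'"
    by (rule inj_on_inverseI[of _ g]) (use hom in \<open>auto simp: homeomorphism_def\<close>)
  have open_image: "open (\<Psi> ` S)" if "open S" "S \<subseteq> U'" for S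
    using homeomorphism_imp_open_map[OF hom, of S] that
    unfolding openin_open_eq[OF V] openin_open_eq[OF U'(1)] by simp
  have \<Psi>_cont: "continuous_on U' \<Psi>"
    using hom homeomorphism_cont1 by blast
  have join_cont: "continuous_on S (\<lambda>(u, t). join u t)" for S
    by (rule linear_continuous_on[OF bounded_linear_join])
  have box: "\<exists>r>0. \<exists>\<tau>>0. \<forall>u\<in>ball u0 r. \<forall>t\<in>{-\<tau>..\<tau>}. join u t \<in> G" if "open G" "y0 \<in> G" for G
  proof -
    have "open ((\<lambda>(u, t). join u t) -` G)" "(u0, 0) \<in> (\<lambda>(u, t). join u t) -` G"
      using that by (auto intro: open_vimage join_cont simp: y0_def)
    then obtain A B where AB: "open A" "open B" "u0 \<in> A" "0 \<in> B" "A \<times> B \<subseteq> (\<lambda>(u, t). join u t) -` G"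
      by (auto elim!: open_prod_elim)
    obtain r where r: "r > 0" "ball u0 r \<subseteq> A" using AB open_contains_ball by blast
    obtain \<tau> where \<tau>: "\<tau> > 0" "cball 0 \<tau> \<subseteq> B" using AB open_contains_cball by blast
    have "join u t \<in> G" if "u \<in> ball u0 r" "t \<in> {-\<tau>..\<tau>}" for u t
    proof -
      have "t \<in> cball 0 \<tau>" using that by (auto simp: dist_norm)
      then have "(u, t) \<in> A \<times> B" using that r \<tau> by blast
      then show ?thesis using AB(5) by auto
    qed
    then show ?thesis using r(1) \<tau>(1) by blast
  qed
  \<comment> \<open>The order of the choices matters: the radius r1 is fixed first, inside the domain of
      injectivity, and only then the box is shrunk so that it avoids the set K of
      all boundary points except those of this patch with parameters within r1 of u0.\<close>
  obtain r1 where r1: "r1 > 0" "ball u0 r1 \<subseteq> interior (D i)" "\<And>u. u \<in> ball u0 r1 \<Longrightarrow> jac i v u > 0"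
    "\<And>u. u \<in> ball u0 r1 \<Longrightarrow> join u 0 \<in> U'"
  proof -
    obtain ra \<tau>a where a: "ra > 0" "\<tau>a > 0" "\<forall>u\<in>ball u0 ra. \<forall>t\<in>{-\<tau>a..\<tau>a}. join u t \<in> U'"
      using box[OF U'(1,3)] by blast
    obtain rb where b: "rb > 0" "ball u0 rb \<subseteq> interior (D i)"
      using u0 open_contains_ball by blast
    have "open {u \<in> N. jac i v u \<in> {0<..}}"
      using continuous_open_preimage[OF jac_continuous[OF N(3), of v] N(1), of "{0<..}"]
      by (simp add: vimage_def Int_def)
    moreover have "u0 \<in> {u \<in> N. jac i v u \<in> {0<..}}" using v int_D by auto
    ultimately obtain rc where c: "rc > 0" "ball u0 rc \<subseteq> {u \<in> N. jac i v u \<in> {0<..}}"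
      using open_contains_ball by blast
    show ?thesis
      by (rule that[of "min ra (min rb rc)"]) (use a b c in auto)
  qed
  define K where "K = (\<Union>j\<in>{..<m}-{i}. \<phi> j ` D j) \<union> \<phi> i ` (D i - ball u0 r1)"
  have img_compact: "compact (\<phi> j ` S)" if "j < m" "compact S" "S \<subseteq> D j" for j S
  proof -
    obtain N' where "D j \<subseteq> N'" "C1_on (\<phi> j) N'" using patch_C1[OF \<open>j < m\<close>] by blast
    then show ?thesis
      using that by (meson C1_on_continuous compact_continuous_image continuous_on_subset subset_trans)
  qed
  have "compact K"
    unfolding K_def using i by (intro compact_Un compact_UN img_compact compact_diff D_compact) auto
  moreover have "x0 \<notin> K"
  proof
    assume "x0 \<in> K"
    then consider j w where "j < m" "j \<noteq> i" "w \<in> D j" "\<phi> i u0 = \<phi> j w"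
      | w where "w \<in> D i - ball u0 r1" "\<phi> i u0 = \<phi> i w"
      by (auto simp: K_def x0_def)
    then show False
      using patch_inj[OF i u0] i r1(1) by cases force+
  qed
  ultimately have K: "open (W - K)" "x0 \<in> W - K"
    using W_open compact_imp_closed patch_frontier[OF i int_D(2)] frontier_W
    by (auto simp: x0_def intro: open_Diff)
  have G: "open (U' \<inter> \<Psi> -` (W - K))" "y0 \<in> U' \<inter> \<Psi> -` (W - K)"
    using continuous_open_preimage[OF \<Psi>_cont U'(1) K(1)] K(2) U'(3) by (auto simp: x0_def y0_def \<Psi>_join)
  obtain r2 \<tau> where r2: "r2 > 0" "\<tau> > 0"
    "\<And>u t. u \<in> ball u0 r2 \<Longrightarrow> t \<in> {-\<tau>..\<tau>} \<Longrightarrow> join u t \<in> U' \<and> \<Psi> (join u t) \<in> W - K"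
    using box[OF G] by blast
  have v0: "v \<noteq> 0" using v jac_scale[of i 0 v u0] by auto
  obtain r where r: "0 < r" "r \<le> r1" "r \<le> r2" "\<And>u. u \<in> ball u0 r \<Longrightarrow> dist (\<phi> i u) x0 < \<tau> * norm v / 4"
  proof -
    have "isCont (\<phi> i) u0"
      using \<phi>'[OF int_D(3)] has_derivative_continuous by blast
    moreover have "0 < \<tau> * norm v / 4" using r2 v0 by simp
    ultimately obtain d where d: "d > 0" "\<And>u. dist u u0 < d \<Longrightarrow> dist (\<phi> i u) x0 < \<tau> * norm v / 4"
      unfolding continuous_at_eps_delta x0_def by blast
    show ?thesis
      by (rule that[of "min d (min r1 r2)"]) (use d r1 r2 in \<open>auto simp: dist_commute\<close>)
  qed
  define Q where "Q = (\<lambda>T. {y. tail y \<in> ball u0 r \<and> y$0 \<in> T})"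
  have Q_open: "open (Q T)" if "open T" for T
  proof -
    have "Q T = tail -` ball u0 r \<inter> (\<lambda>y. y$0) -` T" by (auto simp: Q_def)
    then show ?thesis
      using that by (auto intro!: open_Int open_vimage tail_cont continuous_intros)
  qed
  have Q_conv: "convex (Q T)" if "convex T" for T
  proof -
    have "Q T = tail -` ball u0 r \<inter> (\<lambda>y. y$0) -` T" by (auto simp: Q_def)
    moreover have "linear (\<lambda>y::real^4. y$0)" by (simp add: bounded_linear.linear bounded_linear_vec_nth)
    ultimately show ?thesis
      using that bounded_linear_tail
      by (auto intro!: convex_Int convex_linear_vimage bounded_linear.linear)
  qed
  have Q_sub: "y \<in> U'" "\<Psi> y \<in> W - K" if "y \<in> Q {-\<tau>..\<tau>}" for y
    using that r2(3)[of "tail y" "y$0"] r(3) by (auto simp: Q_def)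
  have Q_mono: "Q S \<subseteq> Q T" if "S \<subseteq> T" for S T
    using that by (auto simp: Q_def)
  have Q1: "Q {-\<tau><..<\<tau>} \<subseteq> Q {-\<tau>..\<tau>}" and Q2: "Q {-\<tau><..<0} \<subseteq> Q {-\<tau>..\<tau>}"
    and Q3: "Q {-\<tau><..<0} \<subseteq> Q {-\<tau>..<0}"
    using r2(2) by (auto simp: Q_def)
  \<comment> \<open>A boundary point in the box has a parameter near u0, so it is the image of a point with
      t = 0; injectivity identifies the two.\<close>
  have Q_front: "y$0 = 0" if y: "y \<in> Q {-\<tau>..\<tau>}" and "\<Psi> y \<in> frontier U" for y
  proof -
    have "\<Psi> y \<notin> K" using Q_sub[OF y] by simp
    then obtain u where u: "u \<in> ball u0 r1" "\<Psi> y = \<phi> i u"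
      using \<open>\<Psi> y \<in> frontier U\<close> unfolding frontier_U K_def by blast
    then have "\<Psi> y = \<Psi> (join u 0)" by (simp add: \<Psi>_join)
    then have "y = join u 0"
      using inj Q_sub(1)[OF y] r1(4)[OF u(1)] by (simp add: inj_on_def)
    then show ?thesis by simp
  qed
  have conn: "connected (\<Psi> ` Q T)" if "convex T" "T \<subseteq> {-\<tau>..\<tau>}" for T
    using Q_sub(1) Q_mono[OF that(2)] Q_conv[OF that(1)]
    by (intro connected_continuous_image convex_connected continuous_on_subset[OF \<Psi>_cont]) auto
  obtain s where s: "0 < s" "s < \<tau>" "x0 + s *\<^sub>R v \<notin> closure U" "x0 - s *\<^sub>R v \<in> U"
  proof -
    have "\<forall>\<^sub>F t in at_right 0. t \<in> {0<..<\<tau>}" using r2(2) by (rule eventually_at_right_real)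
    then have "\<forall>\<^sub>F t in at_right (0::real). t \<in> {0<..<\<tau>} \<and> x0 + t *\<^sub>R v \<notin> closure U \<and> x0 - t *\<^sub>R v \<in> U"
      using patch_oriented[OF i u0 v] unfolding x0_def by eventually_elim auto
    from eventually_happens[OF this] show ?thesis using that by auto
  qed
  have upper: "\<Psi> ` Q {0<..\<tau>} \<inter> closure U = {}"
  proof (rule connected_avoiding_frontier(2)[OF conn])
    show "\<Psi> ` Q {0<..\<tau>} \<inter> frontier U = {}"
      using Q_front Q_mono[of "{0<..\<tau>}" "{-\<tau>..\<tau>}"] r2(2) by (force simp: Q_def)
    have "join u0 s \<in> Q {0<..\<tau>}" using s r by (auto simp: Q_def)
    then show "\<Psi> ` Q {0<..\<tau>} - closure U \<noteq> {}"
      using s(3) \<Psi>_join[of u0 s] by (metis DiffI empty_iff image_eqI x0_def)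
  qed (use r2 in auto)
  have lower: "\<Psi> ` Q {-\<tau>..<0} \<subseteq> U"
  proof (rule connected_avoiding_frontier(1)[OF conn])
    show "\<Psi> ` Q {-\<tau>..<0} \<inter> frontier U = {}"
      using Q_front Q_mono[of "{-\<tau>..<0}" "{-\<tau>..\<tau>}"] r2(2) by (force simp: Q_def)
    have "join u0 (-s) \<in> Q {-\<tau>..<0}" using s r by (auto simp: Q_def)
    moreover have "\<Psi> (join u0 (-s)) = x0 - s *\<^sub>R v" by (simp add: \<Psi>_join x0_def)
    ultimately show "\<Psi> ` Q {-\<tau>..<0} \<inter> U \<noteq> {}"
      using s(4) by (metis IntI empty_iff image_eqI)
  qed (use r2 in auto)
  have "open (\<Psi> ` Q {-\<tau><..<\<tau>})"
    using Q_sub(1) Q1 by (intro open_image Q_open) (simp, blast)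
  moreover have "x0 \<in> \<Psi> ` Q {-\<tau><..<\<tau>}"
    using r r2 by (intro image_eqI[of _ _ y0]) (auto simp: y0_def \<Psi>_join x0_def Q_def)
  ultimately obtain \<rho>0 where \<rho>0: "\<rho>0 > 0" "cball x0 \<rho>0 \<subseteq> \<Psi> ` Q {-\<tau><..<\<tau>}"
    using open_contains_cball by blast
  \<comment> \<open>The second bound keeps the far end t = - \<tau> of every line outside the support of h.\<close>
  define \<rho> where "\<rho> = min \<rho>0 (\<tau> * norm v / 4)"
  have \<rho>: "\<rho> > 0" "cball x0 \<rho> \<subseteq> \<Psi> ` Q {-\<tau><..<\<tau>}" "\<rho> \<le> \<tau> * norm v / 4"
    using \<rho>0 r2 v0 by (auto simp: \<rho>_def)
  have ball_W: "cball x0 \<rho> \<subseteq> W"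
    using \<rho>(2) Q_sub(2) Q1 by blast
  have in_patch: "j = i \<and> u \<in> ball u0 r" if "j < m" "u \<in> D j" "\<phi> j u \<in> cball x0 \<rho>" for j u
  proof -
    obtain y where y: "y \<in> Q {-\<tau><..<\<tau>}" "\<phi> j u = \<Psi> y" using \<rho>(2) \<open>\<phi> j u \<in> cball x0 \<rho>\<close> by blast
    have y': "y \<in> Q {-\<tau>..\<tau>}" using y(1) by (auto simp: Q_def)
    have "y$0 = 0" by (rule Q_front[OF y']) (use that y patch_frontier in metis)
    then have "\<phi> j u = \<phi> i (tail y)" using y(2) by (simp add: \<Psi>_def)
    moreover have ty: "tail y \<in> ball u0 r" "tail y \<in> interior (D i)" using y(1) r(2) r1(2) by (auto simp: Q_def)
    ultimately show ?thesis using patch_inj[OF i ty(2) that(1,2)] by auto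
  qed
  \<comment> \<open>The half of the box that lies in U.\<close>
  define Qm where "Qm = Q {-\<tau><..<0}"
  have Qm: "open Qm" "Qm \<subseteq> U'" "\<Psi> ` Qm \<subseteq> U" "Qm \<subseteq> NN"
    using Q_open[of "{-\<tau><..<0}"] Q_sub(1) Q2 Q3 lower U'(2) unfolding Qm_def by simp_all blast+
  have U_cball: "U \<inter> cball x0 \<rho> \<subseteq> \<Psi> ` Qm"
  proof
    fix x assume x: "x \<in> U \<inter> cball x0 \<rho>"
    then obtain y where y: "y \<in> Q {-\<tau><..<\<tau>}" "x = \<Psi> y" using \<rho>(2) by blast
    have "y$0 < 0"
    proof (rule ccontr)
      assume "\<not> y$0 < 0"
      then consider "y$0 = 0" | "y \<in> Q {0<..\<tau>}" using y(1) by (force simp: Q_def)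
      then show False
      proof cases
        case 1
        then have "x = \<phi> i (tail y)" "tail y \<in> D i"
          using y(2) subsetD[OF int_D(1) subsetD[OF r1(2)], of "tail y"] y(1) r(2) by (auto simp: \<Psi>_def Q_def)
        then show False using patch_frontier[OF i] frontier_not_U x by blast
      next
        case 2
        then show False using upper x y closure_subset by blast
      qed
    qed
    then have "y \<in> Qm" using y(1) by (auto simp: Q_def Qm_def)
    then show "x \<in> \<Psi> ` Qm" using y(2) by blast
  qed
  have main: "stokes v h" if h: "C1_on h W" and h0: "\<And>x. x \<in> W \<Longrightarrow> x \<notin> ball x0 \<rho> \<Longrightarrow> h x = 0"
    for h :: "real^4 \<Rightarrow> real"
  proof -
    let ?k = "dderiv v h"
    have k0: "?k x = 0" if "x \<in> W" "x \<notin> cball x0 \<rho>" for x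
      by (rule dderiv_zero_off_ball[where c = x0 and \<rho> = \<rho>]) (use h0 that in auto)
    have QmW: "\<Psi> ` Qm \<subseteq> W" using Qm(3) U_W closure_subset by blast
    have opI: "open (\<Psi> ` Qm)" using open_image Qm by blast
    have kc: "continuous_on W ?k" using h by (rule C1_on_continuous_dderiv)
    have kint: "set_integrable lborel (\<Psi> ` Qm) ?k"
    proof -
      have "set_integrable lborel (\<Psi> ` Qm \<inter> cball x0 \<rho>) ?k"
        by (rule set_integrable_compact[OF compact_cball continuous_on_subset[OF kc ball_W]]) (use opI in auto)
      moreover have "(\<lambda>x. indicator (\<Psi> ` Qm \<inter> cball x0 \<rho>) x *\<^sub>R ?k x) = (\<lambda>x. indicator (\<Psi> ` Qm) x *\<^sub>R ?k x)"
      proof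
        show "indicator (\<Psi> ` Qm \<inter> cball x0 \<rho>) x *\<^sub>R ?k x = indicator (\<Psi> ` Qm) x *\<^sub>R ?k x" for x
          using k0[of x] QmW by (auto simp: indicator_def)
      qed
      ultimately show ?thesis unfolding set_integrable_def by (simp only:)
    qed
    have L1: "integral U ?k = integral (\<Psi> ` Qm) ?k"
      by (rule integral_eq_on_superset[symmetric])
        (use Qm(3) U_cball k0 U_W closure_subset in blast)+
    let ?F = "\<lambda>y. jac i v (tail y) * ?k (\<Psi> y)"
    have jpos: "jac i v (tail y) > 0" if "y \<in> Qm" for y
      using that r r1 by (auto simp: Qm_def Q_def)
    have det_abs: "\<bar>det (matrix (blinfun_apply (\<Psi>' y)))\<bar> * ?k (\<Psi> y) = ?F y" if "y \<in> Qm" for y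
      using jac_det[of y] jpos[OF that] that Qm(4) by auto
    have Qm_leb: "Qm \<in> sets lebesgue" using Qm(1) by (simp add: borel_open)
    have der: "(\<Psi> has_derivative blinfun_apply (\<Psi>' y)) (at y within Qm)" if "y \<in> Qm" for y
      using \<Psi>_der that Qm(4) has_derivative_at_withinI by blast
    let ?C = "\<lambda>y. \<bar>det (matrix (blinfun_apply (\<Psi>' y)))\<bar> * ?k (\<Psi> y)"
    have cov: "?C absolutely_integrable_on Qm" "integral Qm ?C = integral (\<Psi> ` Qm) ?k"
      by (rule change_of_variables_real[OF Qm_leb der inj_on_subset[OF inj Qm(2)]
        set_integrable_imp_absolutely_integrable[OF kint]]; assumption)+
    have Fabs: "?F absolutely_integrable_on Qm"
    proof -
      have "set_integrable lebesgue Qm ?C \<longleftrightarrow> set_integrable lebesgue Qm ?F"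
        by (rule set_integrable_cong[OF refl refl]) (rule det_abs)
      then show ?thesis using cov(1) by (rule iffD1)
    qed
    have L2: "integral (\<Psi> ` Qm) ?k = integral Qm ?F"
    proof (rule cov(2)[symmetric, THEN trans])
      show "integral Qm ?C = integral Qm ?F" by (rule integral_cong) (rule det_abs)
    qed
    have Fcont: "continuous_on Qm ?F"
    proof (intro continuous_intros)
      show "continuous_on Qm (\<lambda>y. jac i v (tail y))"
        by (rule continuous_on_compose2[OF jac_continuous[OF N(3)] tail_cont]) (use Qm(4) in \<open>auto simp: NN_def\<close>)
      show "continuous_on Qm (\<lambda>y. ?k (\<Psi> y))"
        by (rule continuous_on_compose2[OF kc continuous_on_subset[OF \<Psi>_cont Qm(2)]]) (use QmW in auto)
    qed
    have Fint: "set_integrable lborel Qm ?F"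
      using Fabs set_integrable_lborel_iff[OF borel_measurable_continuous_on_indicator[OF _ Fcont]] Qm(1)
      by auto
    have "integral Qm ?F = (\<integral>y. indicator Qm y *\<^sub>R ?F y \<partial>lborel)"
      using set_borel_integral_eq_integral(2)[OF Fint] by (simp add: set_lebesgue_integral_def)
    also have "\<dots> = (\<integral>u. (\<integral>t. indicator Qm (join u t) *\<^sub>R ?F (join u t) \<partial>lborel) \<partial>lborel)"
      using integral_product_coordinates[OF linear_join bij_join Fint[unfolded set_integrable_def]] by simp
    also have "\<dots> = (\<integral>u. indicator (ball u0 r) u *\<^sub>R (jac i v u *\<^sub>R h (\<phi> i u)) \<partial>lborel)"
    proof (rule Bochner_Integration.integral_cong[OF refl])
      fix u :: "real^3"
      show "(\<integral>t. indicator Qm (join u t) *\<^sub>R ?F (join u t) \<partial>lborel) = indicator (ball u0 r) u *\<^sub>R (jac i v u *\<^sub>R h (\<phi> i u))"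
      proof (cases "u \<in> ball u0 r")
        case True
        have W_line: "\<phi> i u + t *\<^sub>R v \<in> W" if "t \<in> {-\<tau>..\<tau>}" for t
          using r2(3)[of u t] that True r(3) by (auto simp: \<Psi>_join)
        have hd: "((\<lambda>t. h (\<phi> i u + t *\<^sub>R v)) has_vector_derivative ?k (\<phi> i u + t *\<^sub>R v)) (at t)"
          if "t \<in> {-\<tau>..\<tau>}" for t
          by (rule dderiv_line) (use C1_on_differentiable[OF h W_line[OF that]] in simp)
        have end0: "h (\<phi> i u + (-\<tau>) *\<^sub>R v) = 0"
        proof (rule h0)
          show "\<phi> i u + (-\<tau>) *\<^sub>R v \<in> W" using W_line[of "-\<tau>"] r2(2) by simp
          have "norm (\<tau> *\<^sub>R v) \<le> dist (\<phi> i u + (-\<tau>) *\<^sub>R v) x0 + dist (\<phi> i u) x0"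
            using norm_triangle_ineq4[of "\<phi> i u - x0" "\<phi> i u + (-\<tau>) *\<^sub>R v - x0"]
            by (simp add: dist_norm)
          then have "\<tau> * norm v \<le> dist (\<phi> i u + (-\<tau>) *\<^sub>R v) x0 + \<tau> * norm v / 4"
            using r(4)[OF True] r2(2) by simp
          moreover have "0 < \<tau> * norm v" using r2 v0 by simp
          ultimately show "\<phi> i u + (-\<tau>) *\<^sub>R v \<notin> ball x0 \<rho>"
            using \<rho>(3) by (simp add: dist_commute)
        qed
        have "((\<lambda>t. ?k (\<phi> i u + t *\<^sub>R v)) has_integral
            (h (\<phi> i u + 0 *\<^sub>R v) - h (\<phi> i u + (-\<tau>) *\<^sub>R v))) {-\<tau>..0}"
        proof (rule fundamental_theorem_of_calculus)
          show "-\<tau> \<le> 0" using r2(2) by simp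
          show "((\<lambda>t. h (\<phi> i u + t *\<^sub>R v)) has_vector_derivative ?k (\<phi> i u + t *\<^sub>R v)) (at t within {-\<tau>..0})"
            if "t \<in> {-\<tau>..0}" for t
            by (rule has_vector_derivative_at_within[OF hd]) (use that r2(2) in simp)
        qed
        then have I1: "integral {-\<tau>..0} (\<lambda>t. ?k (\<phi> i u + t *\<^sub>R v)) = h (\<phi> i u)"
          using end0 by (simp add: integral_unique)
        have "continuous_on {-\<tau>..0} (\<lambda>t. ?k (\<phi> i u + t *\<^sub>R v))"
        proof (rule continuous_on_compose2[OF kc])
          show "continuous_on {-\<tau>..0} (\<lambda>t. \<phi> i u + t *\<^sub>R v)" by (intro continuous_intros)
          show "(\<lambda>t. \<phi> i u + t *\<^sub>R v) ` {-\<tau>..0} \<subseteq> W" using W_line r2(2) by (simp add: image_subset_iff)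
        qed
        then have "set_integrable lborel {-\<tau><..<0} (\<lambda>t. ?k (\<phi> i u + t *\<^sub>R v))"
          by (rule set_integrable_compact[OF compact_Icc]) auto
        from set_borel_integral_eq_integral(2)[OF this] I1
        have I2: "(\<integral>t. indicator {-\<tau><..<0} t *\<^sub>R ?k (\<phi> i u + t *\<^sub>R v) \<partial>lborel) = h (\<phi> i u)"
          by (simp add: set_lebesgue_integral_def integral_open_interval_real)
        have "(\<integral>t. indicator Qm (join u t) *\<^sub>R ?F (join u t) \<partial>lborel)
            = (\<integral>t. jac i v u * (indicator {-\<tau><..<0} t *\<^sub>R ?k (\<phi> i u + t *\<^sub>R v)) \<partial>lborel)"
          using True by (intro Bochner_Integration.integral_cong) (auto simp: Qm_def Q_def \<Psi>_join indicator_def)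
        also have "\<dots> = jac i v u * h (\<phi> i u)" by (simp only: I2 integral_mult_right_zero)
        finally show ?thesis using True by (simp del: mult_cancel_left)
      next
        case False
        then show ?thesis by (simp add: Qm_def Q_def)
      qed
    qed
    also have "\<dots> = integral (ball u0 r) (\<lambda>u. jac i v u *\<^sub>R h (\<phi> i u))"
    proof -
      have "continuous_on (D i) (\<lambda>u. jac i v u *\<^sub>R h (\<phi> i u))"
      proof (intro continuous_intros)
        show "continuous_on (D i) (jac i v)"
          using jac_continuous[OF N(3)] N(2) continuous_on_subset by blast
        show "continuous_on (D i) (\<lambda>u. h (\<phi> i u))"
          by (rule continuous_on_compose2[OF C1_on_continuous[OF h] continuous_on_subset[OF C1_on_continuous[OF N(3)] N(2)]])
            (use patch_frontier[OF i] frontier_W in auto)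
      qed
      then have "set_integrable lborel (ball u0 r) (\<lambda>u. jac i v u *\<^sub>R h (\<phi> i u))"
        by (rule set_integrable_compact[OF D_compact[OF i]]) (use r(2) r1(2) int_D(1) in \<open>auto 0 3\<close>)
      from set_borel_integral_eq_integral(2)[OF this] show ?thesis
        by (simp add: set_lebesgue_integral_def)
    qed
    also have "\<dots> = integral (D i) (\<lambda>u. jac i v u *\<^sub>R h (\<phi> i u))"
    proof (rule integral_eq_on_superset)
      show "ball u0 r \<subseteq> D i" using r(2) r1(2) int_D(1) by (auto 0 3)
      fix u assume u: "u \<in> D i" "u \<notin> ball u0 r"
      then have "\<phi> i u \<notin> cball x0 \<rho>" using in_patch[OF i] by blast
      then have "h (\<phi> i u) = 0"
        using h0[of "\<phi> i u"] patch_frontier[OF i u(1)] frontier_W by auto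
      then show "jac i v u *\<^sub>R h (\<phi> i u) = 0" by simp
    qed
    also have "\<dots> = flux v h"
    proof -
      have "integral (D j) (\<lambda>u. jac j v u *\<^sub>R h (\<phi> j u)) = 0" if "j < m" "j \<noteq> i" for j
      proof -
        have "integral (D j) (\<lambda>u. jac j v u *\<^sub>R h (\<phi> j u)) = integral (D j) (\<lambda>u. 0)"
        proof (rule integral_cong)
          fix u assume u: "u \<in> D j"
          then have "\<phi> j u \<notin> cball x0 \<rho>" using in_patch that by blast
          then show "jac j v u *\<^sub>R h (\<phi> j u) = 0"
            using h0[of "\<phi> j u"] patch_frontier[OF that(1) u] frontier_W by auto
        qed
        then show ?thesis by simp
      qed
      then show ?thesis
        unfolding flux_def using i by (subst sum.remove[of _ i]) (auto intro!: sum.neutral)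
    qed
    finally show ?thesis
      unfolding stokes_def L1 L2 .
  qed
  show ?thesis
    by (rule that[OF \<rho>(1)]) (use main in \<open>simp add: x0_def\<close>)
qed

end

lemma integral_indicator_le_measure:
  fixes B :: "'a::euclidean_space set"
  assumes "bounded B" "open B" "open U"
  shows "(\<lambda>x. indicator B x :: real) integrable_on U" "integral U (indicator B) \<le> measure lebesgue B"
proof -
  have L: "B \<in> lmeasurable" "B \<inter> U \<in> lmeasurable"
    using assms by (auto intro!: lmeasurable_open bounded_Int)
  show "(\<lambda>x. indicator B x :: real) integrable_on U"
    using L(2) by (simp add: integrable_on_indicator)
  have "integral U (indicator B :: 'a \<Rightarrow> real) = measure lebesgue (B \<inter> U)"
    using integral_indicator[OF L(2)] .
  also have "\<dots> \<le> measure lebesgue B"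
    using L by (intro measure_mono_fmeasurable) auto
  finally show "integral U (indicator B) \<le> measure lebesgue B" .
qed

section \<open>Covering the image of a null set\<close>

text \<open>On a compact neighbourhood of \<open>C\<close> the derivative is bounded, and short segments
  starting in \<open>C\<close> stay inside it. The bound is confined to nearby points because \<open>N\<close> need not contain the
  segment between distant ones.\<close>

lemma C1_locally_Lipschitz_at_compact:
  fixes f :: "'a::euclidean_space \<Rightarrow> 'b::real_normed_vector"
  assumes N: "open N" "C \<subseteq> N" "compact C" and f: "C1_on f N"
  obtains d L where "d > 0" "L > 0"
    "\<And>x y. x \<in> C \<Longrightarrow> dist x y < d \<Longrightarrow> dist (f x) (f y) \<le> L * dist x y"
proof -
  obtain f' where f': "\<And>x. x \<in> N \<Longrightarrow> (f has_derivative blinfun_apply (f' x)) (at x)"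
    and c: "continuous_on N f'"
    using f unfolding C1_on_def by blast
  obtain e where e: "e > 0" "(\<Union>x\<in>C. cball x e) \<subseteq> N"
    using compact_subset_open_imp_cball_epsilon_subset[OF N(3,1,2)] by blast
  have "(\<Union>x\<in>C. cball x e) = {x + y | x y. x \<in> C \<and> y \<in> cball 0 e}"
  proof (intro equalityI subsetI)
    fix z assume "z \<in> (\<Union>x\<in>C. cball x e)"
    then obtain x where "x \<in> C" "dist x z \<le> e" by auto
    then have "z = x + (z - x) \<and> x \<in> C \<and> z - x \<in> cball 0 e" by (simp add: dist_norm norm_minus_commute)
    then show "z \<in> {x + y | x y. x \<in> C \<and> y \<in> cball 0 e}" by blast
  qed (force simp: dist_norm)
  then have "compact (\<Union>x\<in>C. cball x e)"
    using compact_sums[OF N(3) compact_cball[of 0 e]] by simp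
  then have "bounded (f' ` (\<Union>x\<in>C. cball x e))"
    using c e(2) by (meson compact_continuous_image compact_imp_bounded continuous_on_subset)
  then obtain L where L: "L > 0" "\<And>z. z \<in> (\<Union>x\<in>C. cball x e) \<Longrightarrow> norm (f' z) \<le> L"
    unfolding bounded_pos by blast
  show ?thesis
  proof (rule that[OF e(1) L(1)])
    fix x y assume xy: "x \<in> C" "dist x y < e"
    have "norm (f x - f y) \<le> L * norm (x - y)"
    proof (rule differentiable_bound[where S = "cball x e" and f' = "\<lambda>z. blinfun_apply (f' z)"])
      show "(f has_derivative blinfun_apply (f' z)) (at z within cball x e)" if "z \<in> cball x e" for z
      proof (rule has_derivative_at_withinI[OF f'])
        show "z \<in> N" using e(2) that xy(1) by blast
      qed
      show "onorm (blinfun_apply (f' z)) \<le> L" if "z \<in> cball x e" for z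
        using L(2)[of z] that xy(1) by (auto simp: norm_blinfun.rep_eq)
    qed (use xy e(1) in auto)
    then show "dist (f x) (f y) \<le> L * dist x y" by (simp add: dist_norm)
  qed
qed

text \<open>The third power is the dimension of the parameter space: a set with small covers at
  all small scales has vanishing three-dimensional content.\<close>

definition small_cover :: "'a::metric_space set \<Rightarrow> real \<Rightarrow> real \<Rightarrow> bool"
  where "small_cover S s \<delta> \<longleftrightarrow> (\<exists>A. finite A \<and> A \<subseteq> S \<and> S \<subseteq> (\<Union>c\<in>A. ball c s) \<and> real (card A) * s ^ 3 < \<delta>)"

text \<open>A compact null set has an open neighbourhood \<open>T\<close> of small measure, which contains
  all balls of a small radius \<open>t\<close> centred in the set. Vitali's lemma selects disjoint ones whose
  fivefold enlargements still cover; disjointness bounds their number by a multiple of the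
  measure of \<open>T\<close> divided by \<open>t ^ 3\<close>, and the Lipschitz bound carries the cover over to the image.\<close>

lemma cover_image_of_null_set:
  fixes f :: "real^3 \<Rightarrow> 'b::real_normed_vector"
  assumes N: "open N" "C \<subseteq> N" "compact C" and f: "C1_on f N" and C: "negligible C" and \<delta>: "\<delta> > 0"
  shows "\<forall>\<^sub>F s in at_right (0::real). small_cover (f ` C) s \<delta>"
proof -
  obtain d L where d: "d > 0" and L: "L > 0"
    and lip: "\<And>x y. x \<in> C \<Longrightarrow> dist x y < d \<Longrightarrow> dist (f x) (f y) \<le> L * dist x y"
    using C1_locally_Lipschitz_at_compact[OF N f] by blast
  have "0 < \<delta> / (5 * L) ^ 3" using \<delta> L by simp
  then obtain T where T: "open T" "C \<subseteq> T" "T - C \<in> lmeasurable" "emeasure lebesgue (T - C) < ennreal (\<delta> / (5 * L) ^ 3)"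
    using sets_lebesgue_outer_open[OF negligible_imp_sets[OF C]] by blast
  have T_eq: "T = (T - C) \<union> C" using T(2) by blast
  have T_meas: "T \<in> lmeasurable"
    by (subst T_eq) (intro fmeasurable.Un T(3) negligible_imp_measurable C)
  have "measure lebesgue T = measure lebesgue (T - C)"
    by (rule measure_negligible_symdiff[OF T(3)]) (use C T(2) in \<open>auto intro: negligible_subset\<close>)
  also have "\<dots> < \<delta> / (5 * L) ^ 3"
    using T(3,4) by (simp add: emeasure_eq_measure2 ennreal_less_iff)
  finally have T_small: "measure lebesgue T < \<delta> / (5 * L) ^ 3" .
  obtain e where e: "e > 0" "(\<Union>x\<in>C. ball x e) \<subseteq> T"
    using compact_subset_open_imp_ball_epsilon_subset[OF N(3) T(1,2)] by blast
  have "\<forall>\<^sub>F s in at_right 0. s \<in> {0<..<5 * L * min e (d / 5)}"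
    by (rule eventually_at_right_real) (use d e L in simp)
  then show ?thesis
  proof eventually_elim
    fix s assume s: "s \<in> {0<..<5 * L * min e (d / 5)}"
    define t where "t = s / (5 * L)"
    have "5 * L * min e (d / 5) \<le> 5 * L * e" "5 * L * min e (d / 5) \<le> 5 * L * (d / 5)"
      using L by (intro mult_left_mono; simp)+
    then have "s < 5 * L * e" "s < 5 * L * (d / 5)" "0 < s"
      using s by (auto dest: less_le_trans)
    then have t: "0 < t" "t < e" "5 * t < d" "s = 5 * L * t"
      using L by (auto simp: t_def pos_divide_less_eq mult.commute)
    obtain I where I: "I \<subseteq> C" "finite I" "C \<subseteq> (\<Union>c\<in>I. ball c t)"
      by (rule compactE_image[OF N(3), of C "\<lambda>c. ball c t"]) (use t(1) in auto)
    obtain J where J: "J \<subseteq> I" "pairwise (\<lambda>i j. disjnt (ball i t) (ball j t)) J" "C \<subseteq> (\<Union>c\<in>J. ball c (5 * t))"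
      by (rule Vitali_covering_lemma_balls[where S = C and K = I and a = "\<lambda>c. c" and r = "\<lambda>c. t" and B = t]) (use I(3) t(1) in auto)
    have J': "finite J" "J \<subseteq> C" using J I finite_subset by auto
    have "card J * t ^ 3 \<le> (\<Sum>c\<in>J. measure lebesgue (ball c t))"
    proof -
      have "t ^ 3 \<le> measure lebesgue (ball c t)" for c :: "real^3"
      proof -
        have "1 \<le> 4 / 3 * pi" using pi_gt3 by simp
        then have "1 * t ^ 3 \<le> (4 / 3 * pi) * t ^ 3" using t(1) by (intro mult_right_mono) auto
        then show ?thesis using t(1) by (simp add: sphere_volume)
      qed
      then have "(\<Sum>c\<in>J. t ^ 3) \<le> (\<Sum>c\<in>J. measure lebesgue (ball c t))" by (rule sum_mono)
      then show ?thesis by simp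
    qed
    also have "\<dots> = measure lebesgue (\<Union>c\<in>J. ball c t)"
      by (rule measure_UNION'[symmetric]) (use J' J(2) in auto)
    also have "\<dots> \<le> measure lebesgue T"
      by (rule measure_mono_fmeasurable[OF _ _ T_meas]) (use J' e(2) t(2) in \<open>force+\<close>)
    also note T_small
    finally have card: "card J * s ^ 3 < \<delta>"
      using L by (simp add: t(4) power_mult_distrib field_simps)
    show "small_cover (f ` C) s \<delta>"
      unfolding small_cover_def
    proof (intro exI conjI)
      show "finite (f ` J)" "f ` J \<subseteq> f ` C" using J' by auto
      show "f ` C \<subseteq> (\<Union>c\<in>f ` J. ball c s)"
      proof
        fix y assume "y \<in> f ` C"
        then obtain x where x: "x \<in> C" "y = f x" by blast
        then obtain c where c: "c \<in> J" "dist c x < 5 * t" using J(3) by auto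
        then have "dist (f c) (f x) \<le> L * dist c x" using lip[of c x] J'(2) t(3) by auto
        also have "\<dots> < s" using c L t(4) by simp
        finally show "y \<in> (\<Union>c\<in>f ` J. ball c s)" using c x by auto
      qed
      have "card (f ` J) * s ^ 3 \<le> card J * s ^ 3"
        using card_image_le[OF J'(1), of f] s by (intro mult_right_mono) auto
      then show "card (f ` J) * s ^ 3 < \<delta>" using card by linarith
    qed
  qed
qed

section \<open>Cutoff functions vanishing near a finite union of balls\<close>

definition cutoff :: "'a::euclidean_space set \<Rightarrow> real \<Rightarrow> 'a \<Rightarrow> real"
  where "cutoff A s x = (\<Prod>c\<in>A. 1 - bump c s x)"

lemma cutoff_bounds: "0 \<le> cutoff A s x" "cutoff A s x \<le> 1"
  using bump_bounds by (auto simp: cutoff_def intro!: prod_nonneg prod_le_1)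

lemma cutoff_zero: "finite A \<Longrightarrow> s > 0 \<Longrightarrow> c \<in> A \<Longrightarrow> x \<in> ball c s \<Longrightarrow> cutoff A s x = 0"
  unfolding cutoff_def by (rule prod_zero) (auto intro!: bexI[of _ c] simp: bump_one)

lemma cutoff_one: "s > 0 \<Longrightarrow> (\<And>c. c \<in> A \<Longrightarrow> x \<notin> ball c (2 * s)) \<Longrightarrow> cutoff A s x = 1"
  unfolding cutoff_def by (rule prod.neutral) (simp add: bump_zero)

lemma C1_on_one_minus:
  fixes f :: "'a::euclidean_space \<Rightarrow> real"
  shows "C1_on f S \<Longrightarrow> C1_on (\<lambda>x. 1 - f x) S"
  using C1_on_add[OF C1_on_const[of 1] C1_on_linear[OF bounded_linear_minus[OF bounded_linear_ident], of f S]] by simp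

lemma dderiv_one_minus:
  fixes f :: "'a::euclidean_space \<Rightarrow> real"
  assumes "f differentiable (at x)"
  shows "dderiv v (\<lambda>x. 1 - f x) x = - dderiv v f x"
proof -
  have "((\<lambda>x. 1 - f x) has_derivative (\<lambda>v. 0 - dderiv v f x)) (at x)"
    by (intro has_derivative_diff has_derivative_const) (use assms frechet_derivative_works in blast)
  from frechet_derivative_at[OF this, symmetric] show ?thesis by simp
qed

lemma C1_on_cutoff:
  fixes A :: "'a::euclidean_space set"
  assumes "finite A"
  shows "C1_on (cutoff A s) UNIV"
  using assms
proof induction
  case empty
  then show ?case by (simp add: cutoff_def[abs_def] C1_on_const)
next
  case (insert a A)
  have "cutoff (insert a A) s = (\<lambda>x. (1 - bump a s x) * cutoff A s x)"
    using insert by (simp add: cutoff_def fun_eq_iff)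
  then show ?case
    using C1_on_mult[OF C1_on_one_minus[OF C1_on_bump[of a s]] insert.IH] by simp
qed

lemma dderiv_cutoff_bound:
  fixes A :: "'a::euclidean_space set"
  assumes "finite A" and s: "s > 0"
  shows "\<bar>dderiv v (cutoff A s) x\<bar> \<le> (\<Sum>c\<in>A. indicator (ball c (2 * s)) x * (6 * norm v / s))"
  using assms(1)
proof induction
  case empty
  then show ?case by (simp add: cutoff_def[abs_def])
next
  case (insert a A)
  have eq: "cutoff (insert a A) s = (\<lambda>x. (1 - bump a s x) * cutoff A s x)"
    using insert by (simp add: cutoff_def fun_eq_iff)
  have diff: "bump a s differentiable (at x)" "cutoff A s differentiable (at x)"
    "(\<lambda>x. 1 - bump a s x) differentiable (at x)"
    using C1_on_differentiable[OF C1_on_bump[of a s UNIV]] C1_on_differentiable[OF C1_on_cutoff[OF insert(1)]]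
    by auto
  have "dderiv v (cutoff (insert a A) s) x
      = (1 - bump a s x) * dderiv v (cutoff A s) x - dderiv v (bump a s) x * cutoff A s x"
    unfolding eq dderiv_bilinear(2)[OF bounded_bilinear_mult diff(3,2)] dderiv_one_minus[OF diff(1)] by simp
  also have "\<bar>\<dots>\<bar> \<le> \<bar>(1 - bump a s x) * dderiv v (cutoff A s) x\<bar> + \<bar>dderiv v (bump a s) x * cutoff A s x\<bar>"
    by (rule abs_triangle_ineq4)
  also have "\<dots> \<le> 1 * \<bar>dderiv v (cutoff A s) x\<bar> + \<bar>dderiv v (bump a s) x\<bar> * 1"
    unfolding abs_mult using bump_bounds[of a s x] cutoff_bounds[of A s x]
    by (intro add_mono mult_right_mono mult_left_mono) auto
  also have "\<bar>dderiv v (bump a s) x\<bar> \<le> indicator (ball a (2 * s)) x * (6 * norm v / s)"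
    using dderiv_bump_bound[OF s, where v = v and c = a and x = x]
      dderiv_bump_zero[OF s, where v = v and c = a and x = x] by (auto simp: indicator_def)
  finally show ?case
    using insert by simp
qed

lemma one_minus_cutoff_bound:
  fixes A :: "'a::euclidean_space set"
  assumes "finite A" and s: "s > 0"
  shows "1 - cutoff A s x \<le> (\<Sum>c\<in>A. indicator (ball c (2 * s)) x)"
proof (cases "\<exists>c\<in>A. x \<in> ball c (2 * s)")
  case True
  then obtain c where c: "c \<in> A" "x \<in> ball c (2 * s)" by blast
  then have "indicator (ball c (2 * s)) x \<le> (\<Sum>c\<in>A. indicator (ball c (2 * s)) x :: real)"
    using assms(1) by (intro member_le_sum) auto
  then show ?thesis using c cutoff_bounds(1)[of A s x] by simp
next
  case False
  then show ?thesis using cutoff_one[OF s, of A x] by (simp add: sum_nonneg)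
qed

section \<open>Patching the local statements together\<close>

lemma dderiv_vec_add: "h differentiable (at x) \<Longrightarrow> dderiv (v + w) h x = dderiv v h x + dderiv w h x"
  by (rule linear_add[OF linear_frechet_derivative])

lemma dderiv_vec_scale: "h differentiable (at x) \<Longrightarrow> dderiv (r *\<^sub>R v) h x = r *\<^sub>R dderiv v h x"
  by (rule linear_cmul[OF linear_frechet_derivative])

context C1_boundary
begin

lemma dderiv_integrable:
  fixes h :: "real^4 \<Rightarrow> 'b::euclidean_space"
  assumes "C1_on h W"
  shows "dderiv v h absolutely_integrable_on U" "dderiv v h integrable_on U"
proof -
  have "set_integrable lborel U (dderiv v h)"
    by (rule set_integrable_compact[OF closure_compact])
      (use C1_on_continuous_dderiv[OF assms] U_W U_open closure_subset in \<open>auto intro: continuous_on_subset\<close>)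
  then show "dderiv v h absolutely_integrable_on U"
    by (rule set_integrable_imp_absolutely_integrable)
  then show "dderiv v h integrable_on U"
    using set_lebesgue_integral_eq_integral(1) by blast
qed

lemma patch_continuous:
  assumes "i < m"
  shows "continuous_on (D i) (\<phi> i)" "continuous_on (D i) (jac i v)"
proof -
  obtain N where N: "D i \<subseteq> N" "C1_on (\<phi> i) N" using patch_C1[OF assms] by blast
  show "continuous_on (D i) (\<phi> i)"
    by (rule continuous_on_subset[OF C1_on_continuous[OF N(2)] N(1)])
  show "continuous_on (D i) (jac i v)"
    by (rule continuous_on_subset[OF jac_continuous[OF N(2)] N(1)])
qed

lemma flux_integrand_continuous:
  fixes h :: "real^4 \<Rightarrow> 'b::euclidean_space"
  assumes h: "continuous_on W h" and i: "i < m"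
  shows "continuous_on (D i) (\<lambda>u. jac i v u *\<^sub>R h (\<phi> i u))"
proof (intro continuous_on_scaleR patch_continuous i)
  show "continuous_on (D i) (\<lambda>u. h (\<phi> i u))"
    by (rule continuous_on_compose2[OF h patch_continuous(1)[OF i]])
      (use patch_frontier[OF i] frontier_W in auto)
qed

lemma integrable_on_compact:
  fixes f :: "'c::euclidean_space \<Rightarrow> 'b::euclidean_space"
  assumes "compact K" "continuous_on K f"
  shows "f integrable_on K"
proof (rule set_borel_integral_eq_integral(1))
  show "set_integrable lborel K f"
    by (rule set_integrable_compact[OF assms]) (use assms(1) in \<open>auto intro: borel_compact\<close>)
qed

lemma flux_integrable:
  fixes h :: "real^4 \<Rightarrow> 'b::euclidean_space"
  assumes "continuous_on W h" "i < m"
  shows "(\<lambda>u. jac i v u *\<^sub>R h (\<phi> i u)) integrable_on D i"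
  by (rule integrable_on_compact[OF D_compact flux_integrand_continuous]) (use assms in auto)

lemma flux_vec_add:
  fixes h :: "real^4 \<Rightarrow> 'b::euclidean_space"
  assumes "continuous_on W h"
  shows "flux (v + w) h = flux v h + flux w h"
  unfolding flux_def sum.distrib[symmetric]
  by (intro sum.cong refl)
    (simp add: jac_add scaleR_add_left Henstock_Kurzweil_Integration.integral_add flux_integrable assms)

lemma flux_vec_scale: "flux (r *\<^sub>R v) h = r *\<^sub>R flux v h"
  by (simp add: flux_def jac_scale scaleR_sum_right flip: scaleR_scaleR)

lemma flux_add:
  fixes h :: "real^4 \<Rightarrow> 'b::euclidean_space"
  assumes "continuous_on W h" "continuous_on W k"
  shows "flux v (\<lambda>x. h x + k x) = flux v h + flux v k"
  unfolding flux_def sum.distrib[symmetric]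
  by (intro sum.cong refl)
    (simp add: scaleR_add_right Henstock_Kurzweil_Integration.integral_add flux_integrable assms)

lemma U_sub_W: "U \<subseteq> W"
  using U_W closure_subset by blast

lemma stokes_vec_add:
  fixes h :: "real^4 \<Rightarrow> 'b::euclidean_space"
  assumes h: "C1_on h W" and "stokes v h" "stokes w h"
  shows "stokes (v + w) h"
proof -
  have "integral U (dderiv (v + w) h) = integral U (\<lambda>x. dderiv v h x + dderiv w h x)"
    by (rule integral_cong) (use C1_on_differentiable[OF h] U_sub_W in \<open>simp add: dderiv_vec_add subset_iff\<close>)
  also have "\<dots> = integral U (dderiv v h) + integral U (dderiv w h)"
    by (rule Henstock_Kurzweil_Integration.integral_add) (rule dderiv_integrable[OF h])+
  finally show ?thesis
    using assms by (simp add: stokes_def flux_vec_add C1_on_continuous)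
qed

lemma stokes_vec_scale:
  fixes h :: "real^4 \<Rightarrow> 'b::euclidean_space"
  assumes h: "C1_on h W" and "stokes v h"
  shows "stokes (r *\<^sub>R v) h"
proof -
  have "integral U (dderiv (r *\<^sub>R v) h) = integral U (\<lambda>x. r *\<^sub>R dderiv v h x)"
    by (rule integral_cong) (use C1_on_differentiable[OF h] U_sub_W in \<open>simp add: dderiv_vec_scale subset_iff\<close>)
  then show ?thesis
    using assms(2) by (simp add: stokes_def flux_vec_scale)
qed

lemma stokes_add:
  fixes h :: "real^4 \<Rightarrow> 'b::euclidean_space"
  assumes h: "C1_on h W" and k: "C1_on k W" and "stokes v h" "stokes v k"
  shows "stokes v (\<lambda>x. h x + k x)"
proof -
  have "integral U (dderiv v (\<lambda>x. h x + k x)) = integral U (\<lambda>x. dderiv v h x + dderiv v k x)"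
    by (rule integral_cong)
      (use C1_on_differentiable[OF h] C1_on_differentiable[OF k] U_sub_W in \<open>simp add: dderiv_add subset_iff\<close>)
  also have "\<dots> = integral U (dderiv v h) + integral U (dderiv v k)"
    by (rule Henstock_Kurzweil_Integration.integral_add) (rule dderiv_integrable[OF h] dderiv_integrable[OF k])+
  finally show ?thesis
    using assms by (simp add: stokes_def flux_add C1_on_continuous)
qed

lemma flux_zero: "(\<And>x. x \<in> frontier U \<Longrightarrow> h x = 0) \<Longrightarrow> flux v h = 0"
proof -
  assume h: "\<And>x. x \<in> frontier U \<Longrightarrow> h x = 0"
  have "integral (D i) (\<lambda>u. jac i v u *\<^sub>R h (\<phi> i u)) = integral (D i) (\<lambda>u. 0)" if "i < m" for i
    by (rule integral_cong) (use h patch_frontier[OF that] in simp)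
  then show ?thesis by (simp add: flux_def)
qed

lemma stokes_zero:
  fixes h :: "real^4 \<Rightarrow> 'b::euclidean_space"
  assumes "\<And>x. x \<in> closure U \<Longrightarrow> h x = 0"
  shows "stokes v h"
proof -
  have "dderiv v h x = 0" if "x \<in> U" for x
  proof -
    have "dderiv v h x = dderiv v (\<lambda>x. 0) x"
      by (rule dderiv_cong[OF U_open that]) (use assms closure_subset in blast)
    then show ?thesis by simp
  qed
  then have "integral U (dderiv v h) = integral U (\<lambda>x. 0)"
    by (intro integral_cong) auto
  moreover have "flux v h = 0"
    by (rule flux_zero) (use assms in \<open>simp add: frontier_def\<close>)
  ultimately show ?thesis by (simp add: stokes_def)
qed

text \<open>A ball such that every field supported in it satisfies the divergence theorem; the
  local statements all have this form, and it is inherited by smaller radii.\<close>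

definition stokes_ball :: "real^4 \<Rightarrow> real^4 \<Rightarrow> real \<Rightarrow> bool"
  where "stokes_ball v c \<rho> \<longleftrightarrow> \<rho> > 0 \<and>
    (\<forall>h :: real^4 \<Rightarrow> real. C1_on h W \<longrightarrow> (\<forall>x\<in>W. x \<notin> ball c \<rho> \<longrightarrow> h x = 0) \<longrightarrow> stokes v h)"

lemma stokes_ball_shrink: "stokes_ball v c \<rho> \<Longrightarrow> 0 < \<rho>' \<Longrightarrow> \<rho>' \<le> \<rho> \<Longrightarrow> stokes_ball v c \<rho>'"
proof -
  assume *: "stokes_ball v c \<rho>" "0 < \<rho>'" "\<rho>' \<le> \<rho>"
  show ?thesis
    unfolding stokes_ball_def
  proof (intro conjI allI impI *(2))
    fix h :: "real^4 \<Rightarrow> real" assume h: "C1_on h W" "\<forall>x\<in>W. x \<notin> ball c \<rho>' \<longrightarrow> h x = 0"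
    have "\<forall>x\<in>W. x \<notin> ball c \<rho> \<longrightarrow> h x = 0" using h(2) *(3) by auto
    then show "stokes v h" using *(1) h(1) unfolding stokes_ball_def by blast
  qed
qed

lemma stokes_ball_add:
  assumes "stokes_ball v c \<rho>" "stokes_ball w c \<rho>'"
  obtains \<rho>'' where "stokes_ball (v + w) c \<rho>''"
proof -
  have "stokes_ball v c (min \<rho> \<rho>')" "stokes_ball w c (min \<rho> \<rho>')"
    by (rule stokes_ball_shrink[OF assms(1)] stokes_ball_shrink[OF assms(2)];
        use assms in \<open>simp add: stokes_ball_def\<close>)+
  then have "stokes_ball (v + w) c (min \<rho> \<rho>')"
    unfolding stokes_ball_def by (simp add: stokes_vec_add)
  then show ?thesis by (rule that)
qed

text \<open>The tangent space has dimension at most \<open>3\<close>, so some vector lies outside it.\<close>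

lemma patch_transversal:
  assumes i: "i < m" and u: "u \<in> interior (D i)"
  obtains v where "jac i v u > 0"
proof -
  obtain N where N: "D i \<subseteq> N" "C1_on (\<phi> i) N" using patch_C1[OF i] by blast
  have uN: "u \<in> N" using u N(1) interior_subset by blast
  have diff: "\<phi> i differentiable (at u)" by (rule C1_on_differentiable[OF N(2) uN])
  let ?L = "frechet_derivative (\<phi> i) (at u)"
  have lin: "linear ?L" by (rule linear_frechet_derivative[OF diff])
  have "dim (range ?L) \<le> dim (UNIV :: (real^3) set)" by (rule dim_image_le[OF lin])
  then have "range ?L \<noteq> UNIV" by auto
  then obtain v where v: "v \<notin> range ?L" by blast
  let ?M = "\<lambda>w. ?L (tail w) + w$0 *\<^sub>R v"
  have linM: "linear ?M"
    using lin bounded_linear.linear[OF bounded_linear_tail]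
    by (auto intro!: linearI simp: linear_add linear_cmul algebra_simps)
  have "w = 0" if "?M w = 0" for w
  proof -
    have "w$0 = 0"
    proof (rule ccontr)
      assume w0: "w$0 \<noteq> 0"
      have "w$0 *\<^sub>R v = ?L (- tail w)"
        using that by (simp add: linear_neg[OF lin] eq_neg_iff_add_eq_0 add.commute)
      then have "v = ?L ((1 / w$0) *\<^sub>R (- tail w))"
        using w0 by (subst linear_cmul[OF lin]) (simp flip: \<open>w$0 *\<^sub>R v = _\<close>)
      then show False using v by blast
    qed
    then have "?L (tail w) = ?L 0" using that by (simp add: linear_0[OF lin])
    then have "tail w = 0" using patch_immersion[OF i u] by (simp add: inj_eq)
    moreover have "join 0 0 = 0" by (simp add: join_def vec_eq_iff)
    ultimately show "w = 0" using \<open>w$0 = 0\<close> join_tail[of w] by simp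
  qed
  then have "inj ?M" using linear_injective_0[OF linM] by blast
  then have "det (matrix ?M) \<noteq> 0" using det_nz_iff_inj[OF linM] by blast
  moreover have "det (matrix ?M) = jac i v u"
    using lin by (subst det_matrix_graph) (auto simp: jac_def rpartial_eq_dderiv[OF diff] linear_conv_bounded_linear)
  ultimately consider "jac i v u > 0" | "jac i (- v) u > 0"
    using jac_scale[of i "-1" v u] by fastforce
  then show ?thesis using that by cases
qed

text \<open>Both \<open>n\<close> and \<open>v + k n\<close> are outward for large \<open>k\<close>, and \<open>v\<close> is a combination of them.\<close>

lemma stokes_ball_patch:
  assumes i: "i < m" and u: "u \<in> interior (D i)"
  obtains \<rho> where "stokes_ball v (\<phi> i u) \<rho>"
proof -
  obtain n where n: "jac i n u > 0" using patch_transversal[OF assms] .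
  have tr: "\<exists>\<rho>. stokes_ball w (\<phi> i u) \<rho>" if w: "jac i w u > 0" for w
  proof -
    obtain \<rho> where "\<rho> > 0"
      "\<And>h :: real^4 \<Rightarrow> real. C1_on h W \<Longrightarrow> (\<And>x. x \<in> W \<Longrightarrow> x \<notin> ball (\<phi> i u) \<rho> \<Longrightarrow> h x = 0) \<Longrightarrow> stokes w h"
      using stokes_near_patch_transversal[OF i u w] by blast
    then have "stokes_ball w (\<phi> i u) \<rho>"
      unfolding stokes_ball_def by blast
    then show ?thesis by blast
  qed
  define k where "k = 1 + \<bar>jac i v u\<bar> / jac i n u"
  have "jac i (v + k *\<^sub>R n) u = jac i v u + jac i n u + \<bar>jac i v u\<bar>"
    using n by (simp add: jac_add jac_scale k_def field_simps)
  then obtain \<rho>1 where 1: "stokes_ball (v + k *\<^sub>R n) (\<phi> i u) \<rho>1" using tr[of "v + k *\<^sub>R n"] n by force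
  obtain \<rho>2 where "stokes_ball n (\<phi> i u) \<rho>2" using tr[OF n] by blast
  then have 2: "stokes_ball ((- k) *\<^sub>R n) (\<phi> i u) \<rho>2"
    unfolding stokes_ball_def using stokes_vec_scale by blast
  obtain \<rho> where "stokes_ball ((v + k *\<^sub>R n) + (- k) *\<^sub>R n) (\<phi> i u) \<rho>"
    using stokes_ball_add[OF 1 2] .
  then show ?thesis using that by simp
qed

text \<open>A field supported in a ball inside \<open>U\<close> extends by zero to the whole space and vanishes
  on the boundary, so both sides are zero.\<close>

lemma stokes_ball_interior:
  assumes "c \<in> U"
  obtains \<rho> where "stokes_ball v c \<rho>"
proof -
  obtain \<rho> where \<rho>: "\<rho> > 0" "cball c \<rho> \<subseteq> U" using U_open assms open_contains_cball by blast
  have "stokes v h" if h: "C1_on h W" and h0: "\<And>x. x \<in> W \<Longrightarrow> x \<notin> ball c \<rho> \<Longrightarrow> h x = 0" for h :: "real^4 \<Rightarrow> real"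
  proof -
    define k where "k x = (if x \<in> W then h x else 0)" for x
    have kW: "C1_on k W"
      by (rule C1_on_cong[OF h W_open]) (simp add: k_def)
    have k0: "k x = 0" if "x \<notin> ball c \<rho>" for x using that h0 by (simp add: k_def)
    have "C1_on k (- cball c \<rho>)"
      by (rule C1_on_cong[OF C1_on_const[of 0]]) (use k0 in auto)
    then have "C1_on k (W \<union> - cball c \<rho>)"
      by (rule C1_on_union[OF kW _ W_open]) auto
    moreover have "W \<union> - cball c \<rho> = UNIV" using \<rho>(2) U_sub_W by blast
    ultimately have kU: "C1_on k UNIV" by simp
    have dk0: "dderiv v k x = 0" if "x \<notin> cball c \<rho>" for x
    proof -
      have "dderiv v k x = dderiv v (\<lambda>x. 0) x"
        by (rule dderiv_cong[of "- cball c \<rho>"]) (use that k0 in auto)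
      then show ?thesis by simp
    qed
    have "integral U (dderiv v h) = integral U (dderiv v k)"
      by (rule integral_cong) (rule dderiv_cong[OF W_open], use U_sub_W in \<open>auto simp: k_def\<close>)
    also have "\<dots> = integral UNIV (dderiv v k)"
    proof (rule integral_eq_on_superset)
      fix x assume "x \<notin> U"
      then have "x \<notin> cball c \<rho>" using \<rho>(2) by blast
      then show "dderiv v k x = 0" by (rule dk0)
    qed simp
    also have "\<dots> = 0"
    proof (rule integral_dderiv_compact_support[OF kU])
      show "k x = 0" if "norm x > norm c + \<rho>" for x
      proof (rule k0)
        have "norm x \<le> norm c + dist c x"
          using norm_triangle_ineq2[of x c] by (simp add: dist_norm norm_minus_commute)
        then show "x \<notin> ball c \<rho>" using that by simp
      qed
    qed
    also have "0 = flux v h"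
    proof (rule flux_zero[symmetric])
      fix x assume x: "x \<in> frontier U"
      then have "x \<notin> ball c \<rho>" using frontier_not_U[OF x] \<rho>(2) ball_subset_cball by blast
      then show "h x = 0" using h0 x frontier_W by blast
    qed
    finally show ?thesis unfolding stokes_def .
  qed
  then have "stokes_ball v c \<rho>" using \<rho>(1) unfolding stokes_ball_def by blast
  then show ?thesis by (rule that)
qed

text \<open>Write \<open>h = \<beta> h + (1 - \<beta>) h\<close> with the bump \<open>\<beta>\<close> of one of the balls: the first summand is
  supported in the doubled ball, and the second vanishes on one ball more. This replaces a
  partition of unity.\<close>

lemma stokes_finite_cover:
  fixes h :: "real^4 \<Rightarrow> real"
  assumes "finite I" "\<And>c. c \<in> I \<Longrightarrow> stokes_ball v c (2 * R c)" "C1_on h W"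
    "\<And>x. x \<in> closure U \<Longrightarrow> x \<notin> (\<Union>c\<in>I. ball c (R c)) \<Longrightarrow> h x = 0"
  shows "stokes v h"
  using assms
proof (induction I arbitrary: h rule: finite_induct)
  case empty
  then show ?case by (intro stokes_zero) auto
next
  case (insert a I)
  let ?b = "bump a (R a)"
  have R: "R a > 0" using insert.prems(1)[of a] by (simp add: stokes_ball_def)
  have 1: "C1_on (\<lambda>x. ?b x * h x) W" "C1_on (\<lambda>x. (1 - ?b x) * h x) W"
    by (intro C1_on_mult C1_on_one_minus C1_on_bump insert.prems(2))+
  have "stokes v (\<lambda>x. ?b x * h x)"
  proof -
    have "\<forall>x\<in>W. x \<notin> ball a (2 * R a) \<longrightarrow> ?b x * h x = 0"
      by (simp add: bump_zero[OF R] del: mem_ball)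
    then show ?thesis
      using insert.prems(1)[of a] 1(1) unfolding stokes_ball_def by blast
  qed
  moreover have "stokes v (\<lambda>x. (1 - ?b x) * h x)"
  proof (rule insert.IH[OF _ 1(2)])
    show "stokes_ball v c (2 * R c)" if "c \<in> I" for c using insert.prems(1) that by blast
    fix x assume x: "x \<in> closure U" "x \<notin> (\<Union>c\<in>I. ball c (R c))"
    show "(1 - ?b x) * h x = 0"
    proof (cases "x \<in> ball a (R a)")
      case True
      then show ?thesis using bump_one[OF R, of x a] by simp
    next
      case False
      then show ?thesis using insert.prems(3)[OF x(1)] x(2) by simp
    qed
  qed
  ultimately have "stokes v (\<lambda>x. ?b x * h x + (1 - ?b x) * h x)"
    by (rule stokes_add[OF 1])
  also have "(\<lambda>x. ?b x * h x + (1 - ?b x) * h x) = h"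
    by (auto simp: algebra_simps)
  finally show ?case .
qed

text \<open>The part of the boundary where no tangent plane need exist; only its size is under
  control.\<close>

definition edges :: "(real^4) set"
  where "edges = (\<Union>i<m. \<phi> i ` frontier (D i))"

lemma frontier_D_subset: "i < m \<Longrightarrow> frontier (D i) \<subseteq> D i"
  using D_compact[of i] by (simp add: compact_imp_closed frontier_subset_closed)

lemma edges_compact: "compact edges"
  unfolding edges_def
proof (intro compact_UN ballI)
  fix i assume "i \<in> {..<m}"
  then have i: "i < m" by simp
  show "compact (\<phi> i ` frontier (D i))"
    using compact_frontier[OF D_compact[OF i]] continuous_on_subset[OF patch_continuous(1)[OF i] frontier_D_subset[OF i]]
    by (rule compact_continuous_image[rotated])
qed simp

lemma interior_not_edge:
  assumes "i < m" "u \<in> interior (D i)"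
  shows "\<phi> i u \<notin> edges"
proof
  assume "\<phi> i u \<in> edges"
  then obtain j w where jw: "j < m" "w \<in> frontier (D j)" "\<phi> i u = \<phi> j w"
    by (auto simp: edges_def)
  then have "i = j" "u = w"
    using patch_inj[OF assms jw(1) _ jw(3)] frontier_D_subset by auto
  then show False using jw(2) assms(2) by (simp add: frontier_def)
qed

lemma stokes_off_edges:
  fixes h :: "real^4 \<Rightarrow> real"
  assumes h: "C1_on h W" and G: "open G" "edges \<subseteq> G" and h0: "\<And>x. x \<in> closure U \<Longrightarrow> x \<in> G \<Longrightarrow> h x = 0"
  shows "stokes v h"
proof -
  have "\<exists>\<rho>. stokes_ball v c (2 * \<rho>)" if c: "c \<in> closure U - G" for c
  proof -
    have "\<exists>\<rho>. stokes_ball v c \<rho>"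
    proof (cases "c \<in> U")
      case True
      then show ?thesis using stokes_ball_interior[of c v] by blast
    next
      case False
      then have "c \<in> frontier U" using c U_open by (simp add: frontier_def interior_open)
      then obtain i u where iu: "i < m" "u \<in> D i" "c = \<phi> i u" using frontier_U by auto
      have "u \<notin> frontier (D i)" using c G(2) iu by (auto simp: edges_def)
      then have "u \<in> interior (D i)" using iu(2) closure_subset[of "D i"] by (auto simp: frontier_def)
      then show ?thesis using stokes_ball_patch[OF iu(1), of u v] iu(3) by blast
    qed
    then obtain \<rho> where "stokes_ball v c \<rho>" by blast
    then show ?thesis by (intro exI[of _ "\<rho> / 2"]) simp
  qed
  then obtain R where R: "\<And>c. c \<in> closure U - G \<Longrightarrow> stokes_ball v c (2 * R c)" by metis
  have "compact (closure U - G)" by (rule compact_diff[OF closure_compact G(1)])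
  then obtain I where I: "I \<subseteq> closure U - G" "finite I" "closure U - G \<subseteq> (\<Union>c\<in>I. ball c (R c))"
  proof (rule compactE_image[where C = "closure U - G" and f = "\<lambda>c. ball c (R c)"])
    show "closure U - G \<subseteq> (\<Union>c\<in>closure U - G. ball c (R c))"
      using R by (force simp: stokes_ball_def)
  qed auto
  show ?thesis
    by (rule stokes_finite_cover[OF I(2) R h]) (use I h0 in blast)+
qed

end

context C1_boundary
begin

section \<open>The divergence theorem\<close>

lemma edges_cover:
  assumes \<delta>: "\<delta> > 0"
  shows "\<forall>\<^sub>F s in at_right (0::real). small_cover edges s \<delta>"
proof -
  have "\<forall>\<^sub>F s in at_right (0::real). small_cover (\<phi> i ` frontier (D i)) s (\<delta> / (m + 1))" if i: "i < m" for i
  proof -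
    obtain N where N: "open N" "D i \<subseteq> N" "C1_on (\<phi> i) N" using patch_C1[OF i] .
    show ?thesis
      by (rule cover_image_of_null_set[OF N(1) _ compact_frontier[OF D_compact[OF i]] N(3) D_negligible[OF i]])
        (use \<delta> N(2) frontier_D_subset[OF i] in auto)
  qed
  then have "\<forall>\<^sub>F s in at_right (0::real). \<forall>i\<in>{..<m}. small_cover (\<phi> i ` frontier (D i)) s (\<delta> / (m + 1))"
    by (intro eventually_ball_finite) auto
  moreover have "\<forall>\<^sub>F s in at_right (0::real). 0 < s"
    by (simp add: eventually_at_filter)
  ultimately show ?thesis
  proof eventually_elim
    fix s :: real assume s: "0 < s" and "\<forall>i\<in>{..<m}. small_cover (\<phi> i ` frontier (D i)) s (\<delta> / (m + 1))"
    then obtain A where A: "\<And>i. i < m \<Longrightarrow> finite (A i)" "\<And>i. i < m \<Longrightarrow> A i \<subseteq> \<phi> i ` frontier (D i)"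
      "\<And>i. i < m \<Longrightarrow> \<phi> i ` frontier (D i) \<subseteq> (\<Union>c\<in>A i. ball c s)"
      "\<And>i. i < m \<Longrightarrow> card (A i) * s ^ 3 < \<delta> / (m + 1)"
      unfolding small_cover_def by (metis lessThan_iff)
    show "small_cover edges s \<delta>"
      unfolding small_cover_def
    proof (intro exI conjI)
      let ?A = "\<Union>i<m. A i"
      show "finite ?A" using A(1) by auto
      show "?A \<subseteq> edges" using A(2) by (fastforce simp: edges_def)
      show "edges \<subseteq> (\<Union>c\<in>?A. ball c s)" unfolding edges_def using A(3) by fastforce
      have "card ?A \<le> (\<Sum>i<m. card (A i))" by (rule card_UN_le) simp
      then have "real (card ?A) \<le> real (\<Sum>i<m. card (A i))" by (rule of_nat_mono)
      then have "card ?A * s ^ 3 \<le> (\<Sum>i<m. real (card (A i))) * s ^ 3"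
        using s by (intro mult_right_mono) auto
      also have "\<dots> = (\<Sum>i<m. card (A i) * s ^ 3)" by (simp add: sum_distrib_right)
      also have "\<dots> \<le> (\<Sum>i<m. \<delta> / (m + 1))" using A(4) by (intro sum_mono) (auto intro: less_imp_le)
      also have "\<dots> < \<delta>" using \<delta> by (simp add: field_simps)
      finally show "card ?A * s ^ 3 < \<delta>" .
    qed
  qed
qed

lemma bounded_on_closure:
  fixes f :: "real^4 \<Rightarrow> 'b::real_normed_vector"
  assumes "continuous_on W f"
  obtains B where "B > 0" "\<And>x. x \<in> closure U \<Longrightarrow> norm (f x) \<le> B"
proof -
  have "compact (f ` closure U)"
    by (rule compact_continuous_image[OF continuous_on_subset[OF assms U_W] closure_compact])
  then have "bounded (f ` closure U)" by (rule compact_imp_bounded)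
  then show ?thesis using that unfolding bounded_pos by auto
qed

text \<open>On \<open>U\<close> the two integrands differ only in the balls of radius \<open>2 s\<close>, by
  \<open>O(1 / s)\<close>; each ball has volume \<open>O(s ^ 4)\<close>.\<close>

lemma cutoff_error:
  fixes h :: "real^4 \<Rightarrow> real"
  assumes h: "C1_on h W"
  obtains K where "\<And>A (s::real). finite A \<Longrightarrow> 0 < s \<Longrightarrow> s < 1 \<Longrightarrow>
    \<bar>integral U (dderiv v (\<lambda>x. cutoff A s x * h x)) - integral U (dderiv v h)\<bar> \<le> K * (card A * s ^ 3)"
proof -
  obtain M where M: "M > 0" "\<And>x. x \<in> closure U \<Longrightarrow> norm (h x) \<le> M"
    using bounded_on_closure[OF C1_on_continuous[OF h]] by blast
  obtain M' where M': "M' > 0" "\<And>x. x \<in> closure U \<Longrightarrow> norm (dderiv v h x) \<le> M'"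
    using bounded_on_closure[OF C1_on_continuous_dderiv[OF h, of v]] by blast
  define \<kappa> where "\<kappa> = unit_ball_vol 4"
  have \<kappa>: "\<kappa> \<ge> 0" by (simp add: \<kappa>_def)
  show ?thesis
  proof (rule that[of "16 * \<kappa> * (M' + M * (6 * norm v))"])
    fix A :: "(real^4) set" and s :: real
    assume A: "finite A" and s: "0 < s" "s < 1"
    let ?\<eta> = "cutoff A s"
    have \<eta>C: "C1_on ?\<eta> S" for S using C1_on_subset[OF C1_on_cutoff[OF A]] by blast
    have dp: "dderiv v (\<lambda>x. ?\<eta> x * h x) x = ?\<eta> x * dderiv v h x + dderiv v ?\<eta> x * h x" if "x \<in> U" for x
      by (rule dderiv_bilinear(2)[OF bounded_bilinear_mult])
        (use that U_sub_W in \<open>auto intro: C1_on_differentiable[OF \<eta>C] C1_on_differentiable[OF h]\<close>)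
    have int1: "dderiv v (\<lambda>x. ?\<eta> x * h x) integrable_on U"
      by (rule dderiv_integrable(2)[OF C1_on_mult[OF \<eta>C h]])
    define C where "C = M' + M * (6 * norm v / s)"
    have C: "C \<ge> 0" using M M' s by (simp add: C_def)
    have ball_int: "(indicator (ball c (2 * s)) :: real^4 \<Rightarrow> real) integrable_on U"
      "integral U (indicator (ball c (2 * s))) \<le> 16 * \<kappa> * s ^ 4" for c :: "real^4"
      using integral_indicator_le_measure[OF bounded_ball open_ball U_open, of c "2 * s"] s
      by (simp_all add: content_ball \<kappa>_def power_mult_distrib mult_ac)
    have "\<bar>integral U (dderiv v (\<lambda>x. ?\<eta> x * h x)) - integral U (dderiv v h)\<bar>
        = \<bar>integral U (\<lambda>x. dderiv v (\<lambda>x. ?\<eta> x * h x) x - dderiv v h x)\<bar>"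
      by (simp add: Henstock_Kurzweil_Integration.integral_diff int1 dderiv_integrable[OF h])
    also have "\<dots> \<le> integral U (\<lambda>x. C * (\<Sum>c\<in>A. indicator (ball c (2 * s)) x))"
      unfolding real_norm_def[symmetric]
    proof (rule Henstock_Kurzweil_Integration.integral_norm_bound_integral)
      show "(\<lambda>x. dderiv v (\<lambda>x. ?\<eta> x * h x) x - dderiv v h x) integrable_on U"
        by (intro integrable_diff int1 dderiv_integrable[OF h])
      show "(\<lambda>x. C * (\<Sum>c\<in>A. indicator (ball c (2 * s)) x)) integrable_on U"
        by (intro integrable_on_mult_right integrable_sum A ball_int)
      fix x assume x: "x \<in> U"
      then have xc: "x \<in> closure U" using closure_subset by blast
      let ?S = "\<Sum>c\<in>A. indicator (ball c (2 * s)) x :: real"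
      have S: "0 \<le> ?S" by (rule sum_nonneg) simp
      have "dderiv v (\<lambda>x. ?\<eta> x * h x) x - dderiv v h x = dderiv v ?\<eta> x * h x - (1 - ?\<eta> x) * dderiv v h x"
        unfolding dp[OF x] by (simp add: algebra_simps)
      also have "norm \<dots> \<le> norm (dderiv v ?\<eta> x) * norm (h x) + norm (1 - ?\<eta> x) * norm (dderiv v h x)"
        unfolding norm_mult[symmetric] by (rule norm_triangle_ineq4)
      also have "\<dots> \<le> (?S * (6 * norm v / s)) * M + ?S * M'"
      proof (intro add_mono mult_mono)
        show "norm (dderiv v ?\<eta> x) \<le> ?S * (6 * norm v / s)"
          using dderiv_cutoff_bound[OF A s(1), where v = v and x = x]
          unfolding sum_distrib_right real_norm_def .
        show "norm (1 - ?\<eta> x) \<le> ?S"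
          using one_minus_cutoff_bound[OF A s(1), of x] cutoff_bounds(2)[of A s x] by simp
      qed (use M(2)[OF xc] M'(2)[OF xc] S s in auto)
      also have "\<dots> = C * ?S" by (simp add: C_def algebra_simps)
      finally show "norm (dderiv v (\<lambda>x. ?\<eta> x * h x) x - dderiv v h x) \<le> C * ?S" .
    qed
    also have "\<dots> = C * (\<Sum>c\<in>A. integral U (indicator (ball c (2 * s))))"
      by (simp add: Henstock_Kurzweil_Integration.integral_sum A ball_int)
    also have "\<dots> \<le> C * (\<Sum>c\<in>A. 16 * \<kappa> * s ^ 4)"
      using C ball_int by (intro mult_left_mono sum_mono) auto
    also have "\<dots> = (s * C) * (16 * \<kappa> * (card A * s ^ 3))"
      by (simp add: eval_nat_numeral)
    also have "\<dots> \<le> (M' + M * (6 * norm v)) * (16 * \<kappa> * (card A * s ^ 3))"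
    proof (rule mult_right_mono)
      have "s * C = s * M' + M * (6 * norm v)" using s by (simp add: C_def field_simps)
      also have "\<dots> \<le> 1 * M' + M * (6 * norm v)"
        using s M'(1) by (intro add_right_mono mult_right_mono) auto
      finally show "s * C \<le> M' + M * (6 * norm v)" by simp
    qed (use s \<kappa> in simp)
    finally show "\<bar>integral U (dderiv v (\<lambda>x. ?\<eta> x * h x)) - integral U (dderiv v h)\<bar>
        \<le> 16 * \<kappa> * (M' + M * (6 * norm v)) * (card A * s ^ 3)"
      by (simp add: mult_ac)
  qed
qed

text \<open>The cutoffs tend to \<open>1\<close> at every point off the edges, that is at every interior
  parameter, and the remaining parameters form a null set.\<close>

lemma flux_cutoff_limit:
  fixes h :: "real^4 \<Rightarrow> real"
  assumes h: "C1_on h W" and A: "\<And>n. finite (A n)" "\<And>n. A n \<subseteq> edges" and s: "\<And>n. 0 < s n" "s \<longlonglongrightarrow> (0::real)"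
  shows "(\<lambda>n. flux v (\<lambda>x. cutoff (A n) (s n) x * h x)) \<longlonglongrightarrow> flux v h"
  unfolding flux_def
proof (rule tendsto_sum)
  fix i assume "i \<in> {..<m}"
  then have i: "i < m" by simp
  have \<eta>h: "continuous_on W (\<lambda>x. cutoff (A n) (s n) x * h x)" for n
    by (intro C1_on_continuous C1_on_mult h C1_on_subset[OF C1_on_cutoff[OF A(1)]]) auto
  have spike: "integral (interior (D i)) f = integral (D i) f" for f :: "real^3 \<Rightarrow> real"
    by (rule integral_spike_set)
      (rule negligible_subset[OF D_negligible[OF i]],
        use interior_subset[of "D i"] closure_subset[of "D i"] in \<open>auto simp: frontier_def\<close>)+
  have sub: "f integrable_on interior (D i)" if "f integrable_on D i" for f :: "real^3 \<Rightarrow> real"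
    by (rule integrable_spike_set[OF that])
      (rule negligible_subset[OF D_negligible[OF i]],
        use interior_subset[of "D i"] closure_subset[of "D i"] in \<open>auto simp: frontier_def\<close>)+
  have "(\<lambda>n. integral (interior (D i)) (\<lambda>u. jac i v u *\<^sub>R (cutoff (A n) (s n) (\<phi> i u) * h (\<phi> i u))))
      \<longlonglongrightarrow> integral (interior (D i)) (\<lambda>u. jac i v u *\<^sub>R h (\<phi> i u))"
  proof (rule dominated_convergence(2))
    show "(\<lambda>u. jac i v u *\<^sub>R (cutoff (A n) (s n) (\<phi> i u) * h (\<phi> i u))) integrable_on interior (D i)" for n
      by (rule sub[OF flux_integrable[OF \<eta>h i]])
    have "continuous_on (D i) (\<lambda>u. norm (jac i v u *\<^sub>R h (\<phi> i u)))"
      by (intro continuous_on_norm flux_integrand_continuous C1_on_continuous[OF h] i)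
    then show "(\<lambda>u. norm (jac i v u *\<^sub>R h (\<phi> i u))) integrable_on interior (D i)"
      by (intro sub integrable_on_compact D_compact[OF i])
    show "norm (jac i v u *\<^sub>R (cutoff (A n) (s n) (\<phi> i u) * h (\<phi> i u))) \<le> norm (jac i v u *\<^sub>R h (\<phi> i u))" for n u
    proof -
      have "norm (cutoff (A n) (s n) (\<phi> i u)) * (\<bar>jac i v u\<bar> * \<bar>h (\<phi> i u)\<bar>) \<le> 1 * (\<bar>jac i v u\<bar> * \<bar>h (\<phi> i u)\<bar>)"
        by (rule mult_right_mono) (use cutoff_bounds[of "A n" "s n" "\<phi> i u"] in auto)
      then show ?thesis by (simp add: abs_mult mult_ac)
    qed
    fix u assume u: "u \<in> interior (D i)"
    have "\<phi> i u \<notin> edges" by (rule interior_not_edge[OF i u])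
    then obtain d where d: "d > 0" "ball (\<phi> i u) d \<inter> edges = {}"
      using compact_imp_closed[OF edges_compact] by (meson ComplI disjoint_eq_subset_Compl open_Compl open_contains_ball)
    have "\<forall>\<^sub>F n in sequentially. s n < d / 2"
      using order_tendstoD(2)[OF s(2), of "d / 2"] d by simp
    then have "\<forall>\<^sub>F n in sequentially. jac i v u *\<^sub>R (cutoff (A n) (s n) (\<phi> i u) * h (\<phi> i u)) = jac i v u *\<^sub>R h (\<phi> i u)"
    proof eventually_elim
      fix n assume n: "s n < d / 2"
      have "cutoff (A n) (s n) (\<phi> i u) = 1"
      proof (rule cutoff_one[OF s(1)])
        fix c assume "c \<in> A n"
        then have "c \<in> edges" using A(2) by blast
        then have "c \<notin> ball (\<phi> i u) d" using d(2) by blast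
        then show "\<phi> i u \<notin> ball c (2 * s n)" using n by (simp add: dist_commute)
      qed
      then show "jac i v u *\<^sub>R (cutoff (A n) (s n) (\<phi> i u) * h (\<phi> i u)) = jac i v u *\<^sub>R h (\<phi> i u)" by simp
    qed
    then show "(\<lambda>n. jac i v u *\<^sub>R (cutoff (A n) (s n) (\<phi> i u) * h (\<phi> i u))) \<longlonglongrightarrow> jac i v u *\<^sub>R h (\<phi> i u)"
      by (rule tendsto_eventually)
  qed
  then show "(\<lambda>n. integral (D i) (\<lambda>u. jac i v u *\<^sub>R (cutoff (A n) (s n) (\<phi> i u) * h (\<phi> i u))))
      \<longlonglongrightarrow> integral (D i) (\<lambda>u. jac i v u *\<^sub>R h (\<phi> i u))"
    by (simp only: spike)
qed

text \<open>For each \<open>n\<close> cut off near the edges with a cover of radius and content below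
  \<open>1 / (n + 1)\<close>. The cut field satisfies the divergence theorem, and both sides converge.\<close>

theorem divergence_theorem_real:
  fixes h :: "real^4 \<Rightarrow> real"
  assumes h: "C1_on h W"
  shows "stokes v h"
proof -
  have "\<exists>A (s::real). finite A \<and> A \<subseteq> edges \<and> edges \<subseteq> (\<Union>c\<in>A. ball c s) \<and> card A * s ^ 3 < inverse (Suc n)
      \<and> 0 < s \<and> s < inverse (Suc n)" for n
  proof -
    have "\<forall>\<^sub>F s in at_right (0::real). s \<in> {0<..<inverse (Suc n)}"
      by (rule eventually_at_right_real) simp
    moreover have "\<forall>\<^sub>F s in at_right (0::real). small_cover edges s (inverse (Suc n))"
      by (rule edges_cover) simp
    ultimately have "\<forall>\<^sub>F s in at_right (0::real). s \<in> {0<..<inverse (Suc n)} \<and> small_cover edges s (inverse (Suc n))"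
      by (rule eventually_conj)
    from eventually_happens[OF this] show ?thesis by (auto simp: small_cover_def)
  qed
  then obtain A and s :: "nat \<Rightarrow> real" where A: "\<And>n. finite (A n)" "\<And>n. A n \<subseteq> edges" "\<And>n. edges \<subseteq> (\<Union>c\<in>A n. ball c (s n))"
    "\<And>n. card (A n) * s n ^ 3 < inverse (Suc n)" and s: "\<And>n. 0 < s n" "\<And>n. s n < inverse (Suc n)"
    by metis
  have s1: "s n < 1" for n
    using s(2)[of n] by (rule less_le_trans) (simp add: inverse_le_1_iff)
  have s0: "s \<longlonglongrightarrow> 0"
    by (rule tendsto_sandwich[OF _ _ tendsto_const LIMSEQ_inverse_real_of_nat])
      (use s in \<open>auto intro!: always_eventually intro: less_imp_le\<close>)
  have cut: "integral U (dderiv v (\<lambda>x. cutoff (A n) (s n) x * h x)) = flux v (\<lambda>x. cutoff (A n) (s n) x * h x)" for n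
  proof -
    have "stokes v (\<lambda>x. cutoff (A n) (s n) x * h x)"
    proof (rule stokes_off_edges)
      show "C1_on (\<lambda>x. cutoff (A n) (s n) x * h x) W"
        by (intro C1_on_mult h C1_on_subset[OF C1_on_cutoff[OF A(1)]]) auto
      show "open (\<Union>c\<in>A n. ball c (s n))" by auto
      show "edges \<subseteq> (\<Union>c\<in>A n. ball c (s n))" by (rule A(3))
      fix x assume "x \<in> (\<Union>c\<in>A n. ball c (s n))"
      then show "cutoff (A n) (s n) x * h x = 0" using cutoff_zero[OF A(1) s(1)] by fastforce
    qed
    then show ?thesis by (simp add: stokes_def)
  qed
  obtain K where K: "\<And>A (s::real). finite A \<Longrightarrow> 0 < s \<Longrightarrow> s < 1 \<Longrightarrow>
    \<bar>integral U (dderiv v (\<lambda>x. cutoff A s x * h x)) - integral U (dderiv v h)\<bar> \<le> K * (card A * s ^ 3)"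
    using cutoff_error[OF h, of v] by blast
  have lim0: "(\<lambda>n. real (card (A n)) * s n ^ 3) \<longlonglongrightarrow> 0"
    by (rule tendsto_sandwich[OF _ _ tendsto_const LIMSEQ_inverse_real_of_nat])
      (use A(4) s(1) in \<open>auto intro!: always_eventually mult_nonneg_nonneg intro: less_imp_le\<close>)
  have "(\<lambda>n. integral U (dderiv v (\<lambda>x. cutoff (A n) (s n) x * h x)) - integral U (dderiv v h)) \<longlonglongrightarrow> 0"
  proof (rule Lim_null_comparison)
    show "\<forall>\<^sub>F n in sequentially. norm (integral U (dderiv v (\<lambda>x. cutoff (A n) (s n) x * h x)) - integral U (dderiv v h))
        \<le> K * (real (card (A n)) * s n ^ 3)"
      using K[OF A(1) s(1) s1] by (intro always_eventually) simp
    show "(\<lambda>n. K * (real (card (A n)) * s n ^ 3)) \<longlonglongrightarrow> 0"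
      using tendsto_mult_left[OF lim0, of K] by simp
  qed
  then have "(\<lambda>n. flux v (\<lambda>x. cutoff (A n) (s n) x * h x)) \<longlonglongrightarrow> integral U (dderiv v h)"
    unfolding cut by (simp add: LIM_zero_iff)
  from LIMSEQ_unique[OF this flux_cutoff_limit[where A = A and s = s, OF h A(1,2) s(1) s0]]
  show ?thesis by (simp add: stokes_def)
qed

text \<open>Here \<open>dderiv v h\<close> is the divergence of the field \<open>h v\<close>, and \<open>flux\<close> its
  integral over the oriented boundary.\<close>

theorem divergence_theorem:
  fixes h :: "real^4 \<Rightarrow> 'b::euclidean_space"
  assumes h: "C1_on h W"
  shows "integral U (dderiv v h) = flux v h"
proof (rule euclidean_eqI)
  fix b :: 'b assume b: "b \<in> Basis"
  have hb: "C1_on (\<lambda>x. h x \<bullet> b) W"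
    by (rule C1_on_linear[OF bounded_linear_inner_left h])
  have "integral U (dderiv v h) \<bullet> b = integral U (\<lambda>x. dderiv v h x \<bullet> b)"
    by (rule integral_component_eq[symmetric]) (rule dderiv_integrable[OF h])
  also have "\<dots> = integral U (dderiv v (\<lambda>x. h x \<bullet> b))"
  proof (rule integral_cong)
    fix x assume "x \<in> U"
    then show "dderiv v h x \<bullet> b = dderiv v (\<lambda>x. h x \<bullet> b) x"
      using dderiv_linear[OF bounded_linear_inner_left[of b] C1_on_differentiable[OF h], of x v] U_sub_W by auto
  qed
  also have "\<dots> = flux v (\<lambda>x. h x \<bullet> b)"
    using divergence_theorem_real[OF hb] by (simp add: stokes_def)
  also have "\<dots> = flux v h \<bullet> b"
    unfolding flux_def inner_sum_left
    by (intro sum.cong refl)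
      (simp add: integral_component_eq[OF flux_integrable[OF C1_on_continuous[OF h]], symmetric])
  finally show "integral U (dderiv v h) \<bullet> b = flux v h \<bullet> b" .
qed

end

section \<open>Continuity of the derivative of a holomorphic function\<close>

lemma bounded_bilinear_cscale: "bounded_bilinear (*\<^sub>c)"
proof -
  have "bilinear ((*\<^sub>c) :: complex \<Rightarrow> HC \<Rightarrow> HC)"
    unfolding bilinear_def
    by (intro conjI allI linearI) (auto simp: cscale_def vec_eq_iff algebra_simps scaleR_conv_of_real[where 'a = complex])
  then show ?thesis by (simp add: bilinear_conv_bounded_bilinear)
qed

lemma bounded_bilinear_matrix_product: "bounded_bilinear ((**) :: HC \<Rightarrow> HC \<Rightarrow> HC)"
proof -
  have "bilinear ((**) :: HC \<Rightarrow> HC \<Rightarrow> HC)"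
    unfolding bilinear_def
    by (intro conjI allI linearI)
      (auto simp: matrix_matrix_mult_def vec_eq_iff algebra_simps scaleR_conv_of_real[where 'a = complex]
        sum.distrib sum_distrib_left)
  then show ?thesis by (simp add: bilinear_conv_bounded_bilinear)
qed

lemmas matrix_product_zero = bounded_bilinear.zero_left[OF bounded_bilinear_matrix_product]
  bounded_bilinear.zero_right[OF bounded_bilinear_matrix_product]

lemmas matrix_product_scaleR = bounded_bilinear.scaleR_left[OF bounded_bilinear_matrix_product]
  bounded_bilinear.scaleR_right[OF bounded_bilinear_matrix_product]

lemmas continuous_on_cscale [continuous_intros] = bounded_bilinear.continuous_on[OF bounded_bilinear_cscale]

lemma holomorphic_HC_line:
  assumes f: "(f has_derivative f') (at (Z + t *\<^sub>c A))" and lin: "\<And>c A. f' (c *\<^sub>c A) = c *\<^sub>c f' A"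
  shows "((\<lambda>t. f (Z + t *\<^sub>c A) $ i $ j) has_field_derivative f' A $ i $ j) (at t)"
proof -
  have 1: "((\<lambda>t. Z + t *\<^sub>c A) has_derivative (\<lambda>t. t *\<^sub>c A)) (at t)"
    using bounded_bilinear.bounded_linear_left[OF bounded_bilinear_cscale, of A]
    by (auto intro!: derivative_eq_intros bounded_linear_imp_has_derivative)
  have 2: "bounded_linear (\<lambda>B :: HC. B $ i $ j)"
    by (intro bounded_linear_compose[OF bounded_linear_vec_nth bounded_linear_vec_nth])
  have "((\<lambda>t. f (Z + t *\<^sub>c A) $ i $ j) has_derivative (\<lambda>t. f' (t *\<^sub>c A) $ i $ j)) (at t)"
    using bounded_linear.has_derivative[OF 2 has_derivative_compose[OF 1 f]] .
  moreover have "(\<lambda>t. f' (t *\<^sub>c A) $ i $ j) = (*) (f' A $ i $ j)"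
    unfolding lin by (simp add: cscale_def fun_eq_iff)
  ultimately show ?thesis by (simp add: has_field_derivative_def)
qed

lemma holomorphic_HC_deriv:
  assumes "holomorphic_HC f V" "Z \<in> V"
  shows "(f has_derivative frechet_derivative f (at Z)) (at Z)"
    and "dderiv (c *\<^sub>c A) f Z = c *\<^sub>c dderiv A f Z"
proof -
  obtain f' where f': "(f has_derivative f') (at Z)" "\<And>c A. f' (c *\<^sub>c A) = c *\<^sub>c f' A"
    using assms unfolding holomorphic_HC_def by blast
  then have "frechet_derivative f (at Z) = f'" using frechet_derivative_at by metis
  then show "(f has_derivative frechet_derivative f (at Z)) (at Z)"
    "dderiv (c *\<^sub>c A) f Z = c *\<^sub>c dderiv A f Z"
    using f' by auto
qed

lemma cpartial_eq_dderiv: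
  assumes "holomorphic_HC f V" "Z \<in> V"
  shows "cpartial E f Z = dderiv E f Z"
proof -
  have "((\<lambda>t. f (Z + t *\<^sub>c E) $ i $ j) has_field_derivative dderiv E f Z $ i $ j) (at 0)" for i j
    by (rule holomorphic_HC_line) (use holomorphic_HC_deriv[OF assms] in \<open>auto simp: cscale_def zero_vec_def[symmetric]\<close>)
  then show ?thesis
    unfolding cpartial_def by (simp add: vec_eq_iff DERIV_imp_deriv)
qed

text \<open>Holomorphy only provides a complex-linear derivative at each point. Restricted to
  the complex lines through \<open>Z\<close> in a fixed direction \<open>A\<close>, the entries are holomorphic functions of
  one variable that depend on \<open>Z\<close> uniformly on a disc; by Cauchy's theory their derivatives
  depend continuously on \<open>Z\<close>.\<close>

lemma holomorphic_HC_imp_C1_on: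
  assumes V: "open V" and f: "holomorphic_HC f V"
  shows "C1_on f V"
proof (rule C1_onI)
  show "(f has_derivative frechet_derivative f (at Z)) (at Z)" if "Z \<in> V" for Z
    by (rule holomorphic_HC_deriv(1)[OF f that])
  fix A
  have fc: "continuous_on V f"
    using holomorphic_HC_deriv(1)[OF f] by (meson continuous_at_imp_continuous_on has_derivative_continuous)
  have "isCont (\<lambda>Z. dderiv A f Z $ i $ j) Z0" if Z0: "Z0 \<in> V" for i j Z0
  proof -
    let ?P = "\<lambda>p. fst p + snd p *\<^sub>c A"
    let ?g = "\<lambda>Z t. f (Z + t *\<^sub>c A) $ i $ j"
    have Pc: "continuous_on S ?P" for S by (intro continuous_intros)
    have "open (?P -` V)" "(Z0, 0) \<in> ?P -` V"
      using open_vimage[OF V Pc] Z0 by (simp_all add: cscale_def zero_vec_def[symmetric])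
    then obtain S T where ST: "open S" "open T" "Z0 \<in> S" "0 \<in> T" "S \<times> T \<subseteq> ?P -` V"
      by (auto elim!: open_prod_elim)
    obtain d where d: "d > 0" "cball Z0 d \<subseteq> S" using ST(1,3) open_contains_cball by blast
    obtain r where r: "r > 0" "cball 0 r \<subseteq> T" using ST(2,4) open_contains_cball by blast
    have PV: "Z + t *\<^sub>c A \<in> V" if "Z \<in> cball Z0 d" "t \<in> cball 0 r" for Z t
    proof -
      have "(Z, t) \<in> S \<times> T" using that d(2) r(2) by blast
      then show ?thesis using ST(5) by auto
    qed
    have hd: "(?g Z has_field_derivative dderiv A f (Z + t *\<^sub>c A) $ i $ j) (at t)"
      if "Z \<in> cball Z0 d" "t \<in> cball 0 r" for Z t
      by (rule holomorphic_HC_line) (use holomorphic_HC_deriv[OF f PV[OF that]] in auto)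
    let ?K = "cball Z0 d \<times> cball 0 r"
    have "continuous_on ?K (\<lambda>p. f (?P p) $ i $ j)"
      by (intro continuous_intros continuous_on_compose2[OF fc Pc]) (use PV in auto)
    then have uc: "uniformly_continuous_on ?K (\<lambda>p. f (?P p) $ i $ j)"
      by (rule compact_uniformly_continuous) (intro compact_Times compact_cball)
    have ul: "uniform_limit (ball 0 r) ?g (?g Z0) (at Z0)"
    proof (rule uniform_limitI)
      fix e :: real assume "e > 0"
      then obtain \<delta> where \<delta>: "\<delta> > 0" "\<And>p p'. p \<in> ?K \<Longrightarrow> p' \<in> ?K \<Longrightarrow> dist p' p < \<delta> \<Longrightarrow>
          dist (f (?P p') $ i $ j) (f (?P p) $ i $ j) < e"
        using uc unfolding uniformly_continuous_on_def by blast
      have "\<forall>\<^sub>F Z in at Z0. Z \<in> ball Z0 (min d \<delta>)"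
        by (rule eventually_at_in_open') (use d \<delta> in auto)
      then show "\<forall>\<^sub>F Z in at Z0. \<forall>t\<in>ball 0 r. dist (?g Z t) (?g Z0 t) < e"
      proof eventually_elim
        fix Z assume Z: "Z \<in> ball Z0 (min d \<delta>)"
        show "\<forall>t\<in>ball 0 r. dist (?g Z t) (?g Z0 t) < e"
        proof
          fix t :: complex assume "t \<in> ball 0 r"
          moreover have "dist (Z, t) (Z0, t) < \<delta>" using Z by (simp add: dist_Pair_Pair dist_commute)
          ultimately show "dist (?g Z t) (?g Z0 t) < e"
            using \<delta>(2)[of "(Z0, t)" "(Z, t)"] Z d by simp
        qed
      qed
    qed
    have "\<forall>\<^sub>F Z in at Z0. Z \<in> ball Z0 d" by (rule eventually_at_in_open') (use d in auto)
    then have "\<forall>\<^sub>F Z in at Z0. ?g Z holomorphic_on ball 0 r"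
    proof eventually_elim
      fix Z assume Z: "Z \<in> ball Z0 d"
      show "?g Z holomorphic_on ball 0 r"
        unfolding holomorphic_on_open[OF open_ball]
      proof
        fix t :: complex assume "t \<in> ball 0 r"
        then show "\<exists>g'. (?g Z has_field_derivative g') (at t)"
          by (intro exI[of _ "dderiv A f (Z + t *\<^sub>c A) $ i $ j"] hd) (use Z in auto)
      qed
    qed
    from higher_deriv_complex_uniform_limit[OF ul this _ open_ball, of 0 1] r(1)
    have "((\<lambda>Z. deriv (?g Z) 0) \<longlongrightarrow> deriv (?g Z0) 0) (at Z0)" by simp
    moreover have "deriv (?g Z) 0 = dderiv A f Z $ i $ j" if "Z \<in> ball Z0 d" for Z
      using DERIV_imp_deriv[OF hd[of Z 0]] that r(1) by (simp add: cscale_def zero_vec_def[symmetric])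
    ultimately show ?thesis
      unfolding isCont_def using \<open>\<forall>\<^sub>F Z in at Z0. Z \<in> ball Z0 d\<close> d(1)
      by (auto elim!: Lim_transform_eventually eventually_mono)
  qed
  then have "continuous_on V (\<lambda>Z. \<chi> i. \<chi> j. dderiv A f Z $ i $ j)"
    by (intro continuous_on_vec_lambda continuous_at_imp_continuous_on) blast
  then show "continuous_on V (\<lambda>Z. dderiv A f Z)" by simp
qed

section \<open>Further calculus rules\<close>

lemma C1_on_affine:
  fixes f :: "'b::euclidean_space \<Rightarrow> 'c::real_normed_vector" and L :: "'a::euclidean_space \<Rightarrow> 'b"
  assumes L: "bounded_linear L" and f: "C1_on f V" and S: "\<And>x. x \<in> S \<Longrightarrow> c + L (x - x0) \<in> V"
  shows "C1_on (\<lambda>x. f (c + L (x - x0))) S"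
    and "x \<in> S \<Longrightarrow> dderiv v (\<lambda>x. f (c + L (x - x0))) x = dderiv (L v) f (c + L (x - x0))"
proof -
  have d: "((\<lambda>x. f (c + L (x - x0))) has_derivative (\<lambda>v. dderiv (L v) f (c + L (x - x0)))) (at x)" if "x \<in> S" for x
  proof -
    have "((\<lambda>x. c + L (x - x0)) has_derivative (\<lambda>v. L v)) (at x)"
      by (auto intro!: derivative_eq_intros bounded_linear.has_derivative[OF L])
    from has_derivative_compose[OF this C1_on_has_derivative[OF f S[OF that]]] show ?thesis .
  qed
  have "continuous_on S (\<lambda>x. c + L (x - x0))"
    by (intro continuous_intros bounded_linear.continuous_on[OF L])
  then show "C1_on (\<lambda>x. f (c + L (x - x0))) S"
    by (intro C1_onI[OF d] continuous_on_compose2[OF C1_on_continuous_dderiv[OF f]]) (use S in auto)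
  show "x \<in> S \<Longrightarrow> dderiv v (\<lambda>x. f (c + L (x - x0))) x = dderiv (L v) f (c + L (x - x0))"
    by (simp add: frechet_derivative_at[OF d, symmetric])
qed

lemma C1_on_inverse:
  fixes f :: "'a::euclidean_space \<Rightarrow> complex"
  assumes f: "C1_on f S" and nz: "\<And>x. x \<in> S \<Longrightarrow> f x \<noteq> 0"
  shows "C1_on (\<lambda>x. inverse (f x)) S"
    and "x \<in> S \<Longrightarrow> dderiv v (\<lambda>x. inverse (f x)) x = - (inverse (f x) * dderiv v f x * inverse (f x))"
proof -
  have d: "((\<lambda>x. inverse (f x)) has_derivative (\<lambda>v. - (inverse (f x) * dderiv v f x * inverse (f x)))) (at x)" if "x \<in> S" for x
    by (rule Deriv.has_derivative_inverse[OF nz[OF that] C1_on_has_derivative[OF f that]])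
  show "C1_on (\<lambda>x. inverse (f x)) S"
    by (intro C1_onI[OF d] continuous_intros C1_on_continuous[OF f] C1_on_continuous_dderiv[OF f]) (use nz in auto)
  show "x \<in> S \<Longrightarrow> dderiv v (\<lambda>x. inverse (f x)) x = - (inverse (f x) * dderiv v f x * inverse (f x))"
    by (simp add: frechet_derivative_at[OF d, symmetric])
qed

section \<open>The form on the deformed real form\<close>

text \<open>The matrix of \<open>hr y\<close> with its diagonal multiplied by \<open>a\<close> and its off-diagonal part by
  \<open>b\<close>. The deformation is the case \<open>a = 1 + i \<epsilon>\<close>, \<open>b = 1 - i \<epsilon>\<close>.\<close>

definition twist :: "complex \<Rightarrow> complex \<Rightarrow> real^4 \<Rightarrow> HC"
  where "twist a b y = vector [vector [a * (y$0 - \<i> * y$3), b * (y$1 + \<i> * y$2)],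
                               vector [b * (y$1 - \<i> * y$2), a * (y$0 + \<i> * y$3)]]"

definition twist_norm :: "complex \<Rightarrow> complex \<Rightarrow> real^4 \<Rightarrow> complex"
  where "twist_norm a b y = a\<^sup>2 * ((y$0)\<^sup>2 + (y$3)\<^sup>2) - b\<^sup>2 * ((y$1)\<^sup>2 + (y$2)\<^sup>2)"

text \<open>The adjugate matrix, which gives a polynomial numerator for the inverse.\<close>

definition adj2 :: "HC \<Rightarrow> HC"
  where "adj2 A = vector [vector [A$2$2, - A$1$2], vector [- A$2$1, A$1$1]]"

text \<open>The Cauchy-Fueter kernel $Z^{-1} / N(Z)$ at \<open>Z = twist a b y\<close>; see \<open>kern_eq\<close>.\<close>

definition kern :: "complex \<Rightarrow> complex \<Rightarrow> real^4 \<Rightarrow> HC"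
  where "kern a b y = (inverse (twist_norm a b y) * inverse (twist_norm a b y)) *\<^sub>c adj2 (twist a b y)"

text \<open>The coefficients of the pull-back of \<open>Dz\<close> under \<open>twist a b\<close>, written as the flux form
  of a constant matrix-valued vector field; see \<open>Dz_twist\<close>.\<close>

definition coef :: "complex \<Rightarrow> complex \<Rightarrow> 4 \<Rightarrow> HC"
  where "coef a b k = (if k = 0 then (a * b\<^sup>2) *\<^sub>c e0 else if k = 1 then (- \<i> * a\<^sup>2 * b) *\<^sub>c e1
    else if k = 2 then (\<i> * a\<^sup>2 * b) *\<^sub>c e2 else (a * b\<^sup>2) *\<^sub>c e3)"

lemma HC_eqI: "A$1$1 = B$1$1 \<Longrightarrow> A$1$2 = B$1$2 \<Longrightarrow> A$2$1 = B$2$1 \<Longrightarrow> A$2$2 = B$2$2 \<Longrightarrow> A = (B :: HC)"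
  by (simp add: vec_eq_iff forall_2)

lemma cscale_nth [simp]: "(c *\<^sub>c A) $ i $ j = c * A $ i $ j"
  by (simp add: cscale_def)

lemma matrix_product_nth: "(A ** B) $ i $ j = A $ i $ 1 * B $ 1 $ j + A $ i $ 2 * B $ 2 $ j" for A B :: HC
  by (simp add: matrix_matrix_mult_def sum_2)

lemma hr_eq_twist: "hr y = twist 1 1 y"
  by (rule HC_eqI) (simp_all add: hr_def twist_def te1_def te2_def e0_def e1_def e2_def e3_def
      scaleR_conv_of_real[where 'a = complex] field_simps)

lemma hdef_eq_twist:
  "hdef \<epsilon> (hr X0) (hr x) = hr X0 + twist (1 + \<i> * \<epsilon>) (1 - \<i> * \<epsilon>) (x - X0)"
  unfolding hr_eq_twist hdef_def
  by (rule HC_eqI) (simp_all add: qminus_def twist_def field_simps)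

lemma qnorm_twist: "qnorm (twist a b y) = twist_norm a b y"
  by (simp add: qnorm_def det_2 twist_def twist_norm_def field_simps power2_eq_square)

lemma matrix_inv_adj2:
  assumes "qnorm A \<noteq> 0"
  shows "matrix_inv A = inverse (qnorm A) *\<^sub>c adj2 A"
proof -
  let ?B = "inverse (qnorm A) *\<^sub>c adj2 A"
  have d: "A$1$1 * A$2$2 - A$1$2 * A$2$1 = qnorm A" by (simp add: qnorm_def det_2)
  have e: "A$1$1 * A$2$2 = qnorm A + A$1$2 * A$2$1" using d by (simp add: algebra_simps)
  have AB: "A ** ?B = mat 1" "?B ** A = mat 1"
    by (rule HC_eqI; simp add: matrix_product_nth adj2_def mat_def field_simps assms e)+
  then have inv: "A ** matrix_inv A = mat 1" "matrix_inv A ** A = mat 1"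
    unfolding matrix_inv_def by (metis (mono_tags, lifting) someI)+
  have "matrix_inv A = (?B ** A) ** matrix_inv A" by (simp add: AB)
  also have "\<dots> = ?B" by (simp add: matrix_mul_assoc[symmetric] inv)
  finally show ?thesis .
qed

lemma kern_eq:
  assumes "twist_norm a b y \<noteq> 0"
  shows "(1 / qnorm (twist a b y)) *\<^sub>c matrix_inv (twist a b y) = kern a b y"
  using assms
  by (intro HC_eqI) (simp_all add: matrix_inv_adj2 qnorm_twist kern_def divide_inverse)

lemma bounded_linear_twist: "bounded_linear (twist a b)"
proof -
  have "linear (twist a b)"
    by (intro linearI HC_eqI) (simp_all add: twist_def algebra_simps scaleR_conv_of_real[where 'a = complex])
  then show ?thesis by (simp add: linear_conv_bounded_linear)
qed

lemma bounded_linear_adj2: "bounded_linear adj2"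
proof -
  have "linear adj2"
    by (intro linearI HC_eqI) (simp_all add: adj2_def algebra_simps scaleR_conv_of_real[where 'a = complex])
  then show ?thesis by (simp add: linear_conv_bounded_linear)
qed

definition minor :: "4 \<Rightarrow> 4 \<Rightarrow> 4 \<Rightarrow> real^4 \<Rightarrow> real^4 \<Rightarrow> real^4 \<Rightarrow> real"
  where "minor i j k p q r = p$i * (q$j * r$k - q$k * r$j) - p$j * (q$i * r$k - q$k * r$i)
    + p$k * (q$i * r$j - q$j * r$i)"

lemma det4_expand:
  "det4 v p q r = v$0 * minor 1 2 3 p q r - v$1 * minor 0 2 3 p q r + v$2 * minor 0 1 3 p q r - v$3 * minor 0 1 2 p q r"
proof -
  have f0: "finite {1::4, 2, 3}" "0 \<notin> {1::4, 2, 3}" by auto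
  have f1: "finite {2::4, 3}" "1 \<notin> {2::4, 3}" by auto
  have f2: "finite {3::4}" "2 \<notin> {3::4}" by auto
  show ?thesis
    unfolding det4_def det_def UNIV_4_zero
    unfolding sum_over_permutations_insert[OF f0]
    unfolding sum_over_permutations_insert[OF f1]
    unfolding sum_over_permutations_insert[OF f2]
    unfolding permutes_sing
    by (simp add: sign_swap_id permutation_swap_id sign_compose sign_id swap_id_eq permutation_compose)
      (simp add: minor_def algebra_simps)
qed

lemma dz3_twist:
  fixes a b :: complex
  shows "dz3 1 2 3 (twist a b p) (twist a b q) (twist a b r) = a * b\<^sup>2 * minor 1 2 3 p q r"
  "dz3 0 2 3 (twist a b p) (twist a b q) (twist a b r) = - \<i> * a\<^sup>2 * b * minor 0 2 3 p q r"
  "dz3 0 1 3 (twist a b p) (twist a b q) (twist a b r) = \<i> * a\<^sup>2 * b * minor 0 1 3 p q r"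
  "dz3 0 1 2 (twist a b p) (twist a b q) (twist a b r) = a * b\<^sup>2 * minor 0 1 2 p q r"
proof -
  have z: "zcoord 0 (twist a b y) = a * y$0" "zcoord 1 (twist a b y) = \<i> * b * y$1"
    "zcoord 2 (twist a b y) = - \<i> * b * y$2" "zcoord 3 (twist a b y) = a * y$3" for y
    by (simp_all add: zcoord_def twist_def field_simps)
  show "dz3 1 2 3 (twist a b p) (twist a b q) (twist a b r) = a * b\<^sup>2 * minor 1 2 3 p q r"
    "dz3 0 2 3 (twist a b p) (twist a b q) (twist a b r) = - \<i> * a\<^sup>2 * b * minor 0 2 3 p q r"
    "dz3 0 1 3 (twist a b p) (twist a b q) (twist a b r) = \<i> * a\<^sup>2 * b * minor 0 1 3 p q r"
    "dz3 0 1 2 (twist a b p) (twist a b q) (twist a b r) = a * b\<^sup>2 * minor 0 1 2 p q r"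
    by (simp_all add: dz3_def z det_3 minor_def power2_eq_square algebra_simps)
qed

lemma det4_axis:
  "det4 (axis 0 1) p q r = minor 1 2 3 p q r" "det4 (axis 1 1) p q r = - minor 0 2 3 p q r"
  "det4 (axis 2 1) p q r = minor 0 1 3 p q r" "det4 (axis 3 1) p q r = - minor 0 1 2 p q r"
  by (simp_all add: det4_expand axis_def)

lemma Dz_twist:
  "Dz (twist a b p) (twist a b q) (twist a b r) = (\<Sum>k\<in>UNIV. det4 (axis k 1) p q r *\<^sub>R coef a b k)"
  unfolding sum_4_zero det4_axis Dz_def dz3_twist
  by (rule HC_eqI) (simp_all add: coef_def scaleR_conv_of_real[where 'a = complex] e0_def e1_def e2_def e3_def algebra_simps)

lemma twist_axis:
  "twist a b (axis 0 1) = a *\<^sub>c e0" "twist a b (axis 1 1) = (\<i> * b) *\<^sub>c e1"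
  "twist a b (axis 2 1) = (- \<i> * b) *\<^sub>c e2" "twist a b (axis 3 1) = a *\<^sub>c e3"
  by (rule HC_eqI; simp add: twist_def axis_def e0_def e1_def e2_def e3_def field_simps)+

lemma twist_norm_has_derivative:
  fixes a b :: complex
  shows "(twist_norm a b has_derivative
    (\<lambda>v. 2 * (a\<^sup>2 * (y$0 * v$0 + y$3 * v$3) - b\<^sup>2 * (y$1 * v$1 + y$2 * v$2)))) (at y)"
  unfolding twist_norm_def[abs_def]
  by (rule derivative_eq_intros bounded_linear_imp_has_derivative bounded_linear_vec_nth refl)+
    (auto simp: fun_eq_iff algebra_simps power2_eq_square)

lemma C1_on_twist_norm: "C1_on (twist_norm a b) S"
  by (rule C1_onI[OF twist_norm_has_derivative]) (intro continuous_intros)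

lemma dderiv_twist_norm:
  fixes a b :: complex
  shows "dderiv v (twist_norm a b) y = 2 * (a\<^sup>2 * (y$0 * v$0 + y$3 * v$3) - b\<^sup>2 * (y$1 * v$1 + y$2 * v$2))"
  by (simp add: frechet_derivative_at[OF twist_norm_has_derivative, symmetric])

lemma C1_on_linear_map: "bounded_linear L \<Longrightarrow> C1_on L S" for L :: "'a::euclidean_space \<Rightarrow> 'b::real_normed_vector"
  by (rule C1_onI[OF bounded_linear_imp_has_derivative]) auto

lemma dderiv_linear_map: "bounded_linear L \<Longrightarrow> dderiv v L x = L v"
  using frechet_derivative_at[OF bounded_linear_imp_has_derivative] by metis

lemma adj2_twist_linear: "bounded_linear (\<lambda>y. adj2 (twist a b y))"
  by (rule bounded_linear_compose[OF bounded_linear_adj2 bounded_linear_twist])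

lemma C1_on_kern:
  assumes "\<And>y. y \<in> S \<Longrightarrow> twist_norm a b y \<noteq> 0"
  shows "C1_on (kern a b) S"
  unfolding kern_def[abs_def]
  by (intro C1_on_bilinear[OF bounded_bilinear_cscale] C1_on_mult C1_on_inverse(1) C1_on_twist_norm
      C1_on_linear_map adj2_twist_linear assms)

lemma dderiv_kern:
  assumes N: "twist_norm a b y \<noteq> 0"
  shows "dderiv v (kern a b) y = (1 / (twist_norm a b y)\<^sup>2) *\<^sub>c adj2 (twist a b v)
    + (- 2 * dderiv v (twist_norm a b) y / (twist_norm a b y) ^ 3) *\<^sub>c adj2 (twist a b y)"
proof -
  let ?N = "twist_norm a b" let ?S = "{z. ?N z \<noteq> 0}"
  have y: "y \<in> ?S" using N by simp
  have i: "C1_on (\<lambda>y. inverse (?N y)) ?S" by (rule C1_on_inverse(1)[OF C1_on_twist_norm]) simp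
  have di: "dderiv v (\<lambda>y. inverse (?N y)) y = - (inverse (?N y) * dderiv v ?N y * inverse (?N y))"
    by (rule C1_on_inverse(2)[OF C1_on_twist_norm _ y]) simp
  have dd: "dderiv v (\<lambda>y. inverse (?N y) * inverse (?N y)) y = - 2 * dderiv v ?N y / ?N y ^ 3"
    unfolding dderiv_bilinear(2)[OF bounded_bilinear_mult C1_on_differentiable[OF i y] C1_on_differentiable[OF i y]] di
    using N by (simp add: field_simps eval_nat_numeral)
  have dl: "dderiv v (\<lambda>y. adj2 (twist a b y)) y = adj2 (twist a b v)"
    by (rule dderiv_linear_map[OF adj2_twist_linear])
  show ?thesis
    unfolding kern_def[abs_def]
    unfolding dderiv_bilinear(2)[OF bounded_bilinear_cscale C1_on_differentiable[OF C1_on_mult[OF i i] y]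
        C1_on_differentiable[OF C1_on_linear_map[OF adj2_twist_linear] y]] dd dl
    by (simp add: power2_eq_square divide_inverse)
qed

text \<open>Right-regularity of the kernel. With $K = \bar Z / N^2$ the derivative of the numerator
  contributes $4 a^2 b^2 / N^2$, and that of the denominator
  $-2 N^{-3} \bar Z \cdot 2 a^2 b^2 Z = - 4 a^2 b^2 / N^2$.\<close>

lemma kern_regular:
  assumes N: "twist_norm a b y \<noteq> 0"
  shows "(\<Sum>k\<in>UNIV. dderiv (axis k 1) (kern a b) y ** coef a b k) = 0"
proof -
  let ?N = "twist_norm a b y"
  have 1: "(\<Sum>k\<in>UNIV. adj2 (twist a b (axis k 1)) ** coef a b k) = (4 * a\<^sup>2 * b\<^sup>2) *\<^sub>c mat 1"
    unfolding sum_4_zero twist_axis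
    by (rule HC_eqI) (simp_all add: matrix_product_nth adj2_def coef_def e0_def e1_def e2_def e3_def mat_def
        power2_eq_square algebra_simps)
  have 2: "(\<Sum>k\<in>UNIV. dderiv (axis k 1) (twist_norm a b) y *\<^sub>c coef a b k) = (2 * a\<^sup>2 * b\<^sup>2) *\<^sub>c twist a b y"
    unfolding sum_4_zero dderiv_twist_norm
    by (rule HC_eqI) (simp_all add: coef_def e0_def e1_def e2_def e3_def twist_def axis_def power2_eq_square algebra_simps)
  have 3: "adj2 (twist a b y) ** twist a b y = ?N *\<^sub>c mat 1"
    by (rule HC_eqI) (simp_all add: matrix_product_nth adj2_def twist_def twist_norm_def mat_def power2_eq_square algebra_simps)
  have "(\<Sum>k\<in>UNIV. dderiv (axis k 1) (kern a b) y ** coef a b k)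
      = (1 / ?N\<^sup>2) *\<^sub>c (\<Sum>k\<in>UNIV. adj2 (twist a b (axis k 1)) ** coef a b k)
      + (- 2 / ?N ^ 3) *\<^sub>c (adj2 (twist a b y) ** (\<Sum>k\<in>UNIV. dderiv (axis k 1) (twist_norm a b) y *\<^sub>c coef a b k))"
    unfolding dderiv_kern[OF N] sum_4_zero
    by (rule HC_eqI) (simp_all add: matrix_product_nth algebra_simps)
  also have "\<dots> = (4 * a\<^sup>2 * b\<^sup>2 / ?N\<^sup>2) *\<^sub>c mat 1 + (- 4 * a\<^sup>2 * b\<^sup>2 / ?N ^ 3) *\<^sub>c (adj2 (twist a b y) ** twist a b y)"
    unfolding 1 2 by (rule HC_eqI) (simp_all add: matrix_product_nth mat_def algebra_simps)
  also have "\<dots> = 0"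
    unfolding 3 using N by (intro HC_eqI) (simp_all add: mat_def eval_nat_numeral)
  finally show ?thesis .
qed

text \<open>This sum is what a radial bump sees of the kernel. Its off-diagonal entries are odd in
  \<open>(y\<^sub>1, y\<^sub>2)\<close> and drop out on integration; the diagonal ones depend only on
  \<open>y\<^sub>0\<^sup>2 + y\<^sub>3\<^sup>2\<close> and \<open>y\<^sub>1\<^sup>2 + y\<^sub>2\<^sup>2\<close>.\<close>

lemma kern_moment:
  fixes a b :: complex
  shows "(\<Sum>k\<in>UNIV. y$k *\<^sub>R (kern a b y ** coef a b k)) = (a * b * inverse (twist_norm a b y) ^ 2) *\<^sub>c
    vector [vector [a * b * (norm y)\<^sup>2, - (a\<^sup>2 + b\<^sup>2) * ((y$0 + \<i> * y$3) * (y$1 + \<i> * y$2))],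
            vector [- (a\<^sup>2 + b\<^sup>2) * ((y$0 - \<i> * y$3) * (y$1 - \<i> * y$2)), a * b * (norm y)\<^sup>2]]"
proof -
  have n: "(complex_of_real (norm y))\<^sup>2 = (y$0)\<^sup>2 + (y$1)\<^sup>2 + (y$2)\<^sup>2 + (y$3)\<^sup>2"
    unfolding of_real_power[symmetric] power2_norm_eq_inner inner_vec_def sum_4_zero
    by (simp add: power2_eq_square)
  have "(\<Sum>k\<in>UNIV. y$k *\<^sub>R (kern a b y ** coef a b k)) = (inverse (twist_norm a b y) ^ 2) *\<^sub>c
    (\<Sum>k\<in>UNIV. y$k *\<^sub>R (adj2 (twist a b y) ** coef a b k))"
    unfolding sum_4_zero kern_def
    by (rule HC_eqI) (simp_all add: matrix_product_nth scaleR_conv_of_real[where 'a = complex] power2_eq_square algebra_simps)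
  also have "(\<Sum>k\<in>UNIV. y$k *\<^sub>R (adj2 (twist a b y) ** coef a b k)) = (a * b) *\<^sub>c
    vector [vector [a * b * (norm y)\<^sup>2, - (a\<^sup>2 + b\<^sup>2) * ((y$0 + \<i> * y$3) * (y$1 + \<i> * y$2))],
            vector [- (a\<^sup>2 + b\<^sup>2) * ((y$0 - \<i> * y$3) * (y$1 - \<i> * y$2)), a * b * (norm y)\<^sup>2]]"
    unfolding sum_4_zero
    by (rule HC_eqI) (simp_all add: n[unfolded power2_eq_square] matrix_product_nth adj2_def coef_def e0_def e1_def e2_def e3_def twist_def
        scaleR_conv_of_real[where 'a = complex] power2_eq_square algebra_simps)
  finally show ?thesis
    by (simp add: vec_eq_iff mult_ac)
qed

section \<open>The mass of the kernel\<close>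

text \<open>The decomposition into two planes on whose squared radii \<open>N\<close> depends.\<close>

definition planes :: "complex \<Rightarrow> complex \<Rightarrow> real^4"
  where "planes z w = (\<chi> k. if k = 0 then Re z else if k = 1 then Re w else if k = 2 then Im w else Im z)"

lemma planes_nth: "planes z w $ 0 = Re z" "planes z w $ 1 = Re w" "planes z w $ 2 = Im w" "planes z w $ 3 = Im z"
  by (simp_all add: planes_def)

lemma linear_planes: "linear (\<lambda>(z, w). planes z w)"
  by (rule linearI) (auto simp: planes_def vec_eq_iff forall_4_zero)

lemma bij_planes: "bij_betw (\<lambda>(z, w). planes z w) Basis Basis"
proof -
  have "planes 1 0 = axis 0 1" "planes \<i> 0 = axis 3 1" "planes 0 1 = axis 1 1" "planes 0 \<i> = axis 2 1"
    by (simp_all add: planes_def vec_eq_iff forall_4_zero axis_def)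
  then have "(\<lambda>(z, w). planes z w) ` Basis = Basis"
    by (auto simp: Basis_prod_def Basis_complex_def Basis_vec_axis UNIV_4_zero image_Un)
  moreover have "inj (\<lambda>(z, w). planes z w)"
  proof (rule injI, clarify)
    fix z w z' w' assume "planes z w = planes z' w'"
    then have "planes z w $ k = planes z' w' $ k" for k by simp
    from this[of 0] this[of 1] this[of 2] this[of 3] show "z = z' \<and> w = w'"
      by (simp add: planes_nth complex_eq_iff)
  qed
  ultimately show ?thesis
    unfolding bij_betw_def by (meson inj_on_subset subset_UNIV)
qed

lemma integral_planes:
  fixes f :: "real^4 \<Rightarrow> 'b::{banach, second_countable_topology}"
  assumes "integrable lborel f"
  shows "integral\<^sup>L lborel f = (\<integral>z. (\<integral>w. f (planes z w) \<partial>lborel) \<partial>lborel)"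
  using integral_product_coordinates[OF linear_planes bij_planes assms] by simp

lemma planes_measurable [measurable]: "(\<lambda>(z, w). planes z w) \<in> borel_measurable (lborel \<Otimes>\<^sub>M lborel)"
  using linear_continuous_on[OF linear_planes[unfolded linear_conv_bounded_linear], of UNIV]
  by (simp add: borel_measurable_continuous_onI lborel_prod)

text \<open>The disc of squared radius \<open>s\<close> has area \<open>\<pi> s\<close>, so squared radii in the plane are
  uniformly distributed with density \<open>\<pi>\<close>.\<close>

lemma distr_norm_square_plane:
  "distr lborel borel (\<lambda>z :: complex. (norm z)\<^sup>2) = density lborel (\<lambda>s. ennreal (pi * indicator {0..} s))"
  (is "?M = ?N")
proof (rule measure_eqI_generator_eq[where \<Omega> = UNIV and E = "range (\<lambda>s::real. {..s})" and A = "\<lambda>n. {..real n}"])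
  show "Int_stable (range (\<lambda>s::real. {..s}))"
    by (auto simp: Int_stable_def)
  show "sets ?M = sigma_sets UNIV (range (\<lambda>s::real. {..s}))"
    "sets ?N = sigma_sets UNIV (range (\<lambda>s::real. {..s}))"
    by (simp_all add: borel_eq_atMost)
  show "(\<Union>n. {..real n}) = UNIV"
    by (auto simp: real_arch_simple)
  have eq1: "emeasure ?M {..s} = ennreal (pi * max 0 s)" for s
  proof (cases "s \<ge> 0")
    case True
    have *: "(norm z)\<^sup>2 \<le> s \<longleftrightarrow> norm z \<le> sqrt s" for z :: complex
      using real_sqrt_le_iff[of "(norm z)\<^sup>2" s] by simp
    have "{z :: complex. (norm z)\<^sup>2 \<le> s} = cball 0 (sqrt s)"
      unfolding * by (simp add: cball_def)
    then have "emeasure ?M {..s} = emeasure lborel (cball (0::complex) (sqrt s))"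
      by (simp add: emeasure_distr vimage_def)
    also have "\<dots> = ennreal (unit_ball_vol 2 * sqrt s ^ 2)"
      using True by (simp add: emeasure_cball)
    finally show ?thesis using True by (simp add: unit_ball_vol_2 max_def)
  next
    case False
    have "(norm z)\<^sup>2 > s" for z :: complex
      using False zero_le_power2[of "norm z"] by linarith
    then have "{z :: complex. (norm z)\<^sup>2 \<le> s} = {}"
      by (auto simp: not_le)
    then show ?thesis using False by (simp add: emeasure_distr vimage_def)
  qed
  have eq2: "emeasure ?N {..s} = ennreal (pi * max 0 s)" for s
  proof -
    have "emeasure ?N {..s}
        = (\<integral>\<^sup>+x. ennreal pi * indicator {0..s} x \<partial>lborel)"
      by (subst emeasure_density) (auto intro!: nn_integral_cong simp: indicator_def)
    also have "\<dots> = ennreal (pi * max 0 s)"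
      by (simp add: nn_integral_cmult_indicator ennreal_mult max_def)
    finally show ?thesis .
  qed
  show "emeasure ?M X = emeasure ?N X"
    if "X \<in> range (\<lambda>s::real. {..s})" for X
    using that eq1 eq2 by auto
  show "emeasure ?M {..real n} \<noteq> \<infinity>" for n
    using eq1 by simp
qed auto

lemma integral_radial_plane:
  fixes f :: "real \<Rightarrow> complex"
  assumes [measurable]: "f \<in> borel_measurable borel"
  shows "(\<integral>z. f ((norm (z::complex))\<^sup>2) \<partial>lborel) = (\<integral>s. (pi * indicator {0..} s) *\<^sub>R f s \<partial>lborel)"
proof -
  have "(\<integral>z. f ((norm (z::complex))\<^sup>2) \<partial>lborel) = integral\<^sup>L (distr lborel borel (\<lambda>z :: complex. (norm z)\<^sup>2)) f"
    by (subst integral_distr) auto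
  also have "\<dots> = (\<integral>s. (pi * indicator {0..} s) *\<^sub>R f s \<partial>lborel)"
    unfolding distr_norm_square_plane by (subst integral_density) auto
  finally show ?thesis .
qed

lemma integral_odd:
  fixes f :: "'a::euclidean_space \<Rightarrow> complex"
  assumes [measurable]: "f \<in> borel_measurable borel" and odd: "\<And>x. f (- x) = - f x"
  shows "integral\<^sup>L lborel f = 0"
proof -
  have "distr lborel borel uminus = (lborel :: 'a measure)"
    by (subst (2) lborel_affine[of "-1" 0]) (auto simp: density_1)
  then have "integral\<^sup>L lborel f = integral\<^sup>L (distr lborel borel uminus) f"
    by simp
  also have "\<dots> = - integral\<^sup>L lborel f"
    by (subst integral_distr) (auto simp: odd)
  finally show ?thesis by simp
qed

text \<open>The derivative of the bump of radius \<open>r\<close> as a function of the squared distance.\<close>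

definition bump_slope :: "real \<Rightarrow> real \<Rightarrow> real"
  where "bump_slope r \<rho> = bump_profile' (\<rho> / r\<^sup>2) / r\<^sup>2"

lemma bump_slope_measurable [measurable]: "bump_slope r \<in> borel_measurable borel"
proof -
  have [measurable]: "bump_profile' \<in> borel_measurable borel"
    by (rule borel_measurable_continuous_onI[OF continuous_bump_profile'])
  show ?thesis unfolding bump_slope_def[abs_def] by measurable
qed

lemma bump_slope_zero: "r > 0 \<Longrightarrow> \<rho> \<le> r\<^sup>2 \<or> 4 * r\<^sup>2 \<le> \<rho> \<Longrightarrow> bump_slope r \<rho> = 0"
  by (auto simp: bump_slope_def field_simps intro!: bump_profile'_zero)

lemma bump_slope_bound: "r > 0 \<Longrightarrow> \<bar>bump_slope r \<rho>\<bar> \<le> 4 / 3 / r\<^sup>2"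
  unfolding bump_slope_def abs_divide abs_power2
  by (rule divide_right_mono[OF bump_profile'_bound]) simp

lemma integral_bump_slope:
  assumes r: "r > 0"
  shows "(\<integral>\<rho>. complex_of_real (bump_slope r \<rho>) \<partial>lborel) = - 1"
proof -
  let ?\<kappa> = "\<lambda>\<rho>. bump_profile (\<rho> / r\<^sup>2)"
  have "((\<lambda>\<rho>. \<rho> / r\<^sup>2) has_real_derivative 1 / r\<^sup>2) (at \<rho>)" for \<rho>
    by (rule DERIV_cdivide[OF DERIV_ident])
  then have d: "(?\<kappa> has_real_derivative bump_slope r \<rho>) (at \<rho>)" for \<rho>
    using DERIV_chain'[OF _ bump_profile_derivative] by (fastforce simp: bump_slope_def)
  have c: "continuous_on {0..4 * r\<^sup>2} (bump_slope r)"
    unfolding bump_slope_def[abs_def] divide_inverse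
    by (intro continuous_intros continuous_on_compose2[OF continuous_bump_profile'[of UNIV]]) auto
  have "(\<integral>\<rho>. indicator {0..4 * r\<^sup>2} \<rho> *\<^sub>R bump_slope r \<rho> \<partial>lborel) = ?\<kappa> (4 * r\<^sup>2) - ?\<kappa> 0"
    by (rule integral_FTC_Icc[OF _ _ c])
      (use r d in \<open>auto simp: has_real_derivative_iff_has_vector_derivative intro: has_vector_derivative_at_within\<close>)
  also have "\<dots> = - 1"
    using r by (simp add: bump_profile_zero bump_profile_one)
  also have "(\<lambda>\<rho>. indicator {0..4 * r\<^sup>2} \<rho> *\<^sub>R bump_slope r \<rho>) = bump_slope r"
  proof
    fix \<rho>
    have "\<rho> \<notin> {0..4 * r\<^sup>2} \<Longrightarrow> \<rho> \<le> r\<^sup>2 \<or> 4 * r\<^sup>2 \<le> \<rho>" using zero_le_power2[of r] by auto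
    then show "indicator {0..4 * r\<^sup>2} \<rho> *\<^sub>R bump_slope r \<rho> = bump_slope r \<rho>"
      using bump_slope_zero[OF r, of \<rho>] by (auto simp: indicator_def)
  qed
  finally show ?thesis by (simp add: integral_complex_of_real)
qed

lemma dderiv_bump_axis: "dderiv (axis k 1) (bump c r) x = 2 * bump_slope r ((norm (x - c))\<^sup>2) * (x - c) $ k"
  by (simp add: dderiv_bump bump_slope_def inner_axis)

text \<open>A quantitative form of: the twisted real form meets the null cone only at the
  origin. Every estimate of the kernel rests on it.\<close>

locale twisted =
  fixes a b :: complex and c :: real
  assumes c: "c > 0" and ab: "\<And>s t :: real. 0 \<le> s \<Longrightarrow> 0 \<le> t \<Longrightarrow> c * (s + t) \<le> norm (a\<^sup>2 * s - b\<^sup>2 * t)"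
begin

lemma ab_nonzero: "a \<noteq> 0" "b \<noteq> 0"
  using ab[of 1 0] ab[of 0 1] c by auto

lemma norm_square_4: "(norm y)\<^sup>2 = ((y$0)\<^sup>2 + (y$3)\<^sup>2) + ((y$1)\<^sup>2 + (y$2)\<^sup>2)" for y :: "real^4"
  unfolding power2_norm_eq_inner inner_vec_def sum_4_zero by (simp add: power2_eq_square)

lemma twist_norm_bound: "c * (norm y)\<^sup>2 \<le> norm (twist_norm a b y)"
  using ab[of "(y$0)\<^sup>2 + (y$3)\<^sup>2" "(y$1)\<^sup>2 + (y$2)\<^sup>2"] by (simp add: norm_square_4 twist_norm_def)

lemma twist_norm_nonzero: "y \<noteq> 0 \<Longrightarrow> twist_norm a b y \<noteq> 0"
  using twist_norm_bound[of y] c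
  by (metis mult_pos_pos norm_zero not_le zero_less_norm_iff zero_less_power)

text \<open>The diagonal entry of the cut-off kernel as a function of the squared radii \<open>s\<close> and
  \<open>t\<close> in the two planes.\<close>

definition shell :: "real \<Rightarrow> real \<Rightarrow> real \<Rightarrow> complex"
  where "shell r s t = of_real (2 * bump_slope r (s + t) * (s + t)) * (a\<^sup>2 * b\<^sup>2) * inverse (a\<^sup>2 * s - b\<^sup>2 * t) ^ 2"

lemma shell_bound:
  assumes r: "r > 0" and "0 \<le> s" "0 \<le> t"
  shows "norm (shell r s t) \<le> indicator {..4 * r\<^sup>2} (s + t) * (32 / 3 * norm (a\<^sup>2 * b\<^sup>2) * (1 / (c * r\<^sup>2)) ^ 2)"
proof (cases "s + t \<le> r\<^sup>2 \<or> 4 * r\<^sup>2 \<le> s + t")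
  case True
  have "0 \<le> 32 / 3 * norm (a\<^sup>2 * b\<^sup>2) * (1 / (c * r\<^sup>2)) ^ 2" by simp
  moreover have "shell r s t = 0" by (simp add: shell_def bump_slope_zero[OF r True])
  ultimately show ?thesis by (simp add: indicator_def)
next
  case False
  have "\<bar>2 * bump_slope r (s + t) * (s + t)\<bar> \<le> 2 * (4 / 3 / r\<^sup>2) * (4 * r\<^sup>2)"
    unfolding abs_mult using False assms by (intro mult_mono bump_slope_bound) auto
  then have 1: "norm (complex_of_real (2 * bump_slope r (s + t) * (s + t))) \<le> 32 / 3"
    using r by (simp only: norm_of_real) simp
  have "c * r\<^sup>2 \<le> c * (s + t)" using c False by simp
  also have "\<dots> \<le> norm (a\<^sup>2 * s - b\<^sup>2 * t)" by (rule ab) fact+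
  finally have "norm (inverse (a\<^sup>2 * s - b\<^sup>2 * t)) \<le> 1 / (c * r\<^sup>2)"
    using le_imp_inverse_le[of "c * r\<^sup>2" "norm (a\<^sup>2 * s - b\<^sup>2 * t)"] c r
    by (simp add: norm_divide inverse_eq_divide)
  then have 2: "norm (inverse (a\<^sup>2 * s - b\<^sup>2 * t)) ^ 2 \<le> (1 / (c * r\<^sup>2)) ^ 2"
    by (rule power_mono) simp
  have "norm (shell r s t) = norm (complex_of_real (2 * bump_slope r (s + t) * (s + t))) * norm (a\<^sup>2 * b\<^sup>2)
      * norm (inverse (a\<^sup>2 * s - b\<^sup>2 * t)) ^ 2"
    by (simp only: shell_def norm_mult norm_power)
  also have "\<dots> \<le> 32 / 3 * norm (a\<^sup>2 * b\<^sup>2) * (1 / (c * r\<^sup>2)) ^ 2"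
    by (intro mult_mono 1 2) auto
  finally show ?thesis using False by simp
qed

lemma shell_measurable [measurable]: "(\<lambda>(s, t). shell r s t) \<in> borel_measurable (borel \<Otimes>\<^sub>M borel)"
  unfolding shell_def[abs_def] by measurable

text \<open>With $L(s) = a^2 s - b^2 (\rho - s)$ an antiderivative of $L^{-2}$ is
  $- s / (b^2 \rho L(s))$, and $L(\rho) = a^2 \rho$.\<close>

lemma segment_integral:
  assumes \<rho>: "\<rho> > 0"
  shows "(\<integral>s. indicator {0..\<rho>} s *\<^sub>R (inverse (a\<^sup>2 * s - b\<^sup>2 * complex_of_real (\<rho> - s)) ^ 2) \<partial>lborel) = - 1 / (a\<^sup>2 * b\<^sup>2 * \<rho>)"
proof -
  let ?L = "\<lambda>s::real. a\<^sup>2 * s - b\<^sup>2 * complex_of_real (\<rho> - s)"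
  have nz: "?L s \<noteq> 0" if "s \<in> {0..\<rho>}" for s
  proof -
    have "0 < c * (s + (\<rho> - s))" using c \<rho> by simp
    also have "\<dots> \<le> norm (?L s)" by (rule ab) (use that in auto)
    finally show ?thesis by auto
  qed
  have nzb: "b\<^sup>2 * complex_of_real \<rho> \<noteq> 0" using ab_nonzero \<rho> by simp
  let ?\<Phi> = "\<lambda>s::real. - of_real s / (b\<^sup>2 * complex_of_real \<rho> * ?L s)"
  have "(\<integral>s. indicator {0..\<rho>} s *\<^sub>R (inverse (?L s) ^ 2) \<partial>lborel) = ?\<Phi> \<rho> - ?\<Phi> 0"
  proof (rule integral_FTC_Icc)
    show "0 \<le> \<rho>" using \<rho> by simp
    show "continuous_on {0..\<rho>} (\<lambda>s. inverse (?L s) ^ 2)"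
      by (intro continuous_intros) (use nz in auto)
    fix s assume s: "0 \<le> s" "s \<le> \<rho>"
    let ?\<Psi> = "\<lambda>z::complex. - z / (b\<^sup>2 * complex_of_real \<rho> * (a\<^sup>2 * z - b\<^sup>2 * (\<rho> - z)))"
    have nzs: "a\<^sup>2 * s - b\<^sup>2 * (complex_of_real \<rho> - of_real s) \<noteq> 0" using nz[of s] s by simp
    define k L where "k = b\<^sup>2 * complex_of_real \<rho>"
      and "L = a\<^sup>2 * s - b\<^sup>2 * (complex_of_real \<rho> - of_real s)"
    have kL: "k \<noteq> 0" "L \<noteq> 0" using nzs nzb by (simp_all add: k_def L_def)
    have "((\<lambda>z. k * (a\<^sup>2 * z - b\<^sup>2 * (complex_of_real \<rho> - z))) has_field_derivative k * (a\<^sup>2 + b\<^sup>2)) (at (of_real s))"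
      by (auto intro!: derivative_eq_intros)
    from DERIV_divide[OF DERIV_minus[OF DERIV_ident] this] kL
    have "(?\<Psi> has_field_derivative (- 1 * (k * L) - (- of_real s) * (k * (a\<^sup>2 + b\<^sup>2))) / ((k * L) * (k * L))) (at (of_real s))"
      unfolding k_def[symmetric] L_def[symmetric] by simp
    moreover have "- 1 * (k * L) - (- of_real s) * (k * (a\<^sup>2 + b\<^sup>2)) = k * k"
      by (simp add: k_def L_def algebra_simps)
    moreover have "(k * k) / ((k * L) * (k * L)) = inverse L ^ 2"
      using kL by (simp add: divide_simps power2_eq_square)
    ultimately have "(?\<Psi> has_field_derivative (inverse (a\<^sup>2 * s - b\<^sup>2 * (complex_of_real \<rho> - of_real s)) ^ 2)) (at (of_real s))"
      by (simp only: L_def)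
    then have "((\<lambda>s. ?\<Psi> (of_real s)) has_vector_derivative (inverse (?L s) ^ 2)) (at s within {0..\<rho>})"
      by (auto dest!: has_vector_derivative_real_field intro: has_vector_derivative_at_within)
    then show "(?\<Phi> has_vector_derivative (inverse (?L s) ^ 2)) (at s within {0..\<rho>})"
      by simp
  qed
  also have "\<dots> = - 1 / (a\<^sup>2 * b\<^sup>2 * \<rho>)"
    using \<rho> ab_nonzero by (simp add: field_simps)
  finally show ?thesis .
qed

text \<open>In the variables \<open>s\<close> and \<open>\<rho> = s + t\<close> the inner integral over \<open>0 \<le> s \<le> \<rho>\<close> is
  $-1/(a^2 b^2 \rho)$ and cancels all dependence on \<open>a\<close> and \<open>b\<close>; what remains is \<open>- 2 \<pi>\<^sup>2\<close> times
  the total change \<open>- 1\<close> of the profile.\<close>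

lemma shell_quadrant_integral:
  assumes r: "r > 0"
  shows "(\<integral>s. (pi * indicator {0..} s) *\<^sub>R (\<integral>t. (pi * indicator {0..} t) *\<^sub>R shell r s t \<partial>lborel) \<partial>lborel) = of_real (2 * pi\<^sup>2)"
proof -
  define H where "H = (\<lambda>s \<rho>. (pi\<^sup>2 * indicator {0..\<rho>} s) *\<^sub>R shell r s (\<rho> - s))"
  have [measurable]: "(\<lambda>(s, \<rho>). H s \<rho>) \<in> borel_measurable (borel \<Otimes>\<^sub>M borel)"
  proof -
    have "(\<lambda>(s, \<rho>). H s \<rho>) = (\<lambda>p. (pi\<^sup>2 * (if 0 \<le> fst p \<and> fst p \<le> snd p then 1 else 0)) *\<^sub>R shell r (fst p) (snd p - fst p))"
      by (auto simp: H_def fun_eq_iff indicator_def)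
    then show ?thesis unfolding shell_def by simp
  qed
  let ?B = "32 / 3 * norm (a\<^sup>2 * b\<^sup>2) * (1 / (c * r\<^sup>2)) ^ 2"
  have "(\<integral>s. (pi * indicator {0..} s) *\<^sub>R (\<integral>t. (pi * indicator {0..} t) *\<^sub>R shell r s t \<partial>lborel) \<partial>lborel)
      = (\<integral>s. (\<integral>\<rho>. H s \<rho> \<partial>lborel) \<partial>lborel)"
  proof (rule Bochner_Integration.integral_cong[OF refl])
    fix s :: real
    have "(\<integral>t. (pi * indicator {0..} t) *\<^sub>R shell r s t \<partial>lborel)
        = (\<integral>\<rho>. (pi * indicator {0..} (\<rho> - s)) *\<^sub>R shell r s (\<rho> - s) \<partial>lborel)"
      using lborel_integral_real_affine[of 1 "\<lambda>t. (pi * indicator {0..} t) *\<^sub>R shell r s t" "- s"] by simp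
    then have "(pi * indicator {0..} s) *\<^sub>R (\<integral>t. (pi * indicator {0..} t) *\<^sub>R shell r s t \<partial>lborel)
        = (\<integral>\<rho>. (pi * indicator {0..} s) *\<^sub>R ((pi * indicator {0..} (\<rho> - s)) *\<^sub>R shell r s (\<rho> - s)) \<partial>lborel)"
      by (simp only: scaleR_conv_of_real integral_mult_right_zero)
    also have "\<dots> = (\<integral>\<rho>. H s \<rho> \<partial>lborel)"
      by (rule Bochner_Integration.integral_cong[OF refl]) (auto simp: H_def indicator_def power2_eq_square)
    finally show "(pi * indicator {0..} s) *\<^sub>R (\<integral>t. (pi * indicator {0..} t) *\<^sub>R shell r s t \<partial>lborel) = (\<integral>\<rho>. H s \<rho> \<partial>lborel)" .
  qed
  also have "\<dots> = (\<integral>\<rho>. (\<integral>s. H s \<rho> \<partial>lborel) \<partial>lborel)"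
  proof (rule lborel_pair.Fubini_integral[symmetric])
    have "integrable lborel (\<lambda>p. indicator (cbox (0, 0) (4 * r\<^sup>2, 4 * r\<^sup>2)) p *\<^sub>R (pi\<^sup>2 * ?B) :: real)"
      by (intro integrable_real_mult_indicator integrable_scaleR_left) (auto simp: emeasure_lborel_cbox_eq)
    then show "integrable (lborel \<Otimes>\<^sub>M lborel) (case_prod H)"
      unfolding lborel_prod
    proof (rule Bochner_Integration.integrable_bound)
      show "case_prod H \<in> borel_measurable lborel"
        using \<open>(\<lambda>(s, \<rho>). H s \<rho>) \<in> borel_measurable (borel \<Otimes>\<^sub>M borel)\<close> by (simp add: borel_prod)
      have bnd: "norm (H s \<rho>) \<le> norm (indicator (cbox (0, 0) (4 * r\<^sup>2, 4 * r\<^sup>2)) (s, \<rho>) *\<^sub>R (pi\<^sup>2 * ?B))" for s \<rho>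
      proof (cases "0 \<le> s \<and> s \<le> \<rho> \<and> \<rho> \<le> 4 * r\<^sup>2")
        case True
        then have "norm (shell r s (\<rho> - s)) \<le> ?B"
          using shell_bound[OF r, of s "\<rho> - s"] by simp
        then have "norm (H s \<rho>) \<le> pi\<^sup>2 * ?B"
          using True by (simp add: H_def)
        moreover have "(s, \<rho>) \<in> cbox (0, 0) (4 * r\<^sup>2, 4 * r\<^sup>2)"
          using True by (simp add: cbox_Pair_eq)
        ultimately show ?thesis by simp
      next
        case False
        then have "H s \<rho> = 0"
          using bump_slope_zero[OF r, of \<rho>] by (auto simp: H_def shell_def indicator_def)
        then show ?thesis by simp
      qed
      show "AE p in lborel. norm (case_prod H p) \<le> norm (indicator (cbox (0, 0) (4 * r\<^sup>2, 4 * r\<^sup>2)) p *\<^sub>R (pi\<^sup>2 * ?B))"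
      proof (rule AE_I2)
        fix p :: "real \<times> real"
        show "norm (case_prod H p) \<le> norm (indicator (cbox (0, 0) (4 * r\<^sup>2, 4 * r\<^sup>2)) p *\<^sub>R (pi\<^sup>2 * ?B))"
          using bnd[of "fst p" "snd p"] by (simp only: case_prod_unfold prod.collapse)
      qed
    qed
  qed
  also have "\<dots> = (\<integral>\<rho>. (- 2 * pi\<^sup>2) * complex_of_real (bump_slope r \<rho>) \<partial>lborel)"
  proof (rule Bochner_Integration.integral_cong[OF refl])
    fix \<rho> :: real
    show "(\<integral>s. H s \<rho> \<partial>lborel) = (- 2 * pi\<^sup>2) * complex_of_real (bump_slope r \<rho>)"
    proof (cases "\<rho> > 0")
      case True
      have "(\<integral>s. H s \<rho> \<partial>lborel) = (\<integral>s. (pi\<^sup>2 * of_real (2 * bump_slope r \<rho> * \<rho>) * (a\<^sup>2 * b\<^sup>2)) *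
          (indicator {0..\<rho>} s *\<^sub>R (inverse (a\<^sup>2 * s - b\<^sup>2 * complex_of_real (\<rho> - s)) ^ 2)) \<partial>lborel)"
        by (rule Bochner_Integration.integral_cong[OF refl])
          (simp add: H_def shell_def indicator_def scaleR_conv_of_real[where 'a = complex])
      also have "\<dots> = (pi\<^sup>2 * of_real (2 * bump_slope r \<rho> * \<rho>) * (a\<^sup>2 * b\<^sup>2)) * (- 1 / (a\<^sup>2 * b\<^sup>2 * \<rho>))"
        by (simp only: integral_mult_right_zero segment_integral[OF True])
      also have "\<dots> = (- 2 * pi\<^sup>2) * complex_of_real (bump_slope r \<rho>)"
        using True ab_nonzero by (simp add: field_simps)
      finally show ?thesis .
    next
      case False
      then have "bump_slope r \<rho> = 0" using zero_le_power2[of r] by (intro bump_slope_zero[OF r]) linarith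
      then have "H s \<rho> = 0" for s by (simp add: H_def shell_def)
      then show ?thesis using \<open>bump_slope r \<rho> = 0\<close> by simp
    qed
  qed
  also have "\<dots> = of_real (2 * pi\<^sup>2)"
    by (simp only: integral_mult_right_zero integral_bump_slope[OF r]) simp
  finally show ?thesis .
qed

end

section \<open>The cut-off kernel\<close>

lemma norm_le_sum_entries: "norm A \<le> (\<Sum>i\<in>UNIV. \<Sum>j\<in>UNIV. norm (A $ i $ j))" for A :: HC
proof -
  have "norm A \<le> (\<Sum>i\<in>UNIV. norm (A $ i))"
    unfolding norm_vec_def[of A] by (rule L2_set_le_sum) simp
  also have "\<dots> \<le> (\<Sum>i\<in>UNIV. \<Sum>j\<in>UNIV. norm (A $ i $ j))"
    unfolding norm_vec_def[where 'b = 2] by (intro sum_mono L2_set_le_sum) simp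
  finally show ?thesis .
qed

context twisted
begin

text \<open>Up to the sign and a right factor \<open>f\<^sup>C\<close>, the divergence that cutting off by
  \<open>1 - bump\<close> produces; see \<open>cut_field_divergence\<close>.\<close>

definition cutoff_kernel :: "real \<Rightarrow> real^4 \<Rightarrow> HC"
  where "cutoff_kernel r y = (\<Sum>k\<in>UNIV. dderiv (axis k 1) (bump 0 r) y *\<^sub>R (kern a b y ** coef a b k))"

lemma cutoff_kernel_eq:
  "cutoff_kernel r y = of_real (2 * bump_slope r ((norm y)\<^sup>2)) *\<^sub>c (a * b * inverse (twist_norm a b y) ^ 2) *\<^sub>c
    vector [vector [a * b * (norm y)\<^sup>2, - (a\<^sup>2 + b\<^sup>2) * ((y$0 + \<i> * y$3) * (y$1 + \<i> * y$2))],
            vector [- (a\<^sup>2 + b\<^sup>2) * ((y$0 - \<i> * y$3) * (y$1 - \<i> * y$2)), a * b * (norm y)\<^sup>2]]"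
proof -
  have "cutoff_kernel r y = of_real (2 * bump_slope r ((norm y)\<^sup>2)) *\<^sub>c (\<Sum>k\<in>UNIV. y$k *\<^sub>R (kern a b y ** coef a b k))"
    unfolding cutoff_kernel_def dderiv_bump_axis sum_4_zero
    by (rule HC_eqI) (simp_all add: scaleR_conv_of_real[where 'a = complex] algebra_simps)
  then show ?thesis unfolding kern_moment .
qed

lemma cutoff_kernel_zero:
  assumes "r > 0" "norm y < r \<or> 2 * r \<le> norm y"
  shows "cutoff_kernel r y = 0"
proof -
  have "dderiv v (bump 0 r) y = 0" for v
    by (rule dderiv_bump_zero) (use assms in auto)
  then show ?thesis by (simp add: cutoff_kernel_def)
qed

lemma cutoff_kernel_continuous:
  assumes "0 \<notin> S"
  shows "continuous_on S (cutoff_kernel r)"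
proof -
  have 1: "continuous_on S (kern a b)"
  proof (rule C1_on_continuous[OF C1_on_kern])
    show "twist_norm a b y \<noteq> 0" if "y \<in> S" for y
      by (rule twist_norm_nonzero) (use assms that in auto)
  qed
  have 2: "continuous_on S (\<lambda>y. dderiv v (bump 0 r) y)" for v :: "real^4"
    using C1_on_continuous_dderiv[OF C1_on_bump] .
  show ?thesis
    unfolding cutoff_kernel_def[abs_def]
    by (intro continuous_on_sum continuous_on_scaleR 2
        bounded_bilinear.continuous_on[OF bounded_bilinear_matrix_product 1 continuous_on_const])
qed

lemma cutoff_kernel_integrable:
  assumes r: "r > 0"
  shows "integrable lborel (cutoff_kernel r)"
proof (rule integrable_compact_support)
  show "compact (cball 0 (2 * r) - ball 0 r :: (real^4) set)" by (intro compact_diff compact_cball open_ball)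
  show "continuous_on (cball 0 (2 * r) - ball 0 r) (cutoff_kernel r)"
    by (rule cutoff_kernel_continuous) (use r in auto)
  show "cutoff_kernel r y = 0" if "y \<notin> cball 0 (2 * r) - ball 0 r" for y
    by (rule cutoff_kernel_zero[OF r]) (use that in auto)
qed

lemma cutoff_kernel_entry_integrable:
  assumes r: "r > 0"
  shows "integrable lborel (\<lambda>y. cutoff_kernel r y $ i $ j)"
  by (rule integrable_bounded_linear[OF bounded_linear_compose[OF bounded_linear_vec_nth bounded_linear_vec_nth]
        cutoff_kernel_integrable[OF r]])

lemma cutoff_kernel_diagonal:
  assumes r: "r > 0" and f: "f = (\<lambda>y. of_real (2 * bump_slope r ((norm y)\<^sup>2)) * ((a * b * inverse (twist_norm a b y) ^ 2) * (a * b * (norm y)\<^sup>2)))"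
    and i: "integrable lborel f"
  shows "integral\<^sup>L lborel f = of_real (2 * pi\<^sup>2)"
proof -
  have f_planes: "f (planes z w) = shell r ((norm z)\<^sup>2) ((norm w)\<^sup>2)" for z w
  proof -
    have 1: "(norm (planes z w))\<^sup>2 = (norm z)\<^sup>2 + (norm w)\<^sup>2"
      by (simp add: norm_square_4 planes_nth cmod_power2 add_ac)
    have 2: "twist_norm a b (planes z w) = a\<^sup>2 * of_real ((norm z)\<^sup>2) - b\<^sup>2 * of_real ((norm w)\<^sup>2)"
      by (simp add: twist_norm_def planes_nth cmod_power2)
    show ?thesis
      unfolding f shell_def 1 2 by (simp add: power2_eq_square algebra_simps)
  qed
  have m: "(\<lambda>t. shell r s t) \<in> borel_measurable borel" for s
    using shell_measurable[of r] by measurable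
  have "integral\<^sup>L lborel f = (\<integral>z. (\<integral>w. f (planes z w) \<partial>lborel) \<partial>lborel)"
    by (rule integral_planes[OF i])
  also have "\<dots> = (\<integral>z. (\<integral>t. (pi * indicator {0..} t) *\<^sub>R shell r ((norm (z::complex))\<^sup>2) t \<partial>lborel) \<partial>lborel)"
    unfolding f_planes by (subst integral_radial_plane[OF m]) simp
  also have "\<dots> = (\<integral>s. (pi * indicator {0..} s) *\<^sub>R (\<integral>t. (pi * indicator {0..} t) *\<^sub>R shell r s t \<partial>lborel) \<partial>lborel)"
    by (rule integral_radial_plane) measurable
  also have "\<dots> = of_real (2 * pi\<^sup>2)"
    by (rule shell_quadrant_integral[OF r])
  finally show ?thesis .
qed

lemma integral_zero_odd_planes:
  fixes f :: "real^4 \<Rightarrow> complex"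
  assumes i: "integrable lborel f" and odd: "\<And>z w. f (planes z (- w)) = - f (planes z w)"
  shows "integral\<^sup>L lborel f = 0"
proof -
  have [measurable]: "f \<in> borel_measurable borel" using i by auto
  have "(\<lambda>w. planes z w) \<in> borel_measurable borel" for z
    using measurable_compose[OF measurable_Pair1' planes_measurable, of z] by simp
  then have m: "(\<lambda>w. f (planes z w)) \<in> borel_measurable borel" for z by measurable
  have "(\<integral>w. f (planes z w) \<partial>lborel) = 0" for z
    by (rule integral_odd[OF m odd])
  then show ?thesis using integral_planes[OF i] by simp
qed

text \<open>The value does not depend on the radius, nor on the twist: it is the area
  $2 \pi^2$ of the unit sphere in four dimensions.\<close>

lemma cutoff_kernel_integral:
  assumes r: "r > 0"
  shows "integral\<^sup>L lborel (cutoff_kernel r) = (2 * pi\<^sup>2) *\<^sub>R mat 1"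
proof -
  have e: "integral\<^sup>L lborel (cutoff_kernel r) $ i $ j = integral\<^sup>L lborel (\<lambda>y. cutoff_kernel r y $ i $ j)" for i j
    by (rule integral_bounded_linear[OF bounded_linear_compose[OF bounded_linear_vec_nth bounded_linear_vec_nth]
        cutoff_kernel_integrable[OF r], symmetric])
  note int = cutoff_kernel_entry_integrable[OF r]
  have diag: "integral\<^sup>L lborel (\<lambda>y. cutoff_kernel r y $ 1 $ 1) = of_real (2 * pi\<^sup>2)"
    "integral\<^sup>L lborel (\<lambda>y. cutoff_kernel r y $ 2 $ 2) = of_real (2 * pi\<^sup>2)"
    by (rule cutoff_kernel_diagonal[OF r _ int]; simp add: cutoff_kernel_eq fun_eq_iff)+
  have n: "norm (planes z (- w)) = norm (planes z w)" "twist_norm a b (planes z (- w)) = twist_norm a b (planes z w)" for z w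
    by (simp_all add: norm_eq_sqrt_inner inner_vec_def sum_4_zero planes_nth twist_norm_def)
  have off: "integral\<^sup>L lborel (\<lambda>y. cutoff_kernel r y $ 1 $ 2) = 0" "integral\<^sup>L lborel (\<lambda>y. cutoff_kernel r y $ 2 $ 1) = 0"
    by (rule integral_zero_odd_planes[OF int]; simp only: cutoff_kernel_eq n planes_nth cscale_nth vector_2; simp add: algebra_simps)+
  show ?thesis
    by (rule HC_eqI) (simp_all add: e diag off mat_def scaleR_conv_of_real[where 'a = complex])
qed

text \<open>The bump contributes the factor \<open>1 / r ^ 2\<close> and the moment of the kernel at most a
  multiple of \<open>1 / (norm y) ^ 2\<close>, where \<open>norm y \<ge> r\<close> on the support.\<close>

lemma cutoff_kernel_bound:
  obtains C where "C > 0" "\<And>r y. r > 0 \<Longrightarrow> norm (cutoff_kernel r y) \<le> C / r ^ 4"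
proof -
  define C where "C = 4 * (8 / 3 * (norm (a * b) / c\<^sup>2 * (norm (a * b) + norm (a\<^sup>2 + b\<^sup>2))))"
  have C0: "C > 0"
    using ab_nonzero c by (auto simp: C_def intro!: mult_pos_pos divide_pos_pos add_pos_nonneg)
  show ?thesis
  proof (rule that[OF C0])
    fix r :: real and y :: "real^4" assume r: "r > 0"
    show "norm (cutoff_kernel r y) \<le> C / r ^ 4"
    proof (cases "norm y < r")
      case True
      then show ?thesis using cutoff_kernel_zero[OF r] C0 r by simp
    next
      case False
      then have y: "r \<le> norm y" by simp
      have ny: "0 < norm y" using r y by linarith
      have nN: "0 < c * (norm y)\<^sup>2" using c ny by simp
      have i1: "norm (inverse (twist_norm a b y)) \<le> 1 / (c * (norm y)\<^sup>2)"
        using le_imp_inverse_le[OF twist_norm_bound nN] by (simp add: norm_divide inverse_eq_divide)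
      then have i2: "norm (inverse (twist_norm a b y)) ^ 2 \<le> (1 / (c * (norm y)\<^sup>2)) ^ 2"
        by (rule power_mono) simp
      have entry: "norm (cutoff_kernel r y $ i $ j) \<le> 8 / 3 * (norm (a * b) / c\<^sup>2 * (norm (a * b) + norm (a\<^sup>2 + b\<^sup>2))) / r ^ 4" for i j
      proof -
        let ?V = "vector [vector [a * b * (norm y)\<^sup>2, - (a\<^sup>2 + b\<^sup>2) * ((y$0 + \<i> * y$3) * (y$1 + \<i> * y$2))],
            vector [- (a\<^sup>2 + b\<^sup>2) * ((y$0 - \<i> * y$3) * (y$1 - \<i> * y$2)), a * b * (norm y)\<^sup>2]] :: HC"
        have half: "norm (complex_of_real (y$i) + \<i> * complex_of_real (y$j)) \<le> norm y"
          "norm (complex_of_real (y$i) - \<i> * complex_of_real (y$j)) \<le> norm y" if "i \<noteq> j" for i j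
        proof -
          have "(y$i)\<^sup>2 + (y$j)\<^sup>2 = (\<Sum>k\<in>{i, j}. (y$k)\<^sup>2)" using that by simp
          also have "\<dots> \<le> (\<Sum>k\<in>UNIV. (y$k)\<^sup>2)" by (rule sum_mono2) auto
          also have "\<dots> = (norm y)\<^sup>2" unfolding power2_norm_eq_inner inner_vec_def by (simp add: power2_eq_square)
          finally have "sqrt ((y$i)\<^sup>2 + (y$j)\<^sup>2) \<le> norm y" by (simp add: real_le_lsqrt)
          then show "norm (complex_of_real (y$i) + \<i> * complex_of_real (y$j)) \<le> norm y"
            "norm (complex_of_real (y$i) - \<i> * complex_of_real (y$j)) \<le> norm y"
            by (simp_all add: cmod_def)
        qed
        have prods: "norm ((complex_of_real (y$0) + \<i> * y$3) * (y$1 + \<i> * y$2)) \<le> norm y * norm y"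
          "norm ((complex_of_real (y$0) - \<i> * y$3) * (y$1 - \<i> * y$2)) \<le> norm y * norm y"
          unfolding norm_mult by (intro mult_mono half; simp)+
        have V: "norm (?V $ i $ j) \<le> (norm (a * b) + norm (a\<^sup>2 + b\<^sup>2)) * (norm y)\<^sup>2"
        proof -
          have d: "norm (a * b * complex_of_real ((norm y)\<^sup>2)) \<le> (norm (a * b) + norm (a\<^sup>2 + b\<^sup>2)) * (norm y)\<^sup>2"
            unfolding norm_mult[of "a * b"] norm_of_real abs_power2 by (rule mult_right_mono) auto
          have o: "norm (- (a\<^sup>2 + b\<^sup>2) * p) \<le> (norm (a * b) + norm (a\<^sup>2 + b\<^sup>2)) * (norm y)\<^sup>2"
            if "norm p \<le> norm y * norm y" for p
            unfolding norm_mult[of "- (a\<^sup>2 + b\<^sup>2)"] norm_minus_cancel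
            by (intro mult_mono) (use that in \<open>auto simp: power2_eq_square\<close>)
          show ?thesis
            using exhaust_2[of i] exhaust_2[of j] d o[OF prods(1)] o[OF prods(2)] by auto
        qed
        have "norm (cutoff_kernel r y $ i $ j) = \<bar>2 * bump_slope r ((norm y)\<^sup>2)\<bar> *
            (norm (a * b) * norm (inverse (twist_norm a b y)) ^ 2 * norm (?V $ i $ j))"
          unfolding cutoff_kernel_eq cscale_nth norm_mult norm_power norm_of_real by (simp only: mult.assoc)
        also have "\<dots> \<le> (2 * (4 / 3 / r\<^sup>2)) * (norm (a * b) * (1 / (c * (norm y)\<^sup>2)) ^ 2 * ((norm (a * b) + norm (a\<^sup>2 + b\<^sup>2)) * (norm y)\<^sup>2))"
          unfolding abs_mult by (intro mult_mono i2 V bump_slope_bound r) auto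
        also have "\<dots> = (8 / 3 * (norm (a * b) / c\<^sup>2 * (norm (a * b) + norm (a\<^sup>2 + b\<^sup>2))) / r\<^sup>2) * (1 / (norm y)\<^sup>2)"
          using ny c r by (simp add: field_simps eval_nat_numeral)
        also have "\<dots> \<le> (8 / 3 * (norm (a * b) / c\<^sup>2 * (norm (a * b) + norm (a\<^sup>2 + b\<^sup>2))) / r\<^sup>2) * (1 / r\<^sup>2)"
          using y r ny by (intro mult_left_mono divide_left_mono power_mono) auto
        finally show ?thesis by (simp add: eval_nat_numeral mult_ac)
      qed
      have "norm (cutoff_kernel r y) \<le> (\<Sum>i\<in>UNIV. \<Sum>j\<in>UNIV. norm (cutoff_kernel r y $ i $ j))"
        by (rule norm_le_sum_entries)
      also have "\<dots> \<le> (\<Sum>i\<in>(UNIV :: 2 set). \<Sum>j\<in>(UNIV :: 2 set). C / 4 / r ^ 4)"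
        by (intro sum_mono order_trans[OF entry]) (simp add: C_def)
      also have "\<dots> = C / r ^ 4" by simp
      finally show ?thesis .
    qed
  qed
qed

end

section \<open>The integral over the deformed contour\<close>

lemma (in twisted) cutoff_kernel_continuous_everywhere:
  assumes r: "r > 0"
  shows "continuous_on UNIV (cutoff_kernel r)"
proof -
  have "continuous_on (ball 0 r) (cutoff_kernel r)"
    by (rule continuous_on_eq[OF continuous_on_const[of _ 0]]) (use cutoff_kernel_zero[OF r] in auto)
  then have "continuous_on (ball 0 r \<union> - {0}) (cutoff_kernel r)"
    by (rule continuous_on_open_Un[OF open_ball open_Compl[OF closed_singleton] _ cutoff_kernel_continuous]) simp
  moreover have "ball 0 r \<union> - {0} = (UNIV :: (real^4) set)" using r by auto
  ultimately show ?thesis by simp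
qed

lemma matrix_product_sum_left: "(\<Sum>k\<in>I. A k ** B) = (\<Sum>k\<in>I. A k) ** B" for A :: "'k \<Rightarrow> HC" and B :: HC
  using bounded_bilinear.sum_left[OF bounded_bilinear_matrix_product, of A I B] by simp

lemma matrix_product_sum_right: "(\<Sum>k\<in>I. B ** A k) = B ** (\<Sum>k\<in>I. A k)" for A :: "'k \<Rightarrow> HC" and B :: HC
  using bounded_bilinear.sum_right[OF bounded_bilinear_matrix_product, of B A I] by simp

text \<open>The chain rule multiplies the derivatives of \<open>f\<close> by the factors \<open>a, i b, - i b, a\<close>,
  and these complement the factors in \<open>coef\<close> to the common value \<open>a\<^sup>2 b\<^sup>2\<close>.\<close>

lemma left_regular_coef_sum:
  assumes f: "hol_left_regular f V" and Z: "Z \<in> V"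
  shows "(\<Sum>k\<in>UNIV. coef a b k ** dderiv (twist a b (axis k 1)) f Z) = 0"
proof -
  have hol: "holomorphic_HC f V" using f by (simp add: hol_left_regular_def)
  have "(\<Sum>k\<in>UNIV. coef a b k ** dderiv (twist a b (axis k 1)) f Z)
      = (a\<^sup>2 * b\<^sup>2) *\<^sub>c (e0 ** cpartial e0 f Z + e1 ** cpartial e1 f Z + e2 ** cpartial e2 f Z + e3 ** cpartial e3 f Z)"
    unfolding sum_4_zero twist_axis holomorphic_HC_deriv(2)[OF hol Z] cpartial_eq_dderiv[OF hol Z]
    by (rule HC_eqI) (simp_all add: coef_def matrix_product_nth power2_eq_square algebra_simps)
  also have "\<dots> = 0" using f Z by (simp add: hol_left_regular_def vec_eq_iff)
  finally show ?thesis .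
qed

text \<open>Here \<open>W\<close> is the set of points that the deformation sends into the domain of \<open>F\<close>.\<close>

locale deformed_contour = C1_boundary U W m D \<phi> + twisted a b c
  for U W :: "(real^4) set" and m D \<phi> a b c +
  fixes V :: "HC set" and F :: "HC \<Rightarrow> HC" and X0 :: "real^4"
  assumes V: "open V" and F: "hol_left_regular F V"
    and W_eq: "W = {x. hr X0 + twist a b (x - X0) \<in> V}" and X0: "X0 \<notin> frontier U"
begin

definition pulled_back :: "real^4 \<Rightarrow> HC"
  where "pulled_back x = F (hr X0 + twist a b (x - X0))"

text \<open>The components of the vector field whose flux form is the pull-back of the
  integrand; see \<open>contour_integrand\<close>.\<close>

definition field_component :: "4 \<Rightarrow> real^4 \<Rightarrow> HC"
  where "field_component k x = (kern a b (x - X0) ** coef a b k) ** pulled_back x"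

definition cut_field :: "real \<Rightarrow> 4 \<Rightarrow> real^4 \<Rightarrow> HC"
  where "cut_field r k x = (1 - bump X0 r x) *\<^sub>R field_component k x"

lemma F_C1: "C1_on F V"
  using F V by (simp add: hol_left_regular_def holomorphic_HC_imp_C1_on)

lemma pulled_back_C1: "C1_on pulled_back W"
  unfolding pulled_back_def[abs_def]
  by (rule C1_on_affine(1)[OF bounded_linear_twist F_C1]) (simp add: W_eq)

lemma dderiv_pulled_back:
  assumes "x \<in> W"
  shows "dderiv v pulled_back x = dderiv (twist a b v) F (hr X0 + twist a b (x - X0))"
  unfolding pulled_back_def[abs_def]
  by (rule C1_on_affine(2)[OF bounded_linear_twist F_C1 _ assms]) (simp add: W_eq)

lemma kern_shift:
  shows "C1_on (\<lambda>x. kern a b (x - X0)) (- {X0})"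
    and "x \<noteq> X0 \<Longrightarrow> dderiv v (\<lambda>x. kern a b (x - X0)) x = dderiv v (kern a b) (x - X0)"
proof -
  have k: "C1_on (kern a b) (- {0})" by (rule C1_on_kern) (simp add: twist_norm_nonzero)
  have s: "0 + (x - X0) \<in> - {0}" if "x \<in> - {X0}" for x using that by simp
  show "C1_on (\<lambda>x. kern a b (x - X0)) (- {X0})"
    using C1_on_affine(1)[OF bounded_linear_ident k s, of "- {X0}"] by simp
  show "x \<noteq> X0 \<Longrightarrow> dderiv v (\<lambda>x. kern a b (x - X0)) x = dderiv v (kern a b) (x - X0)"
    using C1_on_affine(2)[OF bounded_linear_ident k s, of "- {X0}" x v] by simp
qed

lemma right_product_linear: "bounded_linear (\<lambda>A :: HC. A ** B)" for B :: HC
  by (rule bounded_bilinear.bounded_linear_left[OF bounded_bilinear_matrix_product])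

lemma field_component_C1: "C1_on (field_component k) (W - {X0})"
  unfolding field_component_def[abs_def]
  by (rule C1_on_bilinear[OF bounded_bilinear_matrix_product C1_on_linear[OF right_product_linear]])
    (rule C1_on_subset[OF kern_shift(1)] C1_on_subset[OF pulled_back_C1]; auto)+

text \<open>The product rule splits the divergence into left-regularity of \<open>F\<close> and
  right-regularity of the kernel.\<close>

lemma field_divergence_free:
  assumes x: "x \<in> W - {X0}"
  shows "(\<Sum>k\<in>UNIV. dderiv (axis k 1) (field_component k) x) = 0"
proof -
  let ?k = "\<lambda>x. kern a b (x - X0)"
  have kd: "?k differentiable (at x)" by (rule C1_on_differentiable[OF kern_shift(1)]) (use x in simp)
  have gd: "pulled_back differentiable (at x)" by (rule C1_on_differentiable[OF pulled_back_C1]) (use x in simp)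
  have kcd: "(\<lambda>x. ?k x ** coef a b k) differentiable (at x)" for k
    by (rule C1_on_differentiable[OF C1_on_linear[OF right_product_linear kern_shift(1)]]) (use x in simp)
  have "dderiv (axis k 1) (field_component k) x
      = (?k x ** coef a b k) ** dderiv (axis k 1) pulled_back x
        + (dderiv (axis k 1) (kern a b) (x - X0) ** coef a b k) ** pulled_back x" for k
    unfolding field_component_def[abs_def]
      dderiv_bilinear(2)[OF bounded_bilinear_matrix_product kcd gd] dderiv_linear[OF right_product_linear kd]
    using x by (simp add: kern_shift(2))
  then have "(\<Sum>k\<in>UNIV. dderiv (axis k 1) (field_component k) x)
      = ?k x ** (\<Sum>k\<in>UNIV. coef a b k ** dderiv (axis k 1) pulled_back x)
        + (\<Sum>k\<in>UNIV. dderiv (axis k 1) (kern a b) (x - X0) ** coef a b k) ** pulled_back x"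
    unfolding matrix_product_sum_right[symmetric] matrix_product_sum_left[symmetric]
    by (simp only: sum.distrib matrix_mul_assoc)
  moreover have "(\<Sum>k\<in>UNIV. coef a b k ** dderiv (axis k 1) pulled_back x) = 0"
    using left_regular_coef_sum[OF F] x by (simp add: dderiv_pulled_back W_eq)
  moreover have "(\<Sum>k\<in>UNIV. dderiv (axis k 1) (kern a b) (x - X0) ** coef a b k) = 0"
    by (rule kern_regular[OF twist_norm_nonzero]) (use x in simp)
  ultimately show ?thesis by (simp add: matrix_product_zero)
qed

lemma cut_field_zero: "r > 0 \<Longrightarrow> x \<in> ball X0 r \<Longrightarrow> cut_field r k x = 0"
  by (simp add: cut_field_def bump_one)

lemma cut_field_C1:
  assumes r: "r > 0"
  shows "C1_on (cut_field r k) W"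
proof -
  have 1: "C1_on (cut_field r k) (W - {X0})"
    unfolding cut_field_def[abs_def]
    by (intro C1_on_scaleR C1_on_one_minus C1_on_bump field_component_C1)
  have 2: "C1_on (cut_field r k) (ball X0 r)"
    by (rule C1_on_cong[OF C1_on_const[of 0] open_ball]) (simp add: cut_field_zero[OF r])
  have "C1_on (cut_field r k) ((W - {X0}) \<union> ball X0 r)"
    using W_open by (intro C1_on_union 1 2) auto
  then show ?thesis by (rule C1_on_subset) (use r in auto)
qed

lemma cut_field_divergence:
  assumes r: "r > 0" and x: "x \<in> W"
  shows "(\<Sum>k\<in>UNIV. dderiv (axis k 1) (cut_field r k) x) = - (cutoff_kernel r (x - X0) ** pulled_back x)"
proof (cases "x = X0")
  case True
  have "dderiv v (cut_field r k) x = dderiv v (\<lambda>x. 0) x" for v k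
    by (rule dderiv_cong[OF open_ball[of X0 r]]) (use True r in \<open>auto simp: cut_field_zero\<close>)
  then have "dderiv v (cut_field r k) x = 0" for v k by simp
  moreover have "cutoff_kernel r (x - X0) = 0" by (rule cutoff_kernel_zero[OF r]) (use True r in simp)
  ultimately show ?thesis by (simp add: matrix_product_zero)
next
  case False
  then have xW: "x \<in> W - {X0}" using x by simp
  have bd: "bump X0 r differentiable (at x)" by (rule C1_on_differentiable[OF C1_on_bump[of X0 r UNIV]]) simp
  have bd': "(\<lambda>x. 1 - bump X0 r x) differentiable (at x)"
    by (rule C1_on_differentiable[OF C1_on_one_minus[OF C1_on_bump[of X0 r UNIV]]]) simp
  have fd: "field_component k differentiable (at x)" for k by (rule C1_on_differentiable[OF field_component_C1 xW])
  have "dderiv (axis k 1) (cut_field r k) x = (1 - bump X0 r x) *\<^sub>R dderiv (axis k 1) (field_component k) x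
      - (dderiv (axis k 1) (bump 0 r) (x - X0) *\<^sub>R (kern a b (x - X0) ** coef a b k)) ** pulled_back x" for k
    unfolding cut_field_def[abs_def] dderiv_bilinear(2)[OF bounded_bilinear_scaleR bd' fd] dderiv_one_minus[OF bd]
    by (simp add: field_component_def dderiv_bump matrix_product_scaleR)
  then have "(\<Sum>k\<in>UNIV. dderiv (axis k 1) (cut_field r k) x)
      = (1 - bump X0 r x) *\<^sub>R (\<Sum>k\<in>UNIV. dderiv (axis k 1) (field_component k) x)
        - cutoff_kernel r (x - X0) ** pulled_back x"
    by (simp add: sum_subtractf scaleR_sum_right cutoff_kernel_def matrix_product_sum_left)
  then show ?thesis by (simp add: field_divergence_free[OF xW])
qed

lemma kernel_integrand_integrable:
  fixes g :: "real^4 \<Rightarrow> HC"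
  assumes r: "r > 0" and g: "continuous_on (closure U) g"
  shows "(\<lambda>x. cutoff_kernel r (x - X0) ** g x) integrable_on U"
proof (rule set_borel_integral_eq_integral(1), rule set_integrable_compact[OF closure_compact])
  have "continuous_on (closure U) (\<lambda>x. cutoff_kernel r (x - X0))"
    by (rule continuous_on_compose2[OF cutoff_kernel_continuous_everywhere[OF r]]) (auto intro!: continuous_intros)
  from bounded_bilinear.continuous_on[OF bounded_bilinear_matrix_product this g]
  show "continuous_on (closure U) (\<lambda>x. cutoff_kernel r (x - X0) ** g x)" .
qed (use U_open closure_subset in auto)

lemma flux_cut_field:
  assumes r: "r > 0"
  shows "(\<Sum>k\<in>UNIV. flux (axis k 1) (cut_field r k)) = - integral U (\<lambda>x. cutoff_kernel r (x - X0) ** pulled_back x)"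
proof -
  have "(\<Sum>k\<in>UNIV. flux (axis k 1) (cut_field r k)) = (\<Sum>k\<in>UNIV. integral U (dderiv (axis k 1) (cut_field r k)))"
    by (simp add: divergence_theorem[OF cut_field_C1[OF r]])
  also have "\<dots> = integral U (\<lambda>x. \<Sum>k\<in>UNIV. dderiv (axis k 1) (cut_field r k) x)"
    by (rule Henstock_Kurzweil_Integration.integral_sum[symmetric]) (auto intro: dderiv_integrable cut_field_C1 r)
  also have "\<dots> = integral U (\<lambda>x. - (cutoff_kernel r (x - X0) ** pulled_back x))"
    by (rule integral_cong) (use cut_field_divergence[OF r] U_sub_W in blast)
  finally show ?thesis by simp
qed

definition deformed_integral :: HC
  where "deformed_integral = chain_integral m D (\<lambda>i u. hr X0 + twist a b (\<phi> i u - X0)) (cauchy_fueter_form (hr X0) F)"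

lemma contour_integrand:
  assumes i: "i < m" and u: "u \<in> D i"
  defines "\<psi> \<equiv> \<lambda>u. hr X0 + twist a b (\<phi> i u - X0)"
  shows "cauchy_fueter_form (hr X0) F (\<psi> u) (rpartial 1 \<psi> u) (rpartial 2 \<psi> u) (rpartial 3 \<psi> u)
    = (\<Sum>k\<in>UNIV. jac i (axis k 1) u *\<^sub>R field_component k (\<phi> i u))"
proof -
  obtain N where N: "D i \<subseteq> N" "C1_on (\<phi> i) N" using patch_C1[OF i] by blast
  have diff: "\<phi> i differentiable (at u)" by (rule C1_on_differentiable[OF N(2)]) (use N(1) u in blast)
  have d: "(\<psi> has_derivative (\<lambda>v. twist a b (dderiv v (\<phi> i) u))) (at u)"
  proof -
    have "(\<phi> i has_derivative (\<lambda>v. dderiv v (\<phi> i) u)) (at u)"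
      using diff frechet_derivative_works by blast
    from has_derivative_add[OF has_derivative_const bounded_linear.has_derivative[OF bounded_linear_twist
        has_derivative_diff[OF this has_derivative_const]]]
    show ?thesis unfolding \<psi>_def by simp
  qed
  have rp: "rpartial k \<psi> u = twist a b (rpartial k (\<phi> i) u)" for k
    unfolding rpartial_eq_dderiv[OF differentiableI[OF d]] rpartial_eq_dderiv[OF diff]
      frechet_derivative_at[OF d, symmetric] ..
  have "\<phi> i u \<noteq> X0" using patch_frontier[OF i u] X0 by auto
  then have nz: "twist_norm a b (\<phi> i u - X0) \<noteq> 0" by (simp add: twist_norm_nonzero)
  have "cauchy_fueter_form (hr X0) F (\<psi> u) (rpartial 1 \<psi> u) (rpartial 2 \<psi> u) (rpartial 3 \<psi> u)
      = kern a b (\<phi> i u - X0) ** (\<Sum>k\<in>UNIV. jac i (axis k 1) u *\<^sub>R coef a b k) ** pulled_back (\<phi> i u)"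
    unfolding cauchy_fueter_form_def rp Dz_twist jac_def pulled_back_def
    by (simp add: \<psi>_def kern_eq[OF nz])
  also have "\<dots> = (\<Sum>k\<in>UNIV. jac i (axis k 1) u *\<^sub>R field_component k (\<phi> i u))"
    unfolding field_component_def matrix_product_sum_right[symmetric] matrix_product_sum_left[symmetric]
    by (simp add: matrix_product_scaleR)
  finally show ?thesis .
qed

lemma deformed_integral_eq_flux:
  assumes r: "r > 0" "ball X0 (2 * r) \<inter> frontier U = {}"
  shows "deformed_integral = (\<Sum>k\<in>UNIV. flux (axis k 1) (cut_field r k))"
proof -
  have on_frontier: "field_component k x = cut_field r k x" if "x \<in> frontier U" for k x
  proof -
    have "x \<notin> ball X0 (2 * r)" using that r(2) by blast
    then show ?thesis by (simp add: cut_field_def bump_zero[OF r(1)] del: mem_ball)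
  qed
  have "deformed_integral = (\<Sum>i<m. integral (D i) (\<lambda>u. \<Sum>k\<in>UNIV. jac i (axis k 1) u *\<^sub>R cut_field r k (\<phi> i u)))"
    unfolding deformed_integral_def chain_integral_def
  proof (intro sum.cong refl integral_cong)
    fix i u assume "i \<in> {..<m}" and u: "u \<in> D i"
    then have i: "i < m" by simp
    let ?\<psi> = "\<lambda>u. hr X0 + twist a b (\<phi> i u - X0)"
    show "cauchy_fueter_form (hr X0) F (?\<psi> u) (rpartial 1 ?\<psi> u) (rpartial 2 ?\<psi> u) (rpartial 3 ?\<psi> u)
      = (\<Sum>k\<in>UNIV. jac i (axis k 1) u *\<^sub>R cut_field r k (\<phi> i u))"
      using contour_integrand[OF i u] on_frontier[OF patch_frontier[OF i u]] by simp
  qed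
  also have "\<dots> = (\<Sum>i<m. \<Sum>k\<in>UNIV. integral (D i) (\<lambda>u. jac i (axis k 1) u *\<^sub>R cut_field r k (\<phi> i u)))"
    by (intro sum.cong refl Henstock_Kurzweil_Integration.integral_sum flux_integrable C1_on_continuous cut_field_C1 r(1)) auto
  also have "\<dots> = (\<Sum>k\<in>UNIV. flux (axis k 1) (cut_field r k))"
    unfolding flux_def by (rule sum.swap)
  finally show ?thesis .
qed

lemma deformed_integral_outside:
  assumes "X0 \<notin> U"
  shows "deformed_integral = 0"
proof -
  have "X0 \<in> - closure U" using assms X0 U_open by (auto simp: frontier_def interior_open)
  then obtain e where e: "e > 0" "ball X0 e \<subseteq> - closure U"
    using open_contains_ball[of "- closure U"] by auto
  define r where "r = e / 2"
  have r: "r > 0" "ball X0 (2 * r) \<inter> closure U = {}" using e by (auto simp: r_def)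
  have "deformed_integral = - integral U (\<lambda>x. cutoff_kernel r (x - X0) ** pulled_back x)"
    using deformed_integral_eq_flux[OF r(1)] flux_cut_field[OF r(1)] r(2) by (auto simp: frontier_def)
  also have "integral U (\<lambda>x. cutoff_kernel r (x - X0) ** pulled_back x) = integral U (\<lambda>x. 0)"
  proof (rule integral_cong)
    fix x assume "x \<in> U"
    then have "x \<notin> ball X0 (2 * r)" using r(2) closure_subset by blast
    then have "cutoff_kernel r (x - X0) = 0"
      by (intro cutoff_kernel_zero[OF r(1)]) (simp add: dist_norm norm_minus_commute)
    then show "cutoff_kernel r (x - X0) ** pulled_back x = 0"
      by (simp add: matrix_product_zero)
  qed
  finally show ?thesis by simp
qed

lemma cutoff_kernel_mass_in_U:
  assumes r: "r > 0" and sub: "ball X0 (2 * r) \<subseteq> U"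
  shows "integral U (\<lambda>x. cutoff_kernel r (x - X0)) = (2 * pi\<^sup>2) *\<^sub>R mat 1"
proof -
  let ?f = "\<lambda>x. cutoff_kernel r (x - X0)"
  have "integral U ?f = integral UNIV ?f"
  proof (rule integral_eq_on_superset)
    fix x assume "x \<notin> U"
    then have "x \<notin> ball X0 (2 * r)" using sub by blast
    then show "?f x = 0" by (intro cutoff_kernel_zero[OF r]) (simp add: dist_norm norm_minus_commute)
  qed simp
  also have "\<dots> = integral\<^sup>L lborel ?f"
  proof (rule integral_lborel, rule integrable_compact_support[OF compact_cball[of X0 "2 * r"]])
    show "continuous_on (cball X0 (2 * r)) ?f"
      by (rule continuous_on_compose2[OF cutoff_kernel_continuous_everywhere[OF r]]) (auto intro!: continuous_intros)
    show "?f x = 0" if "x \<notin> cball X0 (2 * r)" for x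
      by (rule cutoff_kernel_zero[OF r]) (use that in \<open>simp add: dist_norm norm_minus_commute\<close>)
  qed
  also have "\<dots> = integral\<^sup>L (distr lborel borel ((+) (- X0))) (cutoff_kernel r)"
    using cutoff_kernel_integrable[OF r] by (subst integral_distr) auto
  also have "\<dots> = (2 * pi\<^sup>2) *\<^sub>R mat 1"
    unfolding lborel_distr_plus by (rule cutoff_kernel_integral[OF r])
  finally show ?thesis .
qed

text \<open>Replacing \<open>pulled_back x\<close> by its value at \<open>X0\<close> gives the exact result by the mass of
  the kernel, and the error is at most the oscillation of \<open>pulled_back\<close> on the ball of radius
  \<open>2 r\<close> times a constant that does not depend on \<open>r\<close>.\<close>

lemma deformed_integral_inside:
  assumes "X0 \<in> U"
  shows "deformed_integral = - (2 * pi\<^sup>2) *\<^sub>R F (hr X0)"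
proof -
  obtain r0 where r0: "r0 > 0" "ball X0 r0 \<subseteq> U" using U_open assms open_contains_ball by blast
  obtain K where K: "K > 0" "\<And>(A :: HC) (B :: HC). norm (A ** B) \<le> norm A * norm B * K"
    using bounded_bilinear.pos_bounded[OF bounded_bilinear_matrix_product] by blast
  obtain C where C: "C > 0" "\<And>r y. r > 0 \<Longrightarrow> norm (cutoff_kernel r y) \<le> C / r ^ 4"
    using cutoff_kernel_bound by blast
  let ?g = pulled_back
  have gX0: "?g X0 = F (hr X0)"
    by (simp add: pulled_back_def linear_0[OF bounded_linear.linear[OF bounded_linear_twist]])
  have gc: "continuous_on W ?g" by (rule C1_on_continuous[OF pulled_back_C1])
  have gcU: "continuous_on (closure U) ?g" by (rule continuous_on_subset[OF gc U_W])
  let ?M = "16 * unit_ball_vol 4 * C * K"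
  have bound: "norm (deformed_integral + (2 * pi\<^sup>2) *\<^sub>R ?g X0) \<le> ?M * e" if e: "e > 0" for e
  proof -
    have "isCont ?g X0"
      using gc W_open U_sub_W assms continuous_on_eq_continuous_at by blast
    then obtain d where d: "d > 0" "\<And>x. dist x X0 < d \<Longrightarrow> dist (?g x) (?g X0) < e"
      using e unfolding continuous_at_eps_delta by blast
    define r where "r = min r0 d / 2"
    have r: "r > 0" "2 * r \<le> r0" "2 * r \<le> d" using r0(1) d(1) by (auto simp: r_def)
    have sub: "ball X0 (2 * r) \<subseteq> U" using r0(2) r(2) by (meson subset_ball subset_trans)
    have disj: "ball X0 (2 * r) \<inter> frontier U = {}" using sub frontier_not_U by blast
    let ?k = "\<lambda>x. cutoff_kernel r (x - X0)"
    have int1: "(\<lambda>x. ?k x ** (?g x - ?g X0)) integrable_on U"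
      by (rule kernel_integrand_integrable[OF r(1)]) (intro continuous_intros gcU)
    have int2: "(\<lambda>x. ?k x ** ?g X0) integrable_on U"
      by (rule kernel_integrand_integrable[OF r(1)]) (intro continuous_intros)
    have int3: "?k integrable_on U"
      using kernel_integrand_integrable[OF r(1), of "\<lambda>x. mat 1"] by (simp add: continuous_on_const)
    have "deformed_integral = - integral U (\<lambda>x. ?k x ** ?g x)"
      using deformed_integral_eq_flux[OF r(1) disj] flux_cut_field[OF r(1)] by simp
    also have "integral U (\<lambda>x. ?k x ** ?g x) = integral U (\<lambda>x. ?k x ** (?g x - ?g X0) + ?k x ** ?g X0)"
      by (simp add: bounded_bilinear.diff_right[OF bounded_bilinear_matrix_product])
    also have "\<dots> = integral U (\<lambda>x. ?k x ** (?g x - ?g X0)) + integral U (\<lambda>x. ?k x ** ?g X0)"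
      by (rule Henstock_Kurzweil_Integration.integral_add[OF int1 int2])
    also have "integral U (\<lambda>x. ?k x ** ?g X0) = integral U ?k ** ?g X0"
      using integral_linear[OF int3 right_product_linear[of "?g X0"]] by (simp add: o_def)
    also have "\<dots> = (2 * pi\<^sup>2) *\<^sub>R ?g X0"
      unfolding cutoff_kernel_mass_in_U[OF r(1) sub]
      by (simp add: matrix_product_scaleR)
    finally have "norm (deformed_integral + (2 * pi\<^sup>2) *\<^sub>R ?g X0) = norm (integral U (\<lambda>x. ?k x ** (?g x - ?g X0)))"
      by simp
    also have "\<dots> \<le> integral U (\<lambda>x. indicator (ball X0 (2 * r)) x * (C / r ^ 4 * e * K))"
    proof (rule Henstock_Kurzweil_Integration.integral_norm_bound_integral[OF int1])
      show "(\<lambda>x. indicator (ball X0 (2 * r)) x * (C / r ^ 4 * e * K)) integrable_on U"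
        by (intro integrable_on_mult_left integral_indicator_le_measure(1) U_open) auto
      fix x assume "x \<in> U"
      show "norm (?k x ** (?g x - ?g X0)) \<le> indicator (ball X0 (2 * r)) x * (C / r ^ 4 * e * K)"
      proof (cases "x \<in> ball X0 (2 * r)")
        case True
        have "norm (?k x ** (?g x - ?g X0)) \<le> norm (?k x) * norm (?g x - ?g X0) * K" by (rule K(2))
        also have "\<dots> \<le> C / r ^ 4 * e * K"
          using d(2)[of x] True r C K(1) e
          by (intro mult_right_mono mult_mono) (auto simp: dist_norm norm_minus_commute intro: less_imp_le)
        finally show ?thesis using True by simp
      next
        case False
        then have "?k x = 0" by (intro cutoff_kernel_zero[OF r(1)]) (simp add: dist_norm norm_minus_commute)
        then show ?thesis using False by (simp add: matrix_product_zero)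
      qed
    qed
    also have "\<dots> = integral U (indicator (ball X0 (2 * r))) * (C / r ^ 4 * e * K)"
      by simp
    also have "\<dots> \<le> measure lebesgue (ball X0 (2 * r)) * (C / r ^ 4 * e * K)"
      using C K e r
      by (intro mult_right_mono integral_indicator_le_measure(2) U_open) auto
    also have "\<dots> = ?M * e"
      using r(1) by (simp add: content_ball power_mult_distrib field_simps power4_eq_xxxx)
    finally show ?thesis .
  qed
  have "norm (deformed_integral + (2 * pi\<^sup>2) *\<^sub>R ?g X0) \<le> 0"
  proof (rule field_le_epsilon)
    fix e :: real assume e: "e > 0"
    define M where "M = ?M"
    have M: "M > 0" using C K by (simp add: M_def)
    then have "norm (deformed_integral + (2 * pi\<^sup>2) *\<^sub>R ?g X0) \<le> M * (e / M)"
      unfolding M_def by (intro bound) (use e in simp)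
    then show "norm (deformed_integral + (2 * pi\<^sup>2) *\<^sub>R ?g X0) \<le> 0 + e" using M by simp
  qed
  then show ?thesis by (simp add: gX0 eq_neg_iff_add_eq_0)
qed

end

text \<open>At \<open>\<epsilon> = 0\<close> the deformation is the identity; compactness makes the condition on \<open>\<epsilon>\<close>
  uniform in \<open>x\<close>.\<close>

lemma deformation_stays_in:
  assumes K: "compact K" and V: "open V" and sub: "hr ` K \<subseteq> V"
  shows "\<forall>\<^sub>F \<epsilon> in at (0::real). \<forall>x\<in>K. hdef \<epsilon> (hr X0) (hr x) \<in> V"
proof -
  let ?H = "\<lambda>p :: real \<times> (real^4). hdef (fst p) (hr X0) (hr (snd p))"
  have "linear qminus"
    by (intro linearI HC_eqI) (simp_all add: qminus_def algebra_simps)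
  then have q: "bounded_linear qminus" by (simp add: linear_conv_bounded_linear)
  have h: "bounded_linear hr"
    using bounded_linear_twist[of 1 1] by (simp add: hr_eq_twist[abs_def])
  have "continuous_on UNIV ?H"
    unfolding hdef_def
    by (intro continuous_intros bounded_linear.continuous_on[OF q] bounded_linear.continuous_on[OF h])
  then have op: "open (?H -` V)" by (rule open_vimage[OF V])
  have "{0} \<times> K \<subseteq> ?H -` V"
    using sub by (auto simp: hdef_def cscale_def zero_vec_def[symmetric])
  then obtain e where e: "e > 0" "(\<Union>p\<in>{0} \<times> K. ball p e) \<subseteq> ?H -` V"
    using compact_subset_open_imp_ball_epsilon_subset[OF compact_Times[OF compact_sing K] op] by blast
  have "\<forall>\<^sub>F \<epsilon> in at (0::real). \<epsilon> \<in> ball 0 e"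
    by (rule eventually_at_in_open') (use e in auto)
  then show ?thesis
  proof eventually_elim
    fix \<epsilon> :: real assume \<epsilon>: "\<epsilon> \<in> ball 0 e"
    show "\<forall>x\<in>K. hdef \<epsilon> (hr X0) (hr x) \<in> V"
    proof
      fix x assume "x \<in> K"
      moreover have "(\<epsilon>, x) \<in> ball (0, x) e" using \<epsilon> by (simp add: dist_Pair_Pair)
      ultimately have "(\<epsilon>, x) \<in> ?H -` V" using e(2) by blast
      then show "hdef \<epsilon> (hr X0) (hr x) \<in> V" by simp
    qed
  qed
qed

text \<open>Compare imaginary parts: \<open>a\<^sup>2\<close> and \<open>- b\<^sup>2\<close> both have imaginary part \<open>2 \<epsilon>\<close>.\<close>

lemma twisted_deformation:
  assumes "\<epsilon> \<noteq> (0::real)"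
  shows "twisted (1 + \<i> * \<epsilon>) (1 - \<i> * \<epsilon>) (2 * \<bar>\<epsilon>\<bar>)"
proof
  show "2 * \<bar>\<epsilon>\<bar> > 0" using assms by simp
  fix s t :: real assume st: "0 \<le> s" "0 \<le> t"
  have "Im ((1 + \<i> * \<epsilon>)\<^sup>2 * s - (1 - \<i> * \<epsilon>)\<^sup>2 * t) = 2 * \<epsilon> * (s + t)"
    by (simp add: power2_eq_square algebra_simps)
  then show "2 * \<bar>\<epsilon>\<bar> * (s + t) \<le> norm ((1 + \<i> * \<epsilon>)\<^sup>2 * s - (1 - \<i> * \<epsilon>)\<^sup>2 * t)"
    using abs_Im_le_cmod[of "(1 + \<i> * \<epsilon>)\<^sup>2 * s - (1 - \<i> * \<epsilon>)\<^sup>2 * t"] st by (simp add: abs_mult)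
qed

theorem theorem13:
  fixes U W :: "(real^4) set" and VC :: "HC set"
    and f :: "real^4 \<Rightarrow> HC" and fC :: "HC \<Rightarrow> HC"
    and m :: nat and D :: "nat \<Rightarrow> (real^3) set" and \<phi> :: "nat \<Rightarrow> real^3 \<Rightarrow> real^4"
    and X0 :: "real^4"
  assumes "open U" and "bounded U"
    and "oriented_C1_boundary U m D \<phi>"
    and "open W" and "closure U \<subseteq> W"
    and "C1_on f W"
    and "\<And>x. x \<in> W \<Longrightarrow> nablaR_plus f x = 0"
    and "open VC" and "hr ` closure U \<subseteq> VC"
    and "hol_left_regular fC VC"
    and "\<And>x. x \<in> W \<Longrightarrow> hr x \<in> VC \<Longrightarrow> fC (hr x) = f x"
    and "X0 \<notin> frontier U"
  shows "\<forall>\<^sub>F \<epsilon> in at (0::real).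
      (\<forall>x\<in>frontier U. hdef \<epsilon> (hr X0) (hr x) \<in> VC \<and> qnorm (hdef \<epsilon> (hr X0) (hr x) - hr X0) \<noteq> 0) \<and>
      (- 1 / (2 * pi\<^sup>2)) *\<^sub>R
        chain_integral m D (\<lambda>i u. hdef \<epsilon> (hr X0) (hr (\<phi> i u)))
          (cauchy_fueter_form (hr X0) fC)
      = (if X0 \<in> U then f X0 else 0)"
proof -
  have "compact (closure U)" using \<open>bounded U\<close> by (simp add: compact_closure)
  from deformation_stays_in[OF this \<open>open VC\<close> \<open>hr ` closure U \<subseteq> VC\<close>, of X0]
  have "\<forall>\<^sub>F \<epsilon> in at (0::real). \<forall>x\<in>closure U. hdef \<epsilon> (hr X0) (hr x) \<in> VC" .
  moreover have "\<forall>\<^sub>F \<epsilon> in at (0::real). \<epsilon> \<noteq> 0" by (simp add: eventually_at_filter)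
  ultimately show ?thesis
  proof eventually_elim
    fix \<epsilon> :: real
    assume inV: "\<forall>x\<in>closure U. hdef \<epsilon> (hr X0) (hr x) \<in> VC" and \<epsilon>: "\<epsilon> \<noteq> 0"
    define a b where "a = 1 + \<i> * \<epsilon>" and "b = 1 - \<i> * \<epsilon>"
    define W' where "W' = {x. hr X0 + twist a b (x - X0) \<in> VC}"
    have hdef_eq: "hdef \<epsilon> (hr X0) (hr x) = hr X0 + twist a b (x - X0)" for x
      unfolding a_def b_def by (rule hdef_eq_twist)
    interpret twisted a b "2 * \<bar>\<epsilon>\<bar>"
      unfolding a_def b_def by (rule twisted_deformation[OF \<epsilon>])
    have "continuous_on UNIV (\<lambda>x. hr X0 + twist a b (x - X0))"
      by (intro continuous_intros bounded_linear.continuous_on[OF bounded_linear_twist])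
    then have "open W'"
      using open_vimage[OF \<open>open VC\<close>, of "\<lambda>x. hr X0 + twist a b (x - X0)"] by (simp add: W'_def vimage_def)
    moreover have "closure U \<subseteq> W'" using inV by (auto simp: W'_def hdef_eq)
    ultimately interpret deformed_contour U W' m D \<phi> a b "2 * \<bar>\<epsilon>\<bar>" VC fC X0
      using assms by unfold_locales (auto simp: W'_def)
    have ci: "chain_integral m D (\<lambda>i u. hdef \<epsilon> (hr X0) (hr (\<phi> i u))) (cauchy_fueter_form (hr X0) fC) = deformed_integral"
      unfolding deformed_integral_def hdef_eq ..
    have "hdef \<epsilon> (hr X0) (hr x) \<in> VC \<and> qnorm (hdef \<epsilon> (hr X0) (hr x) - hr X0) \<noteq> 0" if x: "x \<in> frontier U" for x
    proof
      show "hdef \<epsilon> (hr X0) (hr x) \<in> VC" using inV x by (simp add: frontier_def)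
      have "x \<noteq> X0" using x \<open>X0 \<notin> frontier U\<close> by blast
      then show "qnorm (hdef \<epsilon> (hr X0) (hr x) - hr X0) \<noteq> 0"
        by (simp add: hdef_eq qnorm_twist twist_norm_nonzero)
    qed
    moreover have "(- 1 / (2 * pi\<^sup>2)) *\<^sub>R deformed_integral = (if X0 \<in> U then f X0 else 0)"
    proof (cases "X0 \<in> U")
      case True
      then have "X0 \<in> closure U" using closure_subset by blast
      then have "fC (hr X0) = f X0" using assms(5,9,11) by blast
      then show ?thesis using True by (simp add: deformed_integral_inside)
    next
      case False
      then show ?thesis by (simp add: deformed_integral_outside)
    qed
    ultimately show "(\<forall>x\<in>frontier U. hdef \<epsilon> (hr X0) (hr x) \<in> VC \<and> qnorm (hdef \<epsilon> (hr X0) (hr x) - hr X0) \<noteq> 0) \<and>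
      (- 1 / (2 * pi\<^sup>2)) *\<^sub>R
        chain_integral m D (\<lambda>i u. hdef \<epsilon> (hr X0) (hr (\<phi> i u))) (cauchy_fueter_form (hr X0) fC)
      = (if X0 \<in> U then f X0 else 0)"
      unfolding ci by blast
  qed
qed

end
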